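(* There exists a simply connected smooth affine cubic surface $S\subset\mathbb{A}^3$ defined over $\mathbb{Q}$ such that the set $S(\mathbb{Z})$ is Zariski-dense in $S$ and thin (over $\mathbb{Q}$).
   Context: $S(\mathbb{Z})$ denotes the set of points of $S$ with coordinates in $\mathbb{Z}$. "Simply connected" means that the topological space $S(\mathbb{C})$ is simply connected. Thin sets: for an irreducible variety $Y$ over a number field $k$, a subset $Z\subset Y(k)$ is thin over $k$ if there exist a (possibly reducible) algebraic variety $X$ over $k$ of the same dimension as $Y$ and a rational map $f:X\to Y$ over $k$, admitting no rational section over $k$, such that $Z\subset f(X(k))$ (image of the rational points where $f$ is defined). *)

theory Defs
  imports "HOL-Analysis.Analysis" "HOL-Library.Poly_Mapping" "HOL-Library.Extended_Nat"
begin

text \<open>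
  Varieties over a subfield \<open>k\<close> of the complex numbers are treated classically: a variety is the
  set of its complex points, with a \<open>k\<close>-structure given by finitely many affine charts. Topology,
  regular functions and morphisms only involve polynomials with coefficients in \<open>k\<close>, so they are
  those of the associated reduced separated scheme of finite type over \<open>k\<close>.
\<close>

text \<open>An exponent vector is a finitely supported function on the variables \<open>0, 1, 2, \<dots>\<close>.\<close>

type_synonym mpoly = "(nat \<Rightarrow>\<^sub>0 nat) \<Rightarrow>\<^sub>0 complex"

definition peval :: "mpoly \<Rightarrow> (nat \<Rightarrow> complex) \<Rightarrow> complex" where
  "peval P v = (\<Sum>m\<in>Poly_Mapping.keys P.
     Poly_Mapping.lookup P m * (\<Prod>i\<in>Poly_Mapping.keys m. v i ^ Poly_Mapping.lookup m i))"

text \<open>\<open>polys k n\<close> is the ring \<open>k[x\<^sub>0, \<dots>, x\<^sub>n\<^sub>-\<^sub>1]\<close>.\<close>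

definition polys :: "complex set \<Rightarrow> nat \<Rightarrow> mpoly set" where
  "polys k n = {P. \<forall>m\<in>Poly_Mapping.keys P.
     Poly_Mapping.lookup P m \<in> k \<and> Poly_Mapping.keys m \<subseteq> {..<n}}"

definition total_degree :: "mpoly \<Rightarrow> nat" where
  "total_degree P = Max (insert 0
     ((\<lambda>m. \<Sum>i\<in>Poly_Mapping.keys m. Poly_Mapping.lookup m i) ` Poly_Mapping.keys P))"

text \<open>
  Points of affine \<open>n\<close>-space are sequences that vanish from index \<open>n\<close> on. The product topology on
  \<open>nat \<Rightarrow> complex\<close> induces on this set the Euclidean topology of complex \<open>n\<close>-space.
\<close>

definition affine_space :: "nat \<Rightarrow> (nat \<Rightarrow> complex) set" where
  "affine_space n = {v. \<forall>i\<ge>n. v i = 0}"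

definition hypersurface :: "nat \<Rightarrow> mpoly \<Rightarrow> (nat \<Rightarrow> complex) set" where
  "hypersurface n F = {v \<in> affine_space n. peval F v = 0}"

text \<open>The Jacobian criterion, applied to the equation \<open>F\<close> at all complex points.\<close>

definition smooth_hypersurface :: "nat \<Rightarrow> mpoly \<Rightarrow> bool" where
  "smooth_hypersurface n F \<longleftrightarrow>
     (\<forall>v\<in>hypersurface n F. \<exists>i<n. deriv (\<lambda>t. peval F (v(i := t))) (v i) \<noteq> 0)"

definition integral_points :: "(nat \<Rightarrow> complex) set \<Rightarrow> (nat \<Rightarrow> complex) set" where
  "integral_points S = {v \<in> S. \<forall>i. v i \<in> \<int>}"

text \<open>
  A chart consists of a set of points, the dimension of an ambient affine space and the
  coordinate map into that space. An atlas is a set of charts.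
\<close>

datatype 'a chart = Chart (cdom: "'a set") (cdim: nat) (cmap: "'a \<Rightarrow> nat \<Rightarrow> complex")

definition points :: "'a chart set \<Rightarrow> 'a set" where
  "points A = (\<Union>c\<in>A. cdom c)"

text \<open>
  The topology generated by the distinguished open sets of the charts. On affine space
  its closed sets are the zero sets of families of polynomials over \<open>k\<close>.
\<close>

definition zariski_topology :: "complex set \<Rightarrow> 'a chart set \<Rightarrow> 'a topology" where
  "zariski_topology k A = topology_generated_by
     {{x \<in> cdom c. peval P (cmap c x) \<noteq> 0} | c P. c \<in> A \<and> P \<in> polys k (cdim c)}"

definition affine_variety :: "nat \<Rightarrow> (nat \<Rightarrow> complex) set \<Rightarrow> (nat \<Rightarrow> complex) chart set" where
  "affine_variety n S = {Chart S n (\<lambda>v. v)}"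

definition algebraic_set :: "complex set \<Rightarrow> nat \<Rightarrow> (nat \<Rightarrow> complex) set \<Rightarrow> bool" where
  "algebraic_set k n Z \<longleftrightarrow> closedin (zariski_topology k (affine_variety n (affine_space n))) Z"

text \<open>Locally on \<open>U\<close>, the function \<open>g\<close> is a quotient of polynomials over \<open>k\<close> in the chart coordinates.\<close>

definition regular_on :: "complex set \<Rightarrow> 'a chart set \<Rightarrow> 'a set \<Rightarrow> ('a \<Rightarrow> complex) \<Rightarrow> bool" where
  "regular_on k A U g \<longleftrightarrow>
     (\<forall>c\<in>A. \<forall>x\<in>U \<inter> cdom c. \<exists>P\<in>polys k (cdim c). \<exists>Q\<in>polys k (cdim c).
        peval Q (cmap c x) \<noteq> 0 \<and>
        (\<forall>y\<in>U \<inter> cdom c. peval Q (cmap c y) \<noteq> 0 \<longrightarrow>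
           g y = peval P (cmap c y) / peval Q (cmap c y)))"

text \<open>
  The charts are closed in their affine spaces, they overlap in open sets with regular
  transition functions, and the last condition, that the overlap embeds as a closed subset of
  the product of the two charts, expresses separatedness. Varieties may be reducible.
\<close>

definition variety :: "complex set \<Rightarrow> 'a chart set \<Rightarrow> bool" where
  "variety k A \<longleftrightarrow> finite A \<and>
     (\<forall>c\<in>A. inj_on (cmap c) (cdom c) \<and> algebraic_set k (cdim c) (cmap c ` cdom c)) \<and>
     (\<forall>c\<in>A. \<forall>d\<in>A.
        openin (zariski_topology k {c}) (cdom c \<inter> cdom d) \<and>
        (\<forall>i<cdim d. regular_on k {c} (cdom c \<inter> cdom d) (\<lambda>x. cmap d x i)) \<and>
        algebraic_set k (cdim c + cdim d)
          ((\<lambda>x i. if i < cdim c then cmap c x i else cmap d x (i - cdim c)) ` (cdom c \<inter> cdom d)))"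

definition rational_points :: "complex set \<Rightarrow> 'a chart set \<Rightarrow> 'a set" where
  "rational_points k A = {x \<in> points A. \<forall>c\<in>A. x \<in> cdom c \<longrightarrow> (\<forall>i. cmap c x i \<in> k)}"

definition irreducible_closed :: "'a topology \<Rightarrow> 'a set \<Rightarrow> bool" where
  "irreducible_closed T Z \<longleftrightarrow> closedin T Z \<and> Z \<noteq> {} \<and>
     (\<forall>Z1 Z2. closedin T Z1 \<and> closedin T Z2 \<and> Z = Z1 \<union> Z2 \<longrightarrow> Z = Z1 \<or> Z = Z2)"

definition irreducible_variety :: "complex set \<Rightarrow> 'a chart set \<Rightarrow> bool" where
  "irreducible_variety k A \<longleftrightarrow>
     variety k A \<and> irreducible_closed (zariski_topology k A) (points A)"

definition krull_dim :: "'a topology \<Rightarrow> enat" where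
  "krull_dim T = Sup {enat n | n. \<exists>Z. (\<forall>i\<le>n. irreducible_closed T (Z i)) \<and>
     (\<forall>i<n. Z i \<subset> Z (Suc i))}"

definition zariski_dense :: "complex set \<Rightarrow> 'a chart set \<Rightarrow> 'a set \<Rightarrow> bool" where
  "zariski_dense k A Z \<longleftrightarrow> Z \<subseteq> points A \<and> zariski_topology k A closure_of Z = points A"

definition morphism_on ::
    "complex set \<Rightarrow> 'a chart set \<Rightarrow> 'a set \<Rightarrow> 'b chart set \<Rightarrow> ('a \<Rightarrow> 'b) \<Rightarrow> bool" where
  "morphism_on k X U Y f \<longleftrightarrow> f ` U \<subseteq> points Y \<and>
     (\<forall>d\<in>Y. openin (zariski_topology k X) {x \<in> U. f x \<in> cdom d} \<and>
        (\<forall>i<cdim d. regular_on k X {x \<in> U. f x \<in> cdom d} (\<lambda>x. cmap d (f x) i)))"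

text \<open>A rational map is represented by a morphism \<open>f\<close> on a dense open set \<open>U\<close>.\<close>

definition rational_map ::
    "complex set \<Rightarrow> 'a chart set \<Rightarrow> 'b chart set \<Rightarrow> 'a set \<Rightarrow> ('a \<Rightarrow> 'b) \<Rightarrow> bool" where
  "rational_map k X Y U f \<longleftrightarrow>
     openin (zariski_topology k X) U \<and> zariski_dense k X U \<and> morphism_on k X U Y f"

definition represents_same ::
    "complex set \<Rightarrow> 'a chart set \<Rightarrow> 'b chart set \<Rightarrow> 'a set \<Rightarrow> ('a \<Rightarrow> 'b) \<Rightarrow> 'a set \<Rightarrow> ('a \<Rightarrow> 'b) \<Rightarrow> bool" where
  "represents_same k X Y U f U' f' \<longleftrightarrow>
     rational_map k X Y U f \<and> rational_map k X Y U' f' \<and> (\<forall>x\<in>U \<inter> U'. f x = f' x)"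

text \<open>
  The map is defined at a point if some representative is. Hence the image of the rational points
  where the map is defined, and the composition with a section, range over all representatives.
\<close>

definition rational_image ::
    "complex set \<Rightarrow> 'a chart set \<Rightarrow> 'b chart set \<Rightarrow> 'a set \<Rightarrow> ('a \<Rightarrow> 'b) \<Rightarrow> 'b set" where
  "rational_image k X Y U f =
     {f' x | U' f' x. represents_same k X Y U f U' f' \<and> x \<in> U' \<inter> rational_points k X}"

definition has_rational_section ::
    "complex set \<Rightarrow> 'a chart set \<Rightarrow> 'b chart set \<Rightarrow> 'a set \<Rightarrow> ('a \<Rightarrow> 'b) \<Rightarrow> bool" where
  "has_rational_section k X Y U f \<longleftrightarrow>
     (\<exists>V s U' f'. rational_map k Y X V s \<and> represents_same k X Y U f U' f' \<and>
        s ` V \<subseteq> U' \<and> (\<forall>y\<in>V. f' (s y) = y))"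

text \<open>
  The covering variety \<open>X\<close> ranges over all varieties: since \<open>nat \<Rightarrow> complex\<close> has the cardinality of the
  continuum, every variety over \<open>k\<close> is isomorphic to one whose points have this type.
\<close>

definition thin :: "complex set \<Rightarrow> 'a chart set \<Rightarrow> 'a set \<Rightarrow> bool" where
  "thin k Y Z \<longleftrightarrow> irreducible_variety k Y \<and> Z \<subseteq> rational_points k Y \<and>
     (\<exists>(X :: (nat \<Rightarrow> complex) chart set) U f.
        variety k X \<and> krull_dim (zariski_topology k X) = krull_dim (zariski_topology k Y) \<and>
        rational_map k X Y U f \<and> \<not> has_rational_section k X Y U f \<and>
        Z \<subseteq> rational_image k X Y U f)"

end

theory Submission
  imports Defs "HOL-Computational_Algebra.Polynomial"
begin

text \<open>
  The surface is \<open>x\<^sup>2 + y\<^sup>2 = t (4xy + 1)\<close>. By Vieta jumping (as in problem 6 of the 1988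
  International Mathematical Olympiad) every integral point has a square as its \<open>t\<close>-coordinate,
  although \<open>t\<close> is not a square in the function field; so the integral points lift to the double
  cover \<open>t = w\<^sup>2\<close>, which is birational to the plane with coordinates \<open>w, s\<close>: \<open>s\<close> is the slope of a line through the
  point \<open>(0, w)\<close> of the conic over \<open>t = w\<^sup>2\<close>. Over each \<open>t = w\<^sup>2\<close>, \<open>w \<ge> 1\<close>, there are infinitely many
  integral points, whence density.

  Putting \<open>b = 1 + 4xy\<close> and \<open>a = 1 - 4xy + 16ty\<^sup>2\<close> one has \<open>ab = 1 + 16y\<^sup>4\<close>. The part where \<open>b\<close> avoids the
  closed negative real axis is a graph over a star-shaped set, and the part where \<open>y\<close> lies in the
  half-plane around one of the four zeros of \<open>1 + 16y\<^sup>4\<close> contracts to the node \<open>a = b = 0\<close> over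
  that zero. These five sets cover the surface and are glued by the theorem of Seifert and
  van Kampen.
\<close>

section \<open>Unions of simply connected sets\<close>

text \<open>The coefficient 4 serves the negative values of \<open>t\<close>. For x^2 + y^2 = t (xy
  + 1) the point (1, -2) has t = -5; with 4xy + 1 the descent also works for negative
  \<open>t\<close> and thereby excludes them. The jump x -> 4ty - x is an automorphism of the
  surface and recurs outside the arithmetic: \<open>a\<close> is the value of \<open>b\<close> after
  this jump, and the surface is covered by the graph chart b \<noteq> 0 together with its images
  under the jumps in x and in y. The obstacle to every argument with graphs is the hyperbola b = 0,
  over which there is either no point or, where also x^2 + y^2 = 0, a whole line. Irreducibility and
  density both rest on one fact: a rational function of one variable that is nonzero somewhere has
  finitely many zeros.\<close>

lemma simply_connected_imp_homotopic_paths_within: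
  fixes T :: "'a::real_normed_vector set"
  assumes "simply_connected T" "path_connected C" "C \<subseteq> T" "path r" "path_image r \<subseteq> T"
    "pathstart r \<in> C" "pathfinish r \<in> C"
  obtains r' where "path r'" "path_image r' \<subseteq> C" "homotopic_paths T r r'"
proof -
  obtain r' where r': "path r'" "path_image r' \<subseteq> C" "pathstart r' = pathstart r"
      "pathfinish r' = pathfinish r"
    using assms unfolding path_connected_def by metis
  then have "homotopic_paths T r r'"
    using assms(1,3-5) unfolding simply_connected_eq_homotopic_paths by blast
  then show thesis using that r' by blast
qed

text \<open>Continuous induction along \<open>p\<close>: every initial piece is homotopic to a path
  in \<open>S\<close>, or to a path in \<open>S\<close> followed by one in \<open>T\<close>,
  according to where it ends. On a return to \<open>S\<close> the part in \<open>T\<close> has both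
  ends in the overlap and is deformed into it, because \<open>T\<close> is simply connected and the
  overlap path connected. At the end the whole loop lies in \<open>S\<close> and contracts
  there.\<close>

lemma simply_connected_Un_aux:
  fixes S T :: "'a::real_normed_vector set"
  assumes S: "openin (top_of_set (S \<union> T)) S" "simply_connected S"
    and T: "openin (top_of_set (S \<union> T)) T" "simply_connected T"
    and C: "path_connected (S \<inter> T)"
    and p: "path p" "path_image p \<subseteq> S \<union> T" "pathfinish p = pathstart p" "pathstart p \<in> S"
  shows "homotopic_paths (S \<union> T) p (linepath (pathstart p) (pathstart p))"
proof -
  let ?U = "S \<union> T"
  define InS where "InS v \<longleftrightarrow> (\<exists>q. path q \<and> path_image q \<subseteq> S \<and>
    homotopic_paths ?U (subpath 0 v p) q)" for v
  define InST where "InST v \<longleftrightarrow> (\<exists>q r. path q \<and> path_image q \<subseteq> S \<and> path r \<and> path_image r \<subseteq> T \<and>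
    pathfinish q = pathstart r \<and> homotopic_paths ?U (subpath 0 v p) (q +++ r))" for v
  \<comment> \<open>On the overlap both forms are demanded, so that the next piece of
    \<open>p\<close> may run in either set.\<close>
  define Ext where "Ext v \<longleftrightarrow> (p v \<in> S \<longrightarrow> InS v) \<and> (p v \<in> T \<longrightarrow> InST v)" for v
  have S_imp_T: "InST v" if a: "p v \<in> T" "InS v" for v
  proof -
    obtain q where q: "path q" "path_image q \<subseteq> S" "homotopic_paths ?U (subpath 0 v p) q"
      using a(2) unfolding InS_def by blast
    have "homotopic_paths ?U q (q +++ linepath (pathfinish q) (pathfinish q))"
      using q by (intro homotopic_paths_sym[OF homotopic_paths_rid]) auto
    then have "homotopic_paths ?U (subpath 0 v p) (q +++ linepath (pathfinish q) (pathfinish q))"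
      using q homotopic_paths_trans by blast
    moreover have "pathfinish q = p v"
      using homotopic_paths_imp_pathfinish[OF q(3)] by simp
    ultimately show ?thesis
      unfolding InST_def using q that by (intro exI[of _ q] exI[of _ "linepath (p v) (p v)"]) auto
  qed
  have T_imp_S: "InS v" if a: "p v \<in> S" "p v \<in> T" "InST v" for v
  proof -
    obtain q r where q: "path q" "path_image q \<subseteq> S" "path r" "path_image r \<subseteq> T"
        "pathfinish q = pathstart r" "homotopic_paths ?U (subpath 0 v p) (q +++ r)"
      using a(3) unfolding InST_def by blast
    have "pathfinish r = p v"
      using homotopic_paths_imp_pathfinish[OF q(6)] by simp
    moreover have "pathstart r \<in> S \<inter> T"
      using q by (metis IntI pathfinish_in_path_image pathstart_in_path_image subsetD)
    ultimately obtain r' where r': "path r'" "path_image r' \<subseteq> S \<inter> T" "homotopic_paths T r r'"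
      using simply_connected_imp_homotopic_paths_within[OF T(2) C, of r] q(3,4) a(1,2) by auto
    have "homotopic_paths ?U (q +++ r) (q +++ r')"
      using q homotopic_paths_subset[OF r'(3), of ?U] by (intro homotopic_paths_join) auto
    then have "homotopic_paths ?U (subpath 0 v p) (q +++ r')"
      using q homotopic_paths_trans by blast
    moreover have "pathfinish q = pathstart r'"
      using homotopic_paths_imp_pathstart[OF r'(3)] q by simp
    ultimately show ?thesis
      unfolding InS_def using q r' by (intro exI[of _ "q +++ r'"]) (auto simp: path_image_join)
  qed
  have sub: "homotopic_paths ?U (subpath 0 v p +++ subpath v w p) (subpath 0 w p)"
      "path (subpath v w p)" "path_image (subpath v w p) = p ` {v..w}"
    if "0 \<le> v" "v \<le> w" "w \<le> 1" for v w
    using that p by (auto intro!: homotopic_join_subpaths simp: path_image_subpath)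
  have extS: "Ext w" if "Ext v" "0 \<le> v" "v \<le> w" "w \<le> 1" "p ` {v..w} \<subseteq> S" for v w
  proof -
    have "p v \<in> S" "p w \<in> S" using that by auto
    with that obtain q where q: "path q" "path_image q \<subseteq> S" "homotopic_paths ?U (subpath 0 v p) q"
      unfolding Ext_def InS_def by blast
    have e: "pathfinish q = p v"
      using homotopic_paths_imp_pathfinish[OF q(3)] by simp
    have "homotopic_paths ?U (subpath 0 v p +++ subpath v w p) (q +++ subpath v w p)"
      using q sub[of v w] that by (intro homotopic_paths_join) auto
    then have "homotopic_paths ?U (subpath 0 w p) (q +++ subpath v w p)"
      using sub[of v w] that by (meson homotopic_paths_sym homotopic_paths_trans)
    then have "InS w"
      unfolding InS_def using q sub[of v w] that e
      by (intro exI[of _ "q +++ subpath v w p"]) (auto simp: path_image_join)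
    then show ?thesis unfolding Ext_def using S_imp_T by blast
  qed
  have extT: "Ext w" if "Ext v" "0 \<le> v" "v \<le> w" "w \<le> 1" "p ` {v..w} \<subseteq> T" for v w
  proof -
    have pT: "p v \<in> T" "p w \<in> T" using that by auto
    with that obtain q r where q: "path q" "path_image q \<subseteq> S" "path r" "path_image r \<subseteq> T"
        "pathfinish q = pathstart r" "homotopic_paths ?U (subpath 0 v p) (q +++ r)"
      unfolding Ext_def InST_def by blast
    have e: "pathfinish r = p v"
      using homotopic_paths_imp_pathfinish[OF q(6)] by simp
    have "homotopic_paths ?U (subpath 0 v p +++ subpath v w p) ((q +++ r) +++ subpath v w p)"
      using q sub[of v w] that by (intro homotopic_paths_join) auto
    moreover have "homotopic_paths ?U (q +++ (r +++ subpath v w p)) ((q +++ r) +++ subpath v w p)"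
      using q sub[of v w] that e by (intro homotopic_paths_assoc) auto
    ultimately have "homotopic_paths ?U (subpath 0 w p) (q +++ (r +++ subpath v w p))"
      using sub[of v w] that by (meson homotopic_paths_sym homotopic_paths_trans)
    then have "InST w"
      unfolding InST_def using q sub[of v w] that e
      by (intro exI[of _ q] exI[of _ "r +++ subpath v w p"]) (auto simp: path_image_join)
    then show ?thesis unfolding Ext_def using T_imp_S pT by blast
  qed
  have "0 \<le> (0::real) \<and> (1::real) \<le> 1 \<longrightarrow> Ext 0 \<longrightarrow> Ext 1"
  \<comment> \<open>Bisection of [0, 1]: the passage of \<open>Ext\<close> from \<open>v\<close> to
    \<open>w\<close> composes over adjacent intervals, so short intervals suffice. The guard is
    there because short intervals around a point may leave [0, 1].\<close>
  proof (rule Bolzano[where P = "\<lambda>v w. 0 \<le> v \<and> w \<le> 1 \<longrightarrow> Ext v \<longrightarrow> Ext w"])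
    fix x :: real assume x: "0 \<le> x" "x \<le> 1"
    have cont: "continuous_on {0..1} p" using p path_def by blast
    have nbhd: "\<exists>d>0. \<forall>y\<in>{0..1}. \<bar>y - x\<bar> < d \<longrightarrow> p y \<in> V"
      if V: "openin (top_of_set ?U) V" "p x \<in> V" for V
    proof -
      have "p \<in> {0..1} \<rightarrow> ?U" using p by (auto simp: path_image_def)
      then have "openin (top_of_set {0..1}) ({0..1} \<inter> p -` V)"
        using cont V(1) continuous_openin_preimage by blast
      then show ?thesis
        using x V(2) unfolding openin_euclidean_subtopology_iff by (auto simp: dist_real_def)
    qed
    have "p x \<in> S \<or> p x \<in> T" using x p(2) unfolding path_image_def by force
    then obtain d where d: "d > 0"
      "(\<forall>y\<in>{0..1}. \<bar>y - x\<bar> < d \<longrightarrow> p y \<in> S) \<or> (\<forall>y\<in>{0..1}. \<bar>y - x\<bar> < d \<longrightarrow> p y \<in> T)"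
      using nbhd[OF S(1)] nbhd[OF T(1)] by blast
    have "Ext w" if "v \<le> x" "x \<le> w" "w - v < d" "0 \<le> v" "w \<le> 1" "Ext v" for v w
      using d(2)
    proof
      assume "\<forall>y\<in>{0..1}. \<bar>y - x\<bar> < d \<longrightarrow> p y \<in> S"
      then show ?thesis using that by (intro extS[of v w]) auto
    next
      assume "\<forall>y\<in>{0..1}. \<bar>y - x\<bar> < d \<longrightarrow> p y \<in> T"
      then show ?thesis using that by (intro extT[of v w]) auto
    qed
    then show "\<exists>d>0. \<forall>a b. a \<le> x \<and> x \<le> b \<and> b - a < d \<longrightarrow> 0 \<le> a \<and> b \<le> 1 \<longrightarrow> Ext a \<longrightarrow> Ext b"
      using d(1) by blast
  qed auto
  moreover have "Ext 0"
  proof -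
    have "InS 0"
      unfolding InS_def subpath_refl using p
      by (intro exI[of _ "linepath (p 0) (p 0)"]) (auto simp: pathstart_def)
    then show ?thesis unfolding Ext_def using S_imp_T by blast
  qed
  ultimately have "Ext 1" by simp
  then have "InS 1" unfolding Ext_def using p by (simp add: pathfinish_def)
  then obtain q where q: "path q" "path_image q \<subseteq> S" "homotopic_paths ?U p q"
    unfolding InS_def by auto
  then have "pathstart q = pathstart p" "pathfinish q = pathfinish p"
    using homotopic_paths_imp_pathfinish homotopic_paths_imp_pathstart by metis+
  then have "homotopic_paths S q (linepath (pathstart p) (pathstart p))"
    using S(2) q p simply_connected_eq_contractible_path by metis
  then show ?thesis
    using q(3) homotopic_paths_subset homotopic_paths_trans by blast
qed

theorem simply_connected_Un:
  fixes S T :: "'a::real_normed_vector set"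
  assumes S: "openin (top_of_set (S \<union> T)) S" "simply_connected S"
    and T: "openin (top_of_set (S \<union> T)) T" "simply_connected T"
    and C: "path_connected (S \<inter> T)" "S \<inter> T \<noteq> {}"
  shows "simply_connected (S \<union> T)"
  unfolding simply_connected_eq_contractible_path
proof (intro conjI allI impI)
  show "path_connected (S \<union> T)"
    using assms by (intro path_connected_Un) (auto intro: simply_connected_imp_path_connected)
next
  fix p assume "path p \<and> path_image p \<subseteq> S \<union> T \<and> pathfinish p = pathstart p"
  moreover from this have "pathstart p \<in> S \<or> pathstart p \<in> T" by auto
  ultimately show "homotopic_paths (S \<union> T) p (linepath (pathstart p) (pathstart p))"
    using simply_connected_Un_aux[of S T p] simply_connected_Un_aux[of T S p] assms
    by (auto simp: Un_commute Int_commute)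
qed

section \<open>Simple connectedness\<close>

text \<open>The library's theorems on simple connectedness need a normed space, which \<open>nat \<Rightarrow> complex\<close> is not.\<close>

definition surf :: "(complex \<times> complex \<times> complex) set" where
  "surf = {(x, y, t). x\<^sup>2 + y\<^sup>2 = t * (4 * x * y + 1)}"

definition surf_slit :: "(complex \<times> complex \<times> complex) set" where
  "surf_slit = {(x, y, t) \<in> surf. 1 + 4 * x * y \<notin> \<real>\<^sub>\<le>\<^sub>0}"

definition surf_half :: "complex \<Rightarrow> (complex \<times> complex \<times> complex) set" where
  "surf_half r = {(x, y, t) \<in> surf. Re (y * cnj r) > 0}"

text \<open>\<open>Re (y * cnj r)\<close> is the Euclidean inner product. The other roots
  \<open>- r\<close>, \<open>\<i> * r\<close> and \<open>- \<i> * r\<close> make no acute angle with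
  \<open>r\<close>.\<close>

lemma fourth_root_unique:
  fixes y r :: complex
  assumes "y ^ 4 = r ^ 4" "Re (y * cnj r) > 0"
  shows "y = r"
proof -
  have "(y - r) * (y + r) * (y - \<i> * r) * (y + \<i> * r) = y ^ 4 - r ^ 4"
    by (simp add: algebra_simps power_numeral_reduce)
  then have "y = r \<or> y = - r \<or> y = \<i> * r \<or> y = - \<i> * r"
    using assms(1) by (auto simp: eq_neg_iff_add_eq_0)
  moreover have "Re ((- r) * cnj r) \<le> 0" "Re (\<i> * r * cnj r) = 0" "Re (- \<i> * r * cnj r) = 0"
    by (auto simp: algebra_simps)
  ultimately show ?thesis using assms(2) by (metis less_irrefl not_less)
qed

lemma Re_mult_cnj_self_pos: "z \<noteq> 0 \<Longrightarrow> Re (z * cnj z) > 0"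
  by (simp add: complex_mod_cnj complex_norm_square[symmetric] del: complex_mult_cnj)

text \<open>The slit plane is star-shaped about 1: if 1 + su is real and nonpositive, then u is real
  and negative, so 1 + u lies at least as far left.\<close>

lemma nonpos_Reals_mono_scale:
  assumes "1 + of_real s * u \<in> (\<real>\<^sub>\<le>\<^sub>0 :: complex set)" "0 \<le> s" "s \<le> 1"
  shows "1 + u \<in> (\<real>\<^sub>\<le>\<^sub>0 :: complex set)"
proof -
  have e: "1 + s * Re u \<le> 0" "s * Im u = 0"
    using assms(1) by (auto simp: complex_nonpos_Reals_iff)
  then have "s \<noteq> 0" by auto
  then have "Im u = 0" using e by simp
  moreover have "Re u < 0"
  proof (rule ccontr)
    assume "\<not> Re u < 0"
    then have "0 \<le> s * Re u" using assms by simp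
    then show False using e by linarith
  qed
  then have "Re u \<le> s * Re u"
    using assms by (metis less_eq_real_def mult_le_cancel_right2 mult_1 mult.commute not_less)
  ultimately show ?thesis using e by (auto simp: complex_nonpos_Reals_iff)
qed

text \<open>The equation determines \<open>t\<close> here, so the part is a graph over
  \<open>?B\<close>. Shrinking (x, y) by a factor s multiplies xy by s^2, which moves 1 + 4xy
  straight towards 1 and hence not into the slit.\<close>

lemma simply_connected_surf_slit: "simply_connected surf_slit"
proof -
  let ?B = "{(x, y). 1 + 4 * x * y \<notin> (\<real>\<^sub>\<le>\<^sub>0 :: complex set)}"
  have "starlike ?B"
    unfolding starlike_def
  proof (rule bexI[of _ "(0, 0)"], safe)
    fix x y a b :: complex
    assume seg: "(a, b) \<in> closed_segment (0, 0) (x, y)" and nonpos: "1 + 4 * a * b \<in> \<real>\<^sub>\<le>\<^sub>0"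
      and B: "1 + 4 * x * y \<notin> \<real>\<^sub>\<le>\<^sub>0"
    obtain s where s: "0 \<le> s" "s \<le> 1" "a = of_real s * x" "b = of_real s * y"
      using seg by (auto simp: closed_segment_def scaleR_conv_of_real)
    have "1 + of_real (s * s) * (4 * x * y) \<in> (\<real>\<^sub>\<le>\<^sub>0 :: complex set)"
      using nonpos s by (simp add: algebra_simps)
    then show False
      using nonpos_Reals_mono_scale[of "s * s" "4 * x * y"] s B by (simp add: mult_le_one)
  qed auto
  then have "simply_connected ?B" by (rule starlike_imp_simply_connected)
  then show ?thesis
  proof (rule simply_connected_retraction_gen[where
        h = "\<lambda>(x, y). (x, y, (x\<^sup>2 + y\<^sup>2) / (1 + 4 * x * y))" and k = "\<lambda>(x, y, t). (x, y)"])
    have nz: "1 + 4 * x * y \<noteq> 0" if "1 + 4 * x * y \<notin> \<real>\<^sub>\<le>\<^sub>0" for x y :: complex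
      using that by auto
    show "continuous_on ?B (\<lambda>(x, y). (x, y, (x\<^sup>2 + y\<^sup>2) / (1 + 4 * x * y)))"
      unfolding case_prod_unfold by (intro continuous_intros) (auto dest: nz)
    show "(\<lambda>(x, y). (x, y, (x\<^sup>2 + y\<^sup>2) / (1 + 4 * x * y))) ` ?B = surf_slit"
    proof (intro equalityI subsetI)
      fix v assume "v \<in> surf_slit"
      then obtain x y t where v: "v = (x, y, t)" "1 + 4 * x * y \<notin> \<real>\<^sub>\<le>\<^sub>0"
          and e: "x\<^sup>2 + y\<^sup>2 = t * (1 + 4 * x * y)"
        by (auto simp: surf_slit_def surf_def add.commute)
      then have "t = (x\<^sup>2 + y\<^sup>2) / (1 + 4 * x * y)" using nz by simp
      then show "v \<in> (\<lambda>(x, y). (x, y, (x\<^sup>2 + y\<^sup>2) / (1 + 4 * x * y))) ` ?B"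
        using v by (intro image_eqI[of _ _ "(x, y)"]) auto
    qed (use nz in \<open>auto simp: surf_slit_def surf_def add.commute\<close>)
    show "continuous_on surf_slit (\<lambda>(x, y, t). (x, y))"
      unfolding case_prod_unfold by (intro continuous_intros)
  qed (auto simp: surf_slit_def surf_def add.commute)
qed

text \<open>On the half-plane 1 + 16 y^4 is y - r times \<open>h y\<close>, with \<open>h\<close>
  free of zeros; after absorbing \<open>h\<close> into \<open>a\<close> the equation reads ab = y -
  r. The set contracts to (0, 0, r) by scaling \<open>a\<close> and \<open>b\<close> by 1 - s and y
  - r by the square of that factor.\<close>

lemma contractible_node_family:
  fixes r :: complex
  assumes r: "16 * r ^ 4 = -1"
  shows "contractible {(a, b, y). a * b = 1 + 16 * y ^ 4 \<and> Re (y * cnj r) > 0}" (is "contractible ?N")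
proof -
  define h where "h y = 16 * (y + r) * (y\<^sup>2 + r\<^sup>2)" for y :: complex
  define H where "H = {y. Re (y * cnj r) > 0}"
  have fac: "1 + 16 * y ^ 4 = (y - r) * h y" for y
  proof -
    have "(y - r) * h y = 16 * y ^ 4 - 16 * r ^ 4"
      unfolding h_def by (simp add: algebra_simps power_numeral_reduce)
    then show ?thesis using r by simp
  qed
  have "r \<noteq> 0" using r by auto
  then have rH: "r \<in> H" using Re_mult_cnj_self_pos[of r] unfolding H_def by simp
  have hnz: "h y \<noteq> 0" if "y \<in> H" for y
  proof
    assume "h y = 0"
    then have "y + r = 0 \<or> y\<^sup>2 + r\<^sup>2 = 0" by (simp add: h_def del: distrib_left_numeral)
    moreover have "y ^ 4 - r ^ 4 = (y - r) * (y + r) * (y\<^sup>2 + r\<^sup>2)"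
      by (simp add: algebra_simps power_numeral_reduce)
    ultimately have "y ^ 4 = r ^ 4" by auto
    then have "y = r" using that fourth_root_unique by (auto simp: H_def)
    then show False using \<open>h y = 0\<close> \<open>r \<noteq> 0\<close> by (simp add: h_def)
  qed
  define Y where "Y s y = r + of_real ((1 - s)\<^sup>2) * (y - r)" for s :: real and y
  have YH: "Y s y \<in> H" if "y \<in> H" "0 \<le> s" "s \<le> 1" for s y
  proof -
    have u: "0 \<le> (1 - s)\<^sup>2" "(1 - s)\<^sup>2 \<le> 1"
      using that by (auto intro: power_le_one)
    have "Re (Y s y * cnj r) = (1 - (1 - s)\<^sup>2) * Re (r * cnj r) + (1 - s)\<^sup>2 * Re (y * cnj r)"
      unfolding Y_def by (simp add: algebra_simps)
    also have "\<dots> > 0"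
    proof (cases "(1 - s)\<^sup>2 = 0")
      case False
      then have "(1 - s)\<^sup>2 * Re (y * cnj r) > 0" using u that by (intro mult_pos_pos) (auto simp: H_def)
      moreover have "(1 - (1 - s)\<^sup>2) * Re (r * cnj r) \<ge> 0"
        using u rH by (intro mult_nonneg_nonneg) (auto simp: H_def)
      ultimately show ?thesis by linarith
    qed (use rH in \<open>auto simp: H_def\<close>)
    finally show ?thesis by (simp add: H_def)
  qed
  \<comment> \<open>The quotient of values of \<open>h\<close> undoes and redoes the absorption of
    \<open>h\<close> into \<open>a\<close> while \<open>y\<close> moves.\<close>
  define f where "f = (\<lambda>(s :: real, a :: complex, b :: complex, y).
    (of_real (1 - s) * a * h (Y s y) / h y, of_real (1 - s) * b, Y s y))"
  have "homotopic_with_canon (\<lambda>x. True) ?N ?N id (\<lambda>_. (0, 0, r))"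
    unfolding homotopic_with[where P = "\<lambda>x. True", simplified]
  proof (intro exI[of _ f] conjI)
    have "continuous_on ({0..1} \<times> ?N) f"
      unfolding f_def case_prod_unfold h_def Y_def
      by (intro continuous_intros) (use hnz in \<open>auto simp: h_def H_def\<close>)
    moreover have "f (s, a, b, y) \<in> ?N" if "s \<in> {0..1}" "(a, b, y) \<in> ?N" for s a b y
    proof -
      have y: "y \<in> H" using that by (simp add: H_def)
      have "of_real (1 - s) * a * h (Y s y) / h y * (of_real (1 - s) * b)
          = of_real ((1 - s)\<^sup>2) * (a * b) * h (Y s y) / h y"
        by (simp add: power2_eq_square)
      also have "a * b = (y - r) * h y" using that fac by simp
      also have "of_real ((1 - s)\<^sup>2) * ((y - r) * h y) * h (Y s y) / h y
          = (Y s y - r) * h (Y s y)"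
        using hnz[OF y] by (simp add: Y_def)
      finally show ?thesis
        using YH[of y s] y that by (simp add: f_def fac H_def)
    qed
    ultimately show "continuous_map (prod_topology (top_of_set {0..1}) (top_of_set ?N)) (top_of_set ?N) f"
      by (auto simp: prod_topology_subtopology_eu Pi_iff)
  qed (use hnz in \<open>auto simp: f_def Y_def H_def\<close>)
  then show ?thesis unfolding contractible_def by blast
qed

text \<open>As \<open>y\<close> is nonzero, (a, b, y) are coordinates: \<open>b\<close> gives
  \<open>x\<close>, and then \<open>a\<close> gives \<open>t\<close>. Here \<open>a\<close> is 1 +
  4zy for the second root z = 4ty - x of the equation as a quadratic in \<open>x\<close>; by x + z =
  4ty and xz = y^2 - t, \<open>t\<close> cancels from ab.\<close>

lemma simply_connected_surf_half:
  assumes r: "16 * r ^ 4 = -1"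
  shows "simply_connected (surf_half r)"
proof -
  let ?N = "{(a, b, y). a * b = 1 + 16 * y ^ 4 \<and> Re (y * cnj r) > 0}"
  let ?h = "\<lambda>(a, b, y). ((b - 1) / (4 * y), y, (a + b - 2) / (16 * y\<^sup>2))"
  let ?k = "\<lambda>(x, y, t). (1 - 4 * x * y + 16 * t * y\<^sup>2, 1 + 4 * x * y, y)"
  have nz: "y \<noteq> 0" if "Re (y * cnj r) > 0" for y using that by auto
  have h: "?h v \<in> surf_half r" if "v \<in> ?N" for v
  proof -
    obtain a b y where v: "v = (a, b, y)" by (cases v)
    then have ab: "a * b = 1 + 16 * y ^ 4" and y: "y \<noteq> 0" using that by auto
    have "((b - 1) / (4 * y))\<^sup>2 + y\<^sup>2 = (b\<^sup>2 - 2 * b + (1 + 16 * y ^ 4)) / (16 * y\<^sup>2)"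
      using y by (simp add: field_simps power_numeral_reduce)
    also have "\<dots> = (a + b - 2) / (16 * y\<^sup>2) * b"
      unfolding ab[symmetric] by (simp add: algebra_simps power2_eq_square)
    finally have "((b - 1) / (4 * y))\<^sup>2 + y\<^sup>2 = (a + b - 2) / (16 * y\<^sup>2) * b" .
    moreover have "4 * ((b - 1) / (4 * y)) * y + 1 = b" using y by (simp add: field_simps)
    ultimately show ?thesis using that unfolding v surf_half_def surf_def by (simp only: mem_Collect_eq prod.case)
  qed
  have k: "?k v \<in> ?N" "?h (?k v) = v" if "v \<in> surf_half r" for v
  proof -
    obtain x y t where v: "v = (x, y, t)" by (cases v)
    then have e: "x\<^sup>2 + y\<^sup>2 = t * (4 * x * y + 1)" and y: "Re (y * cnj r) > 0"
      using that by (auto simp: surf_half_def surf_def)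
    have "(1 - 4 * x * y + 16 * t * y\<^sup>2) * (1 + 4 * x * y)
        = 1 - 16 * x\<^sup>2 * y\<^sup>2 + 16 * y\<^sup>2 * (t * (4 * x * y + 1))"
      by (simp add: algebra_simps power2_eq_square)
    also have "\<dots> = 1 + 16 * y ^ 4"
      unfolding e[symmetric] by (simp add: algebra_simps power_numeral_reduce)
    finally show "?k v \<in> ?N" using y by (simp add: v)
    show "?h (?k v) = v" using nz[OF y] by (simp add: v)
  qed
  have "simply_connected ?N"
    using contractible_imp_simply_connected[OF contractible_node_family[OF r]] .
  then show ?thesis
  proof (rule simply_connected_retraction_gen[where h = ?h and k = ?k])
    show "continuous_on ?N ?h"
      unfolding case_prod_unfold by (intro continuous_intros) auto
    show "?h ` ?N = surf_half r"
      using h k by (fastforce simp: image_iff)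
    show "continuous_on (surf_half r) ?k"
      unfolding case_prod_unfold by (intro continuous_intros)
    show "?k \<in> surf_half r \<rightarrow> ?N" using k(1) by (rule Pi_I)
    show "?h (?k v) = v" if "v \<in> surf_half r" for v using k(2)[OF that] .
  qed
qed

text \<open>With \<open>y\<close> and b = 1 + 4xy nonzero, (b, y) determines \<open>x\<close> and
  then \<open>t\<close>, so the part is a continuous image of a product.\<close>

lemma path_connected_surf_part:
  assumes "path_connected Q" "path_connected B" "0 \<notin> Q" "0 \<notin> B"
  shows "path_connected {(x, y, t) \<in> surf. y \<in> Q \<and> 1 + 4 * x * y \<in> B}"
proof -
  let ?f = "\<lambda>(b, y). ((b - 1) / (4 * y), y, (((b - 1) / (4 * y))\<^sup>2 + y\<^sup>2) / b)"
  have "path_connected (?f ` (B \<times> Q))"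
    unfolding case_prod_unfold
    by (intro path_connected_continuous_image path_connected_Times continuous_intros)
       (use assms in auto)
  also have "?f ` (B \<times> Q) = {(x, y, t) \<in> surf. y \<in> Q \<and> 1 + 4 * x * y \<in> B}"
  proof (intro equalityI subsetI)
    fix v assume "v \<in> ?f ` (B \<times> Q)"
    then obtain b y where "b \<in> B" "y \<in> Q" and v: "v = ?f (b, y)" by auto
    moreover from this have "b \<noteq> 0" "y \<noteq> 0" using assms by auto
    moreover from this have "4 * ((b - 1) / (4 * y)) * y = b - 1" by (simp add: field_simps)
    ultimately show "v \<in> {(x, y, t) \<in> surf. y \<in> Q \<and> 1 + 4 * x * y \<in> B}"
      by (simp add: surf_def del: times_divide_eq_left times_divide_eq_right)
        (simp add: divide_simps)
  next
    fix v assume "v \<in> {(x, y, t) \<in> surf. y \<in> Q \<and> 1 + 4 * x * y \<in> B}"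
    then obtain x y t where v: "v = (x, y, t)" "y \<in> Q" "1 + 4 * x * y \<in> B"
        and e: "x\<^sup>2 + y\<^sup>2 = t * (1 + 4 * x * y)"
      by (auto simp: surf_def add.commute)
    moreover from this have "y \<noteq> 0" "1 + 4 * x * y \<noteq> 0" using assms by auto
    ultimately have "v = ?f (1 + 4 * x * y, y)" by simp
    then show "v \<in> ?f ` (B \<times> Q)" using v by blast
  qed
  finally show ?thesis .
qed

section \<open>Openness and overlaps of the pieces\<close>

lemma surf_part_nonempty: "((0::complex), y, y\<^sup>2) \<in> surf"
  by (simp add: surf_def)

lemma openin_surf:
  assumes "open B" "continuous_on UNIV f"
  shows "openin (top_of_set surf) {v \<in> surf. f v \<in> B}"
proof -
  have "open (f -` B)" using assms continuous_on_open_vimage by (metis Int_UNIV_right open_UNIV)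
  moreover have "{v \<in> surf. f v \<in> B} = surf \<inter> f -` B" by auto
  ultimately show ?thesis by (metis openin_open_Int)
qed

lemma openin_surf_slit: "openin (top_of_set surf) surf_slit"
proof -
  have "surf_slit = {v \<in> surf. 1 + 4 * fst v * fst (snd v) \<in> - \<real>\<^sub>\<le>\<^sub>0}"
    by (auto simp: surf_slit_def)
  moreover have "open (- (\<real>\<^sub>\<le>\<^sub>0 :: complex set))" by (simp add: open_Compl)
  ultimately show ?thesis
    using openin_surf[of "- \<real>\<^sub>\<le>\<^sub>0" "\<lambda>v. 1 + 4 * fst v * fst (snd v)"]
    by (simp add: continuous_intros)
qed

lemma openin_surf_half: "openin (top_of_set surf) (surf_half r)"
proof -
  have "surf_half r = {v \<in> surf. Re (fst (snd v) * cnj r) \<in> {0<..}}"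
    by (auto simp: surf_half_def)
  then show ?thesis
    using openin_surf[of "{0<..}" "\<lambda>v. Re (fst (snd v) * cnj r)"]
    by (simp add: continuous_intros)
qed

lemma path_connected_halfplane: "path_connected {y. Re (y * cnj r) > 0}"
proof -
  have "{y. Re (y * cnj r) > 0} = {y. inner r y > 0}"
    by (simp add: inner_complex_def mult.commute)
  then show ?thesis by (simp add: convex_imp_path_connected convex_halfspace_gt)
qed

lemma path_connected_halfplane_Int:
  "path_connected {y. Re (y * cnj r) > 0 \<and> Re (y * cnj s) > 0}"
proof -
  have "{y. Re (y * cnj r) > 0 \<and> Re (y * cnj s) > 0} = {y. inner r y > 0} \<inter> {y. inner s y > 0}"
    by (auto simp: inner_complex_def mult.commute)
  then show ?thesis by (simp add: convex_imp_path_connected convex_Int convex_halfspace_gt)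
qed

lemma path_connected_slit_half: "path_connected (surf_slit \<inter> surf_half r)"
proof -
  have "surf_slit \<inter> surf_half r
      = {(x, y, t) \<in> surf. y \<in> {y. Re (y * cnj r) > 0} \<and> 1 + 4 * x * y \<in> - \<real>\<^sub>\<le>\<^sub>0}"
    by (auto simp: surf_slit_def surf_half_def)
  moreover have "path_connected (- \<real>\<^sub>\<le>\<^sub>0 :: complex set)"
    using starlike_imp_path_connected[OF starlike_slotted_complex_plane_left[of 0]]
    by (simp add: nonpos_Reals_def image_def atMost_def Bex_def conj_commute)
  ultimately show ?thesis
    using path_connected_surf_part[OF path_connected_halfplane, of "- \<real>\<^sub>\<le>\<^sub>0" r] by simp
qed

text \<open>A point with 1 + 4xy = 0 has x^2 + y^2 = 0, which makes \<open>y\<close> a root of 1 +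
  16 y^4; lying in both half-planes, \<open>y\<close> would equal both \<open>r\<close> and
  \<open>s\<close>. So the overlap avoids the lines, and (b, y) parametrises all of it, over a
  convex set of \<open>y\<close> and a punctured plane of \<open>b\<close>.\<close>

lemma path_connected_half_half:
  assumes "16 * r ^ 4 = -1" "16 * s ^ 4 = -1" "r \<noteq> s"
  shows "path_connected (surf_half r \<inter> surf_half s)"
proof -
  have "1 + 4 * x * y \<noteq> 0" if "(x, y, t) \<in> surf_half r \<inter> surf_half s" for x y t
  proof
    assume b: "1 + 4 * x * y = 0"
    have "x\<^sup>2 + y\<^sup>2 = 0" using that b by (simp add: surf_half_def surf_def add.commute)
    then have "16 * y\<^sup>2 * (x\<^sup>2 + y\<^sup>2) = 0" by simp
    moreover have "16 * y\<^sup>2 * (x\<^sup>2 + y\<^sup>2) = (1 + 4 * x * y) * (4 * x * y - 1) + 1 + 16 * y ^ 4"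
      by (simp add: algebra_simps power_numeral_reduce)
    ultimately have "16 * y ^ 4 = -1" using b by (simp add: eq_neg_iff_add_eq_0 add.commute)
    then have "16 * y ^ 4 = 16 * r ^ 4" "16 * y ^ 4 = 16 * s ^ 4" using assms by metis+
    then have "y ^ 4 = r ^ 4" "y ^ 4 = s ^ 4" by simp_all
    then have "y = r" "y = s" using that fourth_root_unique by (auto simp: surf_half_def)
    then show False using assms by simp
  qed
  then have "surf_half r \<inter> surf_half s = {(x, y, t) \<in> surf.
      y \<in> {y. Re (y * cnj r) > 0 \<and> Re (y * cnj s) > 0} \<and> 1 + 4 * x * y \<in> - {0}}"
    by (auto simp: surf_half_def)
  moreover have "path_connected (- {0} :: complex set)"
    by (simp add: path_connected_punctured_universe)
  ultimately show ?thesis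
    using path_connected_surf_part[OF path_connected_halfplane_Int, of "- {0}" r s] by simp
qed

text \<open>When a half is added, its overlap with what is already there has to be path connected.
  The part of it in the slit piece is, and each overlap of two halves is attached to that part at a
  point with x = 0, where 1 + 4xy = 1.\<close>

lemma simply_connected_slit_Un_halves:
  assumes "finite R" "\<And>r. r \<in> R \<Longrightarrow> 16 * r ^ 4 = -1"
  shows "simply_connected (surf_slit \<union> (\<Union>r\<in>R. surf_half r))"
  using assms
proof (induction R)
  case empty
  then show ?case by (simp add: simply_connected_surf_slit)
next
  case (insert s R)
  let ?U = "surf_slit \<union> (\<Union>r\<in>R. surf_half r)"
  have s: "16 * s ^ 4 = -1" using insert by simp
  have sub: "?U \<union> surf_half s \<subseteq> surf" by (auto simp: surf_slit_def surf_half_def)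
  have "openin (top_of_set surf) ?U"
    by (intro openin_Un openin_Union) (auto intro: openin_surf_slit openin_surf_half)
  then have op: "openin (top_of_set (?U \<union> surf_half s)) ?U"
      "openin (top_of_set (?U \<union> surf_half s)) (surf_half s)"
    using openin_surf_half[of s] openin_subset_trans[OF _ _ sub] by auto
  have "s \<noteq> 0" using s by auto
  then have s_mem: "(0, s, s\<^sup>2) \<in> surf_slit \<inter> surf_half s"
    using surf_part_nonempty[of s] Re_mult_cnj_self_pos[of s]
    by (simp add: surf_slit_def surf_half_def)
  have pc: "path_connected (?U \<inter> surf_half s)"
    unfolding path_connected_component
  proof (intro ballI)
    have *: "path_component (?U \<inter> surf_half s) (0, s, s\<^sup>2) v" if v: "v \<in> ?U \<inter> surf_half s" for v
    proof -
      have "\<exists>W. path_connected W \<and> W \<subseteq> ?U \<inter> surf_half s \<and> (0, s, s\<^sup>2) \<in> W \<and> v \<in> W"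
      proof (cases "v \<in> surf_slit")
        case True
        then show ?thesis
          using path_connected_slit_half s_mem v by (intro exI[of _ "surf_slit \<inter> surf_half s"]) auto
      next
        case False
        then obtain r where r: "r \<in> R" "v \<in> surf_half r" using v by auto
        then have "path_connected (surf_half r \<inter> surf_half s)"
          using insert by (intro path_connected_half_half) auto
        moreover obtain x y t where xyt: "v = (x, y, t)" by (cases v)
        then have "(0, y, y\<^sup>2) \<in> surf_slit \<inter> surf_half s \<inter> (surf_half r \<inter> surf_half s)"
          using surf_part_nonempty[of y] r v by (simp add: surf_slit_def surf_half_def)
        ultimately have "path_connected (surf_slit \<inter> surf_half s \<union> surf_half r \<inter> surf_half s)"
          using path_connected_slit_half by (intro path_connected_Un) auto
        then show ?thesis
          using r s_mem v by (intro exI[of _ "surf_slit \<inter> surf_half s \<union> surf_half r \<inter> surf_half s"]) auto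
      qed
      then show ?thesis
        by (meson path_component_of_subset path_connected_component)
    qed
    show "path_component (?U \<inter> surf_half s) v w"
      if "v \<in> ?U \<inter> surf_half s" "w \<in> ?U \<inter> surf_half s" for v w
      using *[OF that(1)] *[OF that(2)] path_component_sym path_component_trans by blast
  qed
  have "simply_connected ?U" using insert by simp
  then have "simply_connected (?U \<union> surf_half s)"
    using op pc s_mem simply_connected_surf_half[OF s] by (intro simply_connected_Un[of ?U "surf_half s"]) auto
  then show ?case by (simp add: Un_ac)
qed

lemma simply_connected_surf: "simply_connected surf"
proof -
  \<comment> \<open>(1 + \<i>)^4 = -4 and the fourth power of the scalar is 1/64, so this is a root
    of 1 + 16 y^4.\<close>
  define r where "r = of_real (1 / (2 * sqrt 2)) * (1 + \<i>)"
  define R where "R = {r, \<i> * r, - r, - \<i> * r}"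
  have "(1 + \<i>) ^ 4 = -4" by (simp add: power_numeral_reduce algebra_simps)
  moreover have "(1 / (2 * sqrt 2)) ^ 4 = (1 / 64 :: real)"
    by (simp add: power_divide power_mult_distrib power_numeral_reduce)
  ultimately have r: "16 * r ^ 4 = -1"
    unfolding r_def power_mult_distrib of_real_power[symmetric] by (simp only:) simp
  then have "r \<noteq> 0" by auto
  have "16 * q ^ 4 = -1" if "q \<in> R" for q
    using that r by (auto simp: R_def power_mult_distrib)
  then have "simply_connected (surf_slit \<union> (\<Union>q\<in>R. surf_half q))"
    by (intro simply_connected_slit_Un_halves) (auto simp: R_def)
  moreover have "surf_slit \<union> (\<Union>q\<in>R. surf_half q) = surf"
  proof (intro equalityI subsetI)
    fix v assume v: "v \<in> surf"
    obtain x y t where xyt: "v = (x, y, t)" by (cases v)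
    show "v \<in> surf_slit \<union> (\<Union>q\<in>R. surf_half q)"
    proof (cases "y = 0")
      case True
      then show ?thesis using v xyt by (simp add: surf_slit_def)
    next
      case False
      \<comment> \<open>The four roots point along two perpendicular axes in both directions, so
        every nonzero \<open>y\<close> has a positive inner product with one of them.\<close>
      define z where "z = y * cnj r"
      have "z \<noteq> 0" using False \<open>r \<noteq> 0\<close> by (simp add: z_def)
      then have "Re z > 0 \<or> Re z < 0 \<or> Im z > 0 \<or> Im z < 0"
        by (metis complex_eqI linorder_neqE_linordered_idom zero_complex.simps)
      moreover have "Re (y * cnj r) = Re z" "Re (y * cnj (- r)) = - Re z"
          "Re (y * cnj (\<i> * r)) = Im z" "Re (y * cnj (- \<i> * r)) = - Im z"
        by (auto simp: z_def algebra_simps)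
      ultimately have "\<exists>q\<in>R. Re (y * cnj q) > 0" unfolding R_def by auto
      then show ?thesis using v xyt by (auto simp: surf_half_def)
    qed
  qed (auto simp: surf_slit_def surf_half_def)
  ultimately show ?thesis by simp
qed

section \<open>Polynomial functions\<close>

definition monom_eval :: "(nat \<Rightarrow>\<^sub>0 nat) \<Rightarrow> (nat \<Rightarrow> complex) \<Rightarrow> complex" where
  "monom_eval m v = (\<Prod>i\<in>Poly_Mapping.keys m. v i ^ Poly_Mapping.lookup m i)"

lemma monom_eval_superset:
  assumes "finite A" "Poly_Mapping.keys m \<subseteq> A"
  shows "monom_eval m v = (\<Prod>i\<in>A. v i ^ Poly_Mapping.lookup m i)"
  unfolding monom_eval_def
  by (rule prod.mono_neutral_left) (use assms in \<open>auto simp: in_keys_iff\<close>)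

lemma monom_eval_add: "monom_eval (m + m') v = monom_eval m v * monom_eval m' v"
proof -
  let ?A = "Poly_Mapping.keys m \<union> Poly_Mapping.keys m'"
  have "monom_eval (m + m') v = (\<Prod>i\<in>?A. v i ^ Poly_Mapping.lookup (m + m') i)"
    by (rule monom_eval_superset) (auto simp: Poly_Mapping.keys_add)
  also have "\<dots> = monom_eval m v * monom_eval m' v"
    by (simp add: monom_eval_superset[of ?A] lookup_add power_add prod.distrib)
  finally show ?thesis .
qed

lemma peval_superset:
  assumes "finite A" "Poly_Mapping.keys P \<subseteq> A"
  shows "peval P v = (\<Sum>m\<in>A. Poly_Mapping.lookup P m * monom_eval m v)"
  unfolding peval_def monom_eval_def[symmetric]
  by (rule sum.mono_neutral_left) (use assms in \<open>auto simp: in_keys_iff\<close>)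

lemma peval_zero [simp]: "peval 0 v = 0"
  by (simp add: peval_def)

lemma peval_single: "peval (Poly_Mapping.single m c) v = c * monom_eval m v"
  by (simp add: peval_def monom_eval_def)

lemma peval_add: "peval (P + Q) v = peval P v + peval Q v"
proof -
  let ?A = "Poly_Mapping.keys P \<union> Poly_Mapping.keys Q"
  have "peval (P + Q) v = (\<Sum>m\<in>?A. Poly_Mapping.lookup (P + Q) m * monom_eval m v)"
    by (rule peval_superset) (auto simp: Poly_Mapping.keys_add)
  then show ?thesis
    by (simp add: peval_superset[of ?A] lookup_add algebra_simps sum.distrib)
qed

lemma peval_sum: "peval (\<Sum>a\<in>A. f a) v = (\<Sum>a\<in>A. peval (f a) v)"
  by (induction A rule: infinite_finite_induct) (auto simp: peval_add)

lemma poly_mapping_sum_single: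
  "P = (\<Sum>m\<in>Poly_Mapping.keys P. Poly_Mapping.single m (Poly_Mapping.lookup P m))"
  by (rule poly_mapping_eqI) (simp add: lookup_sum lookup_single when_def in_keys_iff)

lemma peval_mult: "peval (P * Q) v = peval P v * peval Q v"
proof -
  have "P * Q = (\<Sum>m\<in>Poly_Mapping.keys P. \<Sum>m'\<in>Poly_Mapping.keys Q.
      Poly_Mapping.single (m + m') (Poly_Mapping.lookup P m * Poly_Mapping.lookup Q m'))"
    by (subst poly_mapping_sum_single[of P], subst poly_mapping_sum_single[of Q])
       (simp add: sum_product mult_single)
  then show ?thesis
    by (simp add: peval_sum peval_single monom_eval_add peval_def[of P] peval_def[of Q]
        monom_eval_def[symmetric] sum_product algebra_simps)
qed

lemma polys_add:
  assumes "P \<in> polys \<rat> n" "Q \<in> polys \<rat> n" shows "P + Q \<in> polys \<rat> n"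
proof -
  have *: "Poly_Mapping.lookup R m \<in> \<rat>" if "R \<in> polys \<rat> n" for R m
    using that by (cases "m \<in> Poly_Mapping.keys R") (auto simp: polys_def in_keys_iff)
  show ?thesis
    unfolding polys_def
  proof (intro CollectI ballI conjI)
    fix m assume "m \<in> Poly_Mapping.keys (P + Q)"
    then have "m \<in> Poly_Mapping.keys P \<or> m \<in> Poly_Mapping.keys Q"
      using Poly_Mapping.keys_add[of P Q] by blast
    then show "Poly_Mapping.keys m \<subseteq> {..<n}" using assms unfolding polys_def by blast
    show "Poly_Mapping.lookup (P + Q) m \<in> \<rat>" using * assms by (simp add: lookup_add)
  qed
qed

lemma polys_sum:
  assumes "\<And>a. a \<in> A \<Longrightarrow> f a \<in> polys \<rat> n" shows "(\<Sum>a\<in>A. f a) \<in> polys \<rat> n"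
  using assms
  by (induction A rule: infinite_finite_induct) (auto simp: polys_add, auto simp: polys_def)

lemma polys_single: "c \<in> \<rat> \<Longrightarrow> Poly_Mapping.keys m \<subseteq> {..<n} \<Longrightarrow> Poly_Mapping.single m c \<in> polys \<rat> n"
  by (auto simp: polys_def)

lemma polys_mult:
  assumes "P \<in> polys \<rat> n" "Q \<in> polys \<rat> n" shows "P * Q \<in> polys \<rat> n"
proof -
  have "P * Q = (\<Sum>m\<in>Poly_Mapping.keys P. \<Sum>m'\<in>Poly_Mapping.keys Q.
      Poly_Mapping.single (m + m') (Poly_Mapping.lookup P m * Poly_Mapping.lookup Q m'))"
    by (subst poly_mapping_sum_single[of P], subst poly_mapping_sum_single[of Q])
       (simp add: sum_product mult_single)
  moreover have "Poly_Mapping.single (m + m') (Poly_Mapping.lookup P m * Poly_Mapping.lookup Q m')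
      \<in> polys \<rat> n" if "m \<in> Poly_Mapping.keys P" "m' \<in> Poly_Mapping.keys Q" for m m'
    using that assms subset_trans[OF Poly_Mapping.keys_add[of m m'], of "{..<n}"]
    by (intro polys_single Rats_mult) (auto simp: polys_def)
  ultimately show ?thesis by (simp add: polys_sum)
qed

text \<open>Closure properties abstracted from the kind of function, so that one substitution
  argument serves rational polynomials in several variables, complex polynomials in one variable,
  and localisations of either.\<close>

definition fun_subring :: "(('a \<Rightarrow> complex) \<Rightarrow> bool) \<Rightarrow> bool" where
  "fun_subring C \<longleftrightarrow> C (\<lambda>_. 0) \<and> C (\<lambda>_. 1) \<and>
     (\<forall>f g. C f \<longrightarrow> C g \<longrightarrow> C (\<lambda>x. f x + g x)) \<and> (\<forall>f g. C f \<longrightarrow> C g \<longrightarrow> C (\<lambda>x. f x * g x))"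

lemma
  assumes "fun_subring C"
  shows fun_subring_0: "C (\<lambda>_. 0)" and fun_subring_1: "C (\<lambda>_. 1)"
    and fun_subring_add: "C f \<Longrightarrow> C g \<Longrightarrow> C (\<lambda>x. f x + g x)"
    and fun_subring_mult: "C f \<Longrightarrow> C g \<Longrightarrow> C (\<lambda>x. f x * g x)"
proof -
  note * = assms[unfolded fun_subring_def]
  show "C (\<lambda>_. 0)" by (rule *[THEN conjunct1])
  show "C (\<lambda>_. 1)" by (rule *[THEN conjunct2, THEN conjunct1])
  show "C f \<Longrightarrow> C g \<Longrightarrow> C (\<lambda>x. f x + g x)"
    by (rule *[THEN conjunct2, THEN conjunct2, THEN conjunct1, THEN spec, THEN spec, THEN mp, THEN mp])
  show "C f \<Longrightarrow> C g \<Longrightarrow> C (\<lambda>x. f x * g x)"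
    by (rule *[THEN conjunct2, THEN conjunct2, THEN conjunct2, THEN spec, THEN spec, THEN mp, THEN mp])
qed

lemma fun_subring_power:
  assumes "fun_subring C" "C f" shows "C (\<lambda>x. f x ^ N)"
proof (induction N)
  case 0
  show ?case unfolding power_0 by (rule fun_subring_1[OF assms(1)])
next
  case (Suc N)
  show ?case unfolding power_Suc by (rule fun_subring_mult[OF assms(1)]) (rule assms(2), rule Suc)
qed

lemma fun_subring_sum:
  assumes "fun_subring C" "\<And>a. a \<in> A \<Longrightarrow> C (f a)" shows "C (\<lambda>x. \<Sum>a\<in>A. f a x)"
  using assms(2)
proof (induction A rule: infinite_finite_induct)
  case (insert a A)
  then have "C (\<lambda>x. f a x + (\<Sum>a\<in>A. f a x))"
    by (intro fun_subring_add[OF assms(1)]) simp_all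
  then show ?case using insert by simp
qed (simp_all add: fun_subring_0[OF assms(1)])

lemma fun_subring_prod:
  assumes "fun_subring C" "\<And>a. a \<in> A \<Longrightarrow> C (f a)" shows "C (\<lambda>x. \<Prod>a\<in>A. f a x)"
  using assms(2)
proof (induction A rule: infinite_finite_induct)
  case (insert a A)
  then have "C (\<lambda>x. f a x * (\<Prod>a\<in>A. f a x))"
    by (intro fun_subring_mult[OF assms(1)]) simp_all
  then show ?case using insert by simp
qed (simp_all add: fun_subring_1[OF assms(1)])

lemma fun_subring_peval:
  assumes C: "fun_subring C" and P: "P \<in> polys k n" and "\<And>c. c \<in> k \<Longrightarrow> C (\<lambda>_. c)"
    "\<And>i. i < n \<Longrightarrow> C (\<lambda>x. \<phi> x i)"
  shows "C (\<lambda>x. peval P (\<phi> x))"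
  unfolding peval_def
proof (intro fun_subring_sum[OF C] fun_subring_mult[OF C] fun_subring_prod[OF C] fun_subring_power[OF C])
  fix m i assume m: "m \<in> Poly_Mapping.keys P"
  then show "C (\<lambda>_. Poly_Mapping.lookup P m)" using P assms(3) by (auto simp: polys_def)
  assume "i \<in> Poly_Mapping.keys m"
  then show "C (\<lambda>x. \<phi> x i)" using P m assms(4) by (auto simp: polys_def)
qed

text \<open>The Zariski topology only sees values, and identities between functions can be checked
  pointwise in the complex numbers.\<close>

definition polyfun :: "nat \<Rightarrow> ((nat \<Rightarrow> complex) \<Rightarrow> complex) \<Rightarrow> bool" where
  "polyfun n f \<longleftrightarrow> (\<exists>P\<in>polys \<rat> n. \<forall>v. peval P v = f v)"

lemma polyfun_peval: "P \<in> polys \<rat> n \<Longrightarrow> polyfun n (peval P)"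
  by (auto simp: polyfun_def)

lemma polyfun_const: "c \<in> \<rat> \<Longrightarrow> polyfun n (\<lambda>_. c)"
  unfolding polyfun_def
  by (intro bexI[of _ "Poly_Mapping.single 0 c"]) (auto simp: peval_single monom_eval_def polys_single)

lemma polyfun_var: "i < n \<Longrightarrow> polyfun n (\<lambda>v. v i)"
  unfolding polyfun_def
  by (intro bexI[of _ "Poly_Mapping.single (Poly_Mapping.single i 1) 1"])
     (auto simp: peval_single monom_eval_def intro!: polys_single)

lemma fun_subring_polyfun: "fun_subring (polyfun n)"
  unfolding fun_subring_def
proof (intro conjI allI impI)
  fix f g assume "polyfun n f" "polyfun n g"
  then obtain P Q where "P \<in> polys \<rat> n" "\<forall>v. peval P v = f v" "Q \<in> polys \<rat> n" "\<forall>v. peval Q v = g v"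
    by (auto simp: polyfun_def)
  then have "P + Q \<in> polys \<rat> n" "\<forall>v. peval (P + Q) v = f v + g v"
      "P * Q \<in> polys \<rat> n" "\<forall>v. peval (P * Q) v = f v * g v"
    by (auto simp: polys_add polys_mult peval_add peval_mult)
  then show "polyfun n (\<lambda>x. f x + g x)" "polyfun n (\<lambda>x. f x * g x)"
    unfolding polyfun_def by blast+
qed (auto intro: polyfun_const)

lemmas polyfun_add = fun_subring_add[OF fun_subring_polyfun]
  and polyfun_mult = fun_subring_mult[OF fun_subring_polyfun]
  and polyfun_power = fun_subring_power[OF fun_subring_polyfun]

lemma polyfun_uminus: "polyfun n f \<Longrightarrow> polyfun n (\<lambda>x. - f x)"
  using polyfun_mult[OF polyfun_const[of "-1"], of n f] by simp

lemma polyfun_diff: "polyfun n f \<Longrightarrow> polyfun n g \<Longrightarrow> polyfun n (\<lambda>x. f x - g x)"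
  using polyfun_add[OF _ polyfun_uminus, of n f g] by simp

lemmas polyfun_intros = polyfun_const polyfun_var polyfun_add polyfun_mult polyfun_power
  polyfun_uminus polyfun_diff

text \<open>Pull-back of a polynomial function along \<open>\<phi>\<close>. With \<open>C\<close> a
  localisation, \<open>\<phi>\<close> may be a rational map or a rational curve, and the result is
  again a fraction over a power of the same denominator.\<close>

lemma polyfun_compose:
  assumes "polyfun n f" "fun_subring C" "\<And>c. c \<in> \<rat> \<Longrightarrow> C (\<lambda>_. c)" "\<And>i. i < n \<Longrightarrow> C (\<lambda>x. \<phi> x i)"
  shows "C (\<lambda>x. f (\<phi> x))"
proof -
  obtain P where P: "P \<in> polys \<rat> n" "\<And>v. peval P v = f v"
    using assms(1) by (auto simp: polyfun_def)
  show ?thesis using fun_subring_peval[where C = C and \<phi> = \<phi>, OF assms(2) P(1) assms(3,4)] by (simp add: P(2))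
qed

text \<open>\<open>frac_fun C q\<close> is the localisation of the function ring \<open>C\<close> at \<open>q\<close>; only values off the zeros of
  \<open>q\<close> matter.\<close>

definition frac_fun :: "(('a \<Rightarrow> complex) \<Rightarrow> bool) \<Rightarrow> ('a \<Rightarrow> complex) \<Rightarrow> ('a \<Rightarrow> complex) \<Rightarrow> bool" where
  "frac_fun C q f \<longleftrightarrow> (\<exists>N p. C p \<and> (\<forall>x. q x \<noteq> 0 \<longrightarrow> f x * q x ^ N = p x))"

lemma frac_funI0: "C f \<Longrightarrow> frac_fun C q f"
  unfolding frac_fun_def by (rule exI[of _ 0]) auto

lemma frac_fun_divide: "C p \<Longrightarrow> frac_fun C q (\<lambda>x. p x / q x)"
  unfolding frac_fun_def by (intro exI[of _ 1] exI[of _ p]) auto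

lemma fun_subring_frac_fun:
  assumes C: "fun_subring C" and q: "C q"
  shows "fun_subring (frac_fun C q)"
  unfolding fun_subring_def
proof (intro conjI allI impI)
  fix f g assume f: "frac_fun C q f" and g: "frac_fun C q g"
  from f obtain N p where p: "C p" "\<forall>x. q x \<noteq> 0 \<longrightarrow> f x * q x ^ N = p x"
    unfolding frac_fun_def by blast
  from g obtain M r where r: "C r" "\<forall>x. q x \<noteq> 0 \<longrightarrow> g x * q x ^ M = r x"
    unfolding frac_fun_def by blast
  have "(f x + g x) * q x ^ (N + M) = p x * q x ^ M + r x * q x ^ N" if "q x \<noteq> 0" for x
    using p(2)[rule_format, OF that, symmetric] r(2)[rule_format, OF that, symmetric]
    by (simp add: algebra_simps power_add)
  moreover have "C (\<lambda>x. p x * q x ^ M)" "C (\<lambda>x. r x * q x ^ N)"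
    using fun_subring_mult[where C = C, OF C] fun_subring_power[where C = C, OF C q] p(1) r(1) by blast+
  then have "C (\<lambda>x. p x * q x ^ M + r x * q x ^ N)"
    by (rule fun_subring_add[where C = C, OF C])
  ultimately show "frac_fun C q (\<lambda>x. f x + g x)"
    unfolding frac_fun_def by (intro exI[of _ "N + M"] exI[of _ "\<lambda>x. p x * q x ^ M + r x * q x ^ N"] conjI allI impI)
  have "f x * g x * q x ^ (N + M) = p x * r x" if "q x \<noteq> 0" for x
    using p(2)[rule_format, OF that, symmetric] r(2)[rule_format, OF that, symmetric]
    by (simp add: algebra_simps power_add)
  moreover have "C (\<lambda>x. p x * r x)"
    by (rule fun_subring_mult[where C = C, OF C p(1) r(1)])
  ultimately show "frac_fun C q (\<lambda>x. f x * g x)"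
    unfolding frac_fun_def by (intro exI[of _ "N + M"] exI[of _ "\<lambda>x. p x * r x"] conjI allI impI)
qed (rule frac_funI0, rule fun_subring_0[OF C] fun_subring_1[OF C])+

section \<open>The Zariski topology of an affine variety\<close>

abbreviation zar :: "nat \<Rightarrow> (nat \<Rightarrow> complex) set \<Rightarrow> (nat \<Rightarrow> complex) topology" where
  "zar n S \<equiv> zariski_topology \<rat> (affine_variety n S)"

lemma zar_eq: "zar n S = topology_generated_by {{x \<in> S. peval P x \<noteq> 0} | P. P \<in> polys \<rat> n}"
  by (simp add: zariski_topology_def affine_variety_def)

lemma openin_zar_polyfun: "polyfun n f \<Longrightarrow> openin (zar n S) {x \<in> S. f x \<noteq> 0}"
proof -
  assume "polyfun n f"
  then obtain P where "P \<in> polys \<rat> n" "\<forall>v. peval P v = f v" unfolding polyfun_def by blast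
  then have "{x \<in> S. f x \<noteq> 0} \<in> {{x \<in> S. peval P x \<noteq> 0} | P. P \<in> polys \<rat> n}"
    by (intro CollectI exI[of _ P]) auto
  then show ?thesis unfolding zar_eq by (rule topology_generated_by_Basis)
qed

text \<open>A product is nonzero exactly where its factors are, so the generating sets are closed
  under binary intersection and form a basis.\<close>

lemma openin_zar_imp:
  assumes "openin (zar n S) U" "x \<in> U"
  shows "\<exists>f. polyfun n f \<and> f x \<noteq> 0 \<and> {y \<in> S. f y \<noteq> 0} \<subseteq> U"
proof -
  have "generate_topology_on {{x \<in> S. peval P x \<noteq> 0} | P. P \<in> polys \<rat> n} U"
    using assms unfolding zar_eq openin_topology_generated_by_iff by simp
  then show ?thesis
    using assms(2)
  proof (induction arbitrary: x)
    case (Int a b)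
    obtain f where f: "polyfun n f" "f x \<noteq> 0" "{y \<in> S. f y \<noteq> 0} \<subseteq> a"
      using Int.IH(1)[of x] Int.prems by blast
    obtain g where g: "polyfun n g" "g x \<noteq> 0" "{y \<in> S. g y \<noteq> 0} \<subseteq> b"
      using Int.IH(2)[of x] Int.prems by blast
    show ?case
      using f g polyfun_mult[OF f(1) g(1)] by (intro exI[of _ "\<lambda>y. f y * g y"]) auto
  next
    case (UN K)
    then obtain k where "k \<in> K" "x \<in> k" by blast
    then show ?case using UN.IH[of k x] by blast
  next
    case (Basis s)
    then obtain P where "s = {x \<in> S. peval P x \<noteq> 0}" "P \<in> polys \<rat> n" by blast
    then show ?case using Basis polyfun_peval by (intro exI[of _ "peval P"]) auto
  qed auto
qed

lemma topspace_zar [simp]: "topspace (zar n S) = S"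
proof -
  have "openin (zar n S) S" using openin_zar_polyfun[OF polyfun_const[of 1], of n S] by simp
  moreover have "topspace (zar n S) \<subseteq> S"
    unfolding zar_eq topology_generated_by_topspace by auto
  ultimately show ?thesis using openin_subset by blast
qed

lemma openin_zar_iff:
  "openin (zar n S) U \<longleftrightarrow> U \<subseteq> S \<and>
     (\<forall>x\<in>U. \<exists>f. polyfun n f \<and> f x \<noteq> 0 \<and> {y \<in> S. f y \<noteq> 0} \<subseteq> U)"
proof (intro iffI conjI)
  assume R: "U \<subseteq> S \<and> (\<forall>x\<in>U. \<exists>f. polyfun n f \<and> f x \<noteq> 0 \<and> {y \<in> S. f y \<noteq> 0} \<subseteq> U)"
  show "openin (zar n S) U"
  proof (subst openin_subopen, intro ballI)
    fix x assume "x \<in> U"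
    then obtain f where "polyfun n f" "f x \<noteq> 0" "{y \<in> S. f y \<noteq> 0} \<subseteq> U" using R by blast
    then show "\<exists>T. openin (zar n S) T \<and> x \<in> T \<and> T \<subseteq> U"
      using openin_zar_polyfun[of n f S] \<open>x \<in> U\<close> R by (intro exI[of _ "{y \<in> S. f y \<noteq> 0}"]) auto
  qed
qed (use openin_subset[of "zar n S"] openin_zar_imp in auto)

lemma algebraic_setI:
  assumes "\<And>f. f \<in> E \<Longrightarrow> polyfun n f" "Z = {v \<in> affine_space n. \<forall>f\<in>E. f v = 0}"
  shows "algebraic_set \<rat> n Z"
  unfolding algebraic_set_def closedin_def openin_zar_iff using assms by fastforce

lemma regular_on_frac:
  assumes "polyfun n q" "frac_fun (polyfun n) q f" "\<And>x. x \<in> U \<Longrightarrow> q x \<noteq> 0"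
  shows "regular_on \<rat> (affine_variety n S) U f"
proof -
  obtain N p where p: "polyfun n p" "\<forall>x. q x \<noteq> 0 \<longrightarrow> f x * q x ^ N = p x"
    using assms(2) unfolding frac_fun_def by blast
  obtain P where P: "P \<in> polys \<rat> n" "\<forall>v. peval P v = p v"
    using p(1) unfolding polyfun_def by blast
  obtain Q where Q: "Q \<in> polys \<rat> n" "\<forall>v. peval Q v = q v ^ N"
    using polyfun_power[OF assms(1), of N] unfolding polyfun_def by blast
  have "f y = peval P y / peval Q y" if "y \<in> U" for y
    using p(2) assms(3)[OF that] by (simp add: P(2) Q(2) nonzero_eq_divide_eq)
  moreover have "peval Q y \<noteq> 0" if "y \<in> U" for y
    using assms(3)[OF that] by (simp add: Q(2))
  ultimately show ?thesis
    unfolding regular_on_def affine_variety_def using P(1) Q(1) by auto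
qed

lemma regular_on_polyfun: "polyfun n f \<Longrightarrow> regular_on \<rat> (affine_variety n S) U f"
  using regular_on_frac[OF polyfun_const[of 1] frac_funI0, of n f] by simp

lemma regular_on_imp:
  assumes "regular_on \<rat> (affine_variety n S) U f" "U \<subseteq> S" "x \<in> U"
  obtains p q where "polyfun n p" "polyfun n q" "q x \<noteq> 0"
    "\<And>y. y \<in> U \<Longrightarrow> q y \<noteq> 0 \<Longrightarrow> f y = p y / q y"
proof -
  have "x \<in> U \<inter> S" using assms by auto
  then obtain P Q where "P \<in> polys \<rat> n" "Q \<in> polys \<rat> n" "peval Q x \<noteq> 0"
    "\<And>y. y \<in> U \<inter> S \<Longrightarrow> peval Q y \<noteq> 0 \<Longrightarrow> f y = peval P y / peval Q y"
    using assms(1) unfolding regular_on_def affine_variety_def by fastforce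
  then show thesis using that[of "peval P" "peval Q"] assms(2) polyfun_peval by blast
qed

lemma variety_affine:
  assumes E: "\<And>f. f \<in> E \<Longrightarrow> polyfun n f" and S: "S = {v \<in> affine_space n. \<forall>f\<in>E. f v = 0}"
  shows "variety \<rat> (affine_variety n S)"
proof -
  define D where "D = (\<lambda>x i. if i < n then x i else x (i - n)) ` S"
  \<comment> \<open>Equations of the diagonal, which express separatedness: those of
    \<open>S\<close> in the first \<open>n\<close> coordinates, and equality of the two
    blocks.\<close>
  define E' where "E' = {g. \<exists>f\<in>E. g = (\<lambda>v. f (\<lambda>i. if i < n then v i else 0))} \<union>
    {g. \<exists>i<n. g = (\<lambda>v. v i - v (n + i))}"
  have E': "polyfun (n + n) g" if "g \<in> E'" for g
  proof -
    have "polyfun (n + n) (\<lambda>v. f (\<lambda>i. if i < n then v i else 0))" if "f \<in> E" for f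
    proof (rule polyfun_compose[where C = "polyfun (n + n)", OF E[OF that] fun_subring_polyfun polyfun_const])
      fix i assume "i < n"
      then show "polyfun (n + n) (\<lambda>v. if i < n then v i else 0)" by (simp add: polyfun_var)
    qed
    moreover have "polyfun (n + n) (\<lambda>v. v i - v (n + i))" if "i < n" for i
      using that by (intro polyfun_diff polyfun_var) auto
    ultimately show ?thesis using that unfolding E'_def by blast
  qed
  have "D = {v \<in> affine_space (n + n). \<forall>g\<in>E'. g v = 0}"
  proof (intro equalityI subsetI)
    fix w assume "w \<in> D"
    then obtain v where v: "v \<in> S" "w = (\<lambda>i. if i < n then v i else v (i - n))" by (auto simp: D_def)
    then have wv: "(\<lambda>i. if i < n then w i else 0) = v" by (auto simp: S affine_space_def fun_eq_iff)
    have "g w = 0" if "g \<in> E'" for g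
      using that unfolding E'_def
    proof
      assume "g \<in> {g. \<exists>f\<in>E. g = (\<lambda>v. f (\<lambda>i. if i < n then v i else 0))}"
      then show ?thesis using v(1) wv by (auto simp: S)
    qed (auto simp: v(2))
    moreover have "w \<in> affine_space (n + n)" using v by (auto simp: S affine_space_def)
    ultimately show "w \<in> {v \<in> affine_space (n + n). \<forall>g\<in>E'. g v = 0}" by blast
  next
    fix w assume w: "w \<in> {v \<in> affine_space (n + n). \<forall>g\<in>E'. g v = 0}"
    define v where "v = (\<lambda>i. if i < n then w i else 0)"
    have "v \<in> S" using w by (auto simp: E'_def S affine_space_def v_def)
    moreover have eq: "w i = w (n + i)" if "i < n" for i
    proof -
      have "(\<lambda>v. v i - v (n + i)) \<in> E'" using that by (auto simp: E'_def)
      then show ?thesis using w by auto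
    qed
    have "w = (\<lambda>i. if i < n then v i else v (i - n))"
    proof
      fix i
      consider "i < n" | "n \<le> i" "i < n + n" | "n + n \<le> i" by linarith
      then show "w i = (if i < n then v i else v (i - n))"
        using eq[of "i - n"] w by cases (auto simp: v_def affine_space_def)
    qed
    ultimately show "w \<in> D" by (auto simp: D_def)
  qed
  then have "algebraic_set \<rat> (n + n) D" using algebraic_setI[of E' "n + n" D] E' by simp
  moreover have "algebraic_set \<rat> n S" using algebraic_setI[OF E S] .
  moreover have "openin (zar n S) S" using openin_topspace[of "zar n S"] by simp
  moreover have "regular_on \<rat> (affine_variety n S) S (\<lambda>x. x i)" if "i < n" for i
    using that by (intro regular_on_polyfun polyfun_var)
  ultimately show ?thesis
    by (simp add: variety_def affine_variety_def D_def cong: if_cong)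
qed

lemma continuous_map_zar:
  assumes q: "polyfun n q" and \<phi>: "\<And>i. i < m \<Longrightarrow> frac_fun (polyfun n) q (\<lambda>x. \<phi> x i)"
    and im: "\<And>x. x \<in> S \<Longrightarrow> q x \<noteq> 0 \<Longrightarrow> \<phi> x \<in> T"
  shows "continuous_map (subtopology (zar n S) {x \<in> S. q x \<noteq> 0}) (zar m T) \<phi>"
  unfolding continuous_map_def
proof (intro conjI allI impI)
  show "\<phi> \<in> topspace (subtopology (zar n S) {x \<in> S. q x \<noteq> 0}) \<rightarrow> topspace (zar m T)"
    using im by auto
  fix W assume W: "openin (zar m T) W"
  let ?U = "{x \<in> S. q x \<noteq> 0}"
  have "openin (zar n S) {x \<in> ?U. \<phi> x \<in> W}"
    unfolding openin_zar_iff
  proof (intro conjI ballI)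
    fix x assume x: "x \<in> {x \<in> ?U. \<phi> x \<in> W}"
    then obtain f where f: "polyfun m f" "f (\<phi> x) \<noteq> 0" "{y \<in> T. f y \<noteq> 0} \<subseteq> W"
      using openin_zar_imp[OF W] by blast
    have "frac_fun (polyfun n) q (\<lambda>x. f (\<phi> x))"
      by (rule polyfun_compose[where C = "frac_fun (polyfun n) q", OF f(1)
            fun_subring_frac_fun[where C = "polyfun n", OF fun_subring_polyfun q]
            frac_funI0[where C = "polyfun n", OF polyfun_const] \<phi>])
    then obtain N p where p: "polyfun n p" "\<forall>x. q x \<noteq> 0 \<longrightarrow> f (\<phi> x) * q x ^ N = p x"
      unfolding frac_fun_def by blast
    show "\<exists>g. polyfun n g \<and> g x \<noteq> 0 \<and> {y \<in> S. g y \<noteq> 0} \<subseteq> {x \<in> ?U. \<phi> x \<in> W}"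
    \<comment> \<open>\<open>p\<close> represents \<open>f\<close> after \<open>\<phi>\<close> only
      off the zeros of \<open>q\<close>; the factor \<open>q\<close> keeps the basic open set inside
      that region.\<close>
    proof (intro exI[of _ "\<lambda>x. p x * q x"] conjI subsetI)
      show "polyfun n (\<lambda>x. p x * q x)" using p q by (intro polyfun_mult)
      show "p x * q x \<noteq> 0" using x f(2) p(2) by auto
      fix y assume y: "y \<in> {y \<in> S. p y * q y \<noteq> 0}"
      then have "f (\<phi> y) \<noteq> 0" using p(2) by auto
      then show "y \<in> {x \<in> ?U. \<phi> x \<in> W}" using y f(3) im by auto
    qed
  qed auto
  then show "openin (subtopology (zar n S) ?U)
      {x \<in> topspace (subtopology (zar n S) ?U). \<phi> x \<in> W}"
    by (auto simp: openin_subtopology Int_def intro!: exI[of _ "{x \<in> ?U. \<phi> x \<in> W}"])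
qed

section \<open>Krull dimension\<close>

lemma irreducible_closed_imp_closedin: "irreducible_closed X Z \<Longrightarrow> closedin X Z"
  unfolding irreducible_closed_def by (rule conjunct1)

lemma irreducible_closed_cases:
  assumes "irreducible_closed X Z" "closedin X A" "closedin X B" "Z \<subseteq> A \<union> B"
  shows "Z \<subseteq> A \<or> Z \<subseteq> B"
proof -
  have "Z = (Z \<inter> A) \<union> (Z \<inter> B)" using assms(4) by blast
  moreover have "closedin X (Z \<inter> A)" "closedin X (Z \<inter> B)"
    using assms(2,3) irreducible_closed_imp_closedin[OF assms(1)] by (auto intro: closedin_Int)
  ultimately have "Z = Z \<inter> A \<or> Z = Z \<inter> B"
    using assms(1) unfolding irreducible_closed_def by metis
  then show ?thesis by blast
qed

lemma irreducible_closed_dense_open: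
  assumes Z: "irreducible_closed X Z" and U: "openin X U" "Z \<inter> U \<noteq> {}"
  shows "X closure_of (Z \<inter> U) = Z"
proof -
  have cZ: "closedin X Z" using irreducible_closed_imp_closedin[OF Z] .
  then have "X closure_of (Z \<inter> U) \<subseteq> Z" by (simp add: closure_of_minimal)
  moreover have "Z \<subseteq> X closure_of (Z \<inter> U) \<union> (topspace X - U)"
    using closure_of_subset_Int[of X "Z \<inter> U"] closedin_subset[OF cZ] by blast
  then have "Z \<subseteq> X closure_of (Z \<inter> U) \<or> Z \<subseteq> topspace X - U"
    by (rule irreducible_closed_cases[OF Z closedin_closure_of closedin_diff[OF closedin_topspace U(1)]])
  ultimately show ?thesis using U(2) by blast
qed

lemma irreducible_closed_image:
  assumes Z: "irreducible_closed X Z" and U: "openin X U" "Z \<inter> U \<noteq> {}"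
    and f: "continuous_map (subtopology X U) Y f"
  shows "irreducible_closed Y (Y closure_of (f ` (Z \<inter> U)))"
  unfolding irreducible_closed_def
proof (intro conjI allI impI)
  have UX: "U \<subseteq> topspace X" using U openin_subset by blast
  have fU: "f ` (Z \<inter> U) \<subseteq> topspace Y" using f UX by (auto simp: continuous_map_def)
  then show "Y closure_of (f ` (Z \<inter> U)) \<noteq> {}" using U(2) closure_of_subset[OF fU] by blast
  fix A B assume AB: "closedin Y A \<and> closedin Y B \<and> Y closure_of (f ` (Z \<inter> U)) = A \<union> B"
  have lift: "\<exists>C'. closedin X C' \<and> {x \<in> U. f x \<in> C} = C' \<inter> U" if "closedin Y C" for C
  proof -
    have "closedin (subtopology X U) {x \<in> topspace (subtopology X U). f x \<in> C}"
      using f that closedin_continuous_map_preimage by blast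
    moreover have "{x \<in> topspace (subtopology X U). f x \<in> C} = {x \<in> U. f x \<in> C}"
      using UX by auto
    ultimately show ?thesis by (simp only: closedin_subtopology)
  qed
  obtain A' B' where A': "closedin X A'" "{x \<in> U. f x \<in> A} = A' \<inter> U"
      and B': "closedin X B'" "{x \<in> U. f x \<in> B} = B' \<inter> U"
    using lift[of A] lift[of B] AB by blast
  have "f ` (Z \<inter> U) \<subseteq> A \<union> B" using closure_of_subset[OF fU] AB by simp
  then have "Z \<inter> U \<subseteq> A' \<union> B'" using A'(2) B'(2) by blast
  moreover have "Z \<subseteq> topspace X" using irreducible_closed_imp_closedin[OF Z] closedin_subset by blast
  ultimately have "Z \<subseteq> (A' \<union> B') \<union> (topspace X - U)" by blast
  then have "Z \<subseteq> A' \<union> B' \<or> Z \<subseteq> topspace X - U"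
    by (rule irreducible_closed_cases[OF Z closedin_Un[OF A'(1) B'(1)] closedin_diff[OF closedin_topspace U(1)]])
  then have "Z \<subseteq> A' \<union> B'" using U(2) by blast
  then have "Z \<subseteq> A' \<or> Z \<subseteq> B'" by (rule irreducible_closed_cases[OF Z A'(1) B'(1)])
  then have "f ` (Z \<inter> U) \<subseteq> A \<or> f ` (Z \<inter> U) \<subseteq> B" using A'(2) B'(2) by blast
  then have "Y closure_of (f ` (Z \<inter> U)) \<subseteq> A \<or> Y closure_of (f ` (Z \<inter> U)) \<subseteq> B"
    using AB closure_of_minimal[of "f ` (Z \<inter> U)" A Y] closure_of_minimal[of "f ` (Z \<inter> U)" B Y] by blast
  then show "Y closure_of (f ` (Z \<inter> U)) = A \<or> Y closure_of (f ` (Z \<inter> U)) = B"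
    using AB by blast
qed simp

text \<open>A chain is visible in any open set \<open>U\<close> that meets its smallest member,
  since irreducible members are the closures of their traces on \<open>U\<close>. The closures of
  the images of the traces form a chain in \<open>Y\<close> of the same length, so a chart around a
  single point suffices for each chain.\<close>

lemma krull_dim_le_local_homeomorphism:
  assumes "\<And>x. x \<in> topspace X \<Longrightarrow> \<exists>U V f g. openin X U \<and> x \<in> U \<and> openin Y V \<and>
     homeomorphic_maps (subtopology X U) (subtopology Y V) f g"
  shows "krull_dim X \<le> krull_dim Y"
proof -
  have "\<exists>W. (\<forall>i\<le>n. irreducible_closed Y (W i)) \<and> (\<forall>i<n. W i \<subset> W (Suc i))"
    if irr: "\<forall>i\<le>n. irreducible_closed X (Z i)" and less: "\<forall>i<n. Z i \<subset> Z (Suc i)" for n Z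
  proof -
    have Zc: "closedin X (Z i)" if "i \<le> n" for i using irr that irreducible_closed_imp_closedin by blast
    have "Z 0 \<noteq> {}" using irr unfolding irreducible_closed_def by blast
    then obtain x where x: "x \<in> Z 0" by blast
    then have "x \<in> topspace X" using Zc[of 0] closedin_subset by blast
    then obtain U V f g where U: "openin X U" "x \<in> U" and V: "openin Y V"
        and h: "homeomorphic_maps (subtopology X U) (subtopology Y V) f g"
      using assms by meson
    have mono: "Z 0 \<subseteq> Z i" if "i \<le> n" for i
      using that
    proof (induction i)
      case (Suc i)
      then show ?case using less by (metis Suc_leD Suc_le_lessD order_trans psubset_imp_subset)
    qed simp
    then have meet: "Z i \<inter> U \<noteq> {}" if "i \<le> n" for i using that x U by blast
    have UX: "topspace (subtopology X U) = U" and VY: "topspace (subtopology Y V) = V"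
      using openin_subset[OF U(1)] openin_subset[OF V] by auto
    have f: "continuous_map (subtopology X U) Y f" "f ` U \<subseteq> V"
      and gf: "\<And>x. x \<in> U \<Longrightarrow> g (f x) = x"
      and g: "continuous_map (subtopology Y V) (subtopology X U) g"
      and fg: "\<And>y. y \<in> V \<Longrightarrow> f (g y) = y" "\<And>y. y \<in> V \<Longrightarrow> g y \<in> U"
      using h UX VY unfolding homeomorphic_maps_def continuous_map_in_subtopology by auto
    define W where "W i = Y closure_of (f ` (Z i \<inter> U))" for i
    have "irreducible_closed Y (W i)" if "i \<le> n" for i
      unfolding W_def using irr that by (intro irreducible_closed_image[OF _ U(1) meet[OF that] f(1)]) blast
    moreover have "W i \<subset> W (Suc i)" if i: "i < n" for i
    proof (rule psubsetI)
      show "W i \<subseteq> W (Suc i)"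
        unfolding W_def using less i by (intro closure_of_mono image_mono) blast
      show "W i \<noteq> W (Suc i)"
      proof
        assume eq: "W i = W (Suc i)"
        \<comment> \<open>The image of the trace is a preimage under \<open>g\<close>, hence closed
          in \<open>V\<close>. So it is recovered from \<open>W i\<close> by intersecting with
          \<open>V\<close>, and equal closures force equal traces.\<close>
        have "closedin (subtopology X U) (Z i \<inter> U)"
          using Zc[of i] i by (auto simp: closedin_subtopology)
        then have "closedin (subtopology Y V) {y \<in> V. g y \<in> Z i \<inter> U}"
          using closedin_continuous_map_preimage[OF g, of "Z i \<inter> U"] unfolding VY by blast
        moreover have img: "{y \<in> V. g y \<in> Z i \<inter> U} = f ` (Z i \<inter> U)"
          using f(2) gf fg by force
        ultimately obtain C where C: "closedin Y C" "f ` (Z i \<inter> U) = C \<inter> V"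
          by (auto simp: closedin_subtopology)
        then have "W i \<subseteq> C" unfolding W_def by (intro closure_of_minimal) auto
        have fsub: "f ` (Z (Suc i) \<inter> U) \<subseteq> topspace Y"
          using f(2) openin_subset[OF V] by blast
        have "f ` (Z (Suc i) \<inter> U) \<subseteq> C \<inter> V"
          using closure_of_subset[OF fsub] eq \<open>W i \<subseteq> C\<close> f(2) unfolding W_def by blast
        then have "f ` (Z (Suc i) \<inter> U) \<subseteq> f ` (Z i \<inter> U)" using C by simp
        then have "Z (Suc i) \<inter> U \<subseteq> Z i \<inter> U"
        proof (intro subsetI)
          fix x assume x: "x \<in> Z (Suc i) \<inter> U"
          then obtain x' where "x' \<in> Z i \<inter> U" "f x = f x'"
            using \<open>f ` (Z (Suc i) \<inter> U) \<subseteq> f ` (Z i \<inter> U)\<close> by blast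
          then show "x \<in> Z i \<inter> U" using gf[of x] gf[of x'] x by auto
        qed
        then have "Z (Suc i) \<inter> U = Z i \<inter> U" using less i by blast
        moreover have "X closure_of (Z i \<inter> U) = Z i" "X closure_of (Z (Suc i) \<inter> U) = Z (Suc i)"
          using i by (auto intro!: irreducible_closed_dense_open[OF _ U(1) meet] simp: irr)
        ultimately show False using less i by force
      qed
    qed
    ultimately show ?thesis by blast
  qed
  then have "{enat n |n. \<exists>Z. (\<forall>i\<le>n. irreducible_closed X (Z i)) \<and> (\<forall>i<n. Z i \<subset> Z (Suc i))}
      \<subseteq> {enat n |n. \<exists>Z. (\<forall>i\<le>n. irreducible_closed Y (Z i)) \<and> (\<forall>i<n. Z i \<subset> Z (Suc i))}"
    by (intro Collect_mono) metis
  then show ?thesis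
    unfolding krull_dim_def by (rule Sup_subset_mono)
qed

section \<open>Vieta jumping\<close>

text \<open>\<open>x\<close> and \<open>z\<close> are the roots of the same quadratic, with product
  y^2 - t. Positivity of \<open>t\<close> and y^2 makes 4xy + 1 and 4zy + 1 positive, so the
  integers xy and zy are nonnegative; thus 0 \<le> xz = y^2 - t < x^2.\<close>

lemma vieta_step_positive:
  fixes x y t z :: int
  assumes eq: "x\<^sup>2 + y\<^sup>2 = t * (4 * x * y + 1)" and z: "z = 4 * t * y - x"
    and "\<bar>y\<bar> \<le> \<bar>x\<bar>" "x * y \<noteq> 0" "t > 0"
  shows "\<bar>z\<bar> < \<bar>x\<bar>"
proof -
  have eqz: "z\<^sup>2 + y\<^sup>2 = t * (4 * z * y + 1)" and xz: "x * z = y\<^sup>2 - t"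
    using eq unfolding z by (simp_all add: algebra_simps power2_eq_square)
  have "y\<^sup>2 > 0" using assms(4) by simp
  then have "t * (4 * x * y + 1) > 0" "t * (4 * z * y + 1) > 0"
    using eq eqz by (metis add_nonneg_pos zero_le_power2)+
  then have "4 * (x * y) + 1 > 0" "4 * (z * y) + 1 > 0"
    using \<open>t > 0\<close> by (simp_all add: zero_less_mult_iff mult.assoc)
  then have "x * y > 0" "z * y \<ge> 0" using assms(4) by linarith+
  then have "0 \<le> (x * y) * (z * y)" by simp
  also have "\<dots> = (x * z) * y\<^sup>2" by (simp add: power2_eq_square)
  finally have "x * z \<ge> 0" using \<open>y\<^sup>2 > 0\<close> by (simp add: zero_le_mult_iff)
  moreover have "y\<^sup>2 \<le> x\<^sup>2" using assms(3) by (simp add: abs_le_square_iff)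
  then have "x * z < \<bar>x\<bar> * \<bar>x\<bar>" using xz \<open>t > 0\<close> by (simp add: power2_eq_square flip: abs_mult)
  ultimately have "\<bar>x\<bar> * \<bar>z\<bar> < \<bar>x\<bar> * \<bar>x\<bar>" by (simp flip: abs_mult)
  then show ?thesis by (rule mult_left_less_imp_less) simp
qed

text \<open>Now xz = y^2 + |t| exceeds y^2, so |t| < x^2 - y^2 is needed. Size estimates give |t|
  \<le> |x| and |x| \<noteq> |y|, hence x^2 - y^2 \<ge> |x| + |y| > |t|.\<close>

lemma vieta_step_negative:
  fixes x y t z :: int
  assumes eq: "x\<^sup>2 + y\<^sup>2 = t * (4 * x * y + 1)" and z: "z = 4 * t * y - x"
    and "\<bar>y\<bar> \<le> \<bar>x\<bar>" "x * y \<noteq> 0" "t < 0"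
  shows "\<bar>z\<bar> < \<bar>x\<bar>"
proof -
  define a b s where "a = \<bar>x\<bar>" "b = \<bar>y\<bar>" "s = - t"
  have "x * y \<le> 0"
  proof (rule ccontr)
    assume "\<not> x * y \<le> 0"
    then have "t * (4 * x * y + 1) < 0" using \<open>t < 0\<close> by (simp add: mult_less_0_iff mult.assoc)
    then show False using eq by (metis add_nonneg_nonneg not_less zero_le_power2)
  qed
  then have xy: "x * y = - (a * b)" by (simp add: a_b_s_def flip: abs_mult)
  have ab: "1 \<le> a" "1 \<le> b" "b \<le> a" and s: "s \<ge> 1" using assms by (auto simp: a_b_s_def)
  have "t * (4 * x * y + 1) = s * (4 * (a * b) - 1)"
    using xy by (simp add: a_b_s_def(3) mult.assoc right_diff_distrib)
  then have e: "a\<^sup>2 + b\<^sup>2 = s * (4 * (a * b) - 1)" using eq by (simp add: a_b_s_def)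
  have aab: "a \<le> a * b" using ab by (simp add: mult_le_cancel_left1)
  have "s \<le> a"
  proof (rule ccontr)
    assume "\<not> s \<le> a"
    \<comment> \<open>The coefficient 4 enters through 4ab - 1 \<ge> 3a: for s \<ge> a + 1 the
      right-hand side exceeds 2a^2, which bounds the left-hand side.\<close>
    then have "(a + 1) * (3 * a) \<le> s * (4 * (a * b) - 1)"
      using ab aab by (intro mult_mono) auto
    moreover have "b\<^sup>2 \<le> a\<^sup>2" using ab by (simp add: power_mono)
    ultimately have "3 * a * a + 3 * a \<le> 2 * a * a" using e by (simp add: power2_eq_square algebra_simps)
    then show False using ab mult_pos_pos[of a a] by linarith
  qed
  have "a \<noteq> b"
  proof
    assume "a = b"
    then have "2 * (a * a) = s * (4 * (a * a) - 1)" using e by (simp add: power2_eq_square)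
    moreover have "1 * (4 * (a * a) - 1) \<le> s * (4 * (a * a) - 1)"
      using s ab mult_pos_pos[of a a] by (intro mult_right_mono) auto
    ultimately have "4 * (a * a) - 1 \<le> 2 * (a * a)" by (simp only: mult_1)
    moreover have "a * a \<ge> 1" using ab mult_mono[of 1 a 1 a] by simp
    ultimately show False by linarith
  qed
  then have "a - b \<ge> 1" using ab by simp
  then have "1 * (a + b) \<le> (a - b) * (a + b)" using ab by (intro mult_right_mono) auto
  then have "s < a * a - b * b" using \<open>s \<le> a\<close> ab by (simp add: algebra_simps)
  moreover have "x * z = b * b + s"
    using eq unfolding z a_b_s_def by (simp add: algebra_simps power2_eq_square)
  ultimately have "x * z < a * a" "x * z > 0" using s ab mult_pos_pos[of b b] by linarith+
  then have "\<bar>x\<bar> * \<bar>z\<bar> < \<bar>x\<bar> * \<bar>x\<bar>" by (simp add: a_b_s_def flip: abs_mult)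
  then show ?thesis by (rule mult_left_less_imp_less) simp
qed

text \<open>Descent with \<open>t\<close> fixed: the larger coordinate is replaced by the other root
  until xy = 0, where \<open>t\<close> is the square of a coordinate. For negative \<open>t\<close>
  this is absurd, so there are no such points.\<close>

theorem vieta_jumping_square:
  fixes x y t :: int
  assumes "x\<^sup>2 + y\<^sup>2 = t * (4 * x * y + 1)"
  shows "\<exists>w. t = w\<^sup>2"
  using assms
proof (induction "nat (\<bar>x\<bar> + \<bar>y\<bar>)" arbitrary: x y rule: less_induct)
  case less
  have main: "\<exists>w. t = w\<^sup>2"
    if eq: "x\<^sup>2 + y\<^sup>2 = t * (4 * x * y + 1)" and le: "\<bar>y\<bar> \<le> \<bar>x\<bar>"
      and IH: "\<And>z. z\<^sup>2 + y\<^sup>2 = t * (4 * z * y + 1) \<Longrightarrow> \<bar>z\<bar> < \<bar>x\<bar> \<Longrightarrow> \<exists>w. t = w\<^sup>2" for x y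
  proof (cases "x * y = 0 \<or> t = 0")
    case True
    then show ?thesis
    proof
      assume "x * y = 0"
      then have "t = x\<^sup>2 \<or> t = y\<^sup>2" using eq by auto
      then show ?thesis by auto
    qed (auto intro: exI[of _ 0])
  next
    case False
    define z where "z = 4 * t * y - x"
    have "\<bar>z\<bar> < \<bar>x\<bar>"
      using vieta_step_positive[OF eq z_def le] vieta_step_negative[OF eq z_def le] False
      by (metis linorder_neqE_linordered_idom)
    moreover have "z\<^sup>2 + y\<^sup>2 = t * (4 * z * y + 1)"
      using eq unfolding z_def by (simp add: algebra_simps power2_eq_square)
    ultimately show ?thesis using IH by blast
  qed
  show ?case
  proof (cases "\<bar>y\<bar> \<le> \<bar>x\<bar>")
    case True
    show ?thesis
    proof (rule main[OF less.prems True])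
      fix z assume z: "z\<^sup>2 + y\<^sup>2 = t * (4 * z * y + 1)" "\<bar>z\<bar> < \<bar>x\<bar>"
      show "\<exists>w. t = w\<^sup>2" by (rule less.hyps[OF _ z(1)]) (use z(2) in simp)
    qed
  next
    case False
    have eq: "y\<^sup>2 + x\<^sup>2 = t * (4 * y * x + 1)" using less.prems by (simp add: ac_simps)
    show ?thesis
    proof (rule main[OF eq])
      fix z assume z: "z\<^sup>2 + x\<^sup>2 = t * (4 * z * x + 1)" "\<bar>z\<bar> < \<bar>y\<bar>"
      then have "x\<^sup>2 + z\<^sup>2 = t * (4 * x * z + 1)" by (simp add: ac_simps)
      then show "\<exists>w. t = w\<^sup>2" by (rule less.hyps[rotated]) (use z(2) in simp)
    qed (use False in simp)
  qed
qed

text \<open>From \<open>(0, w)\<close> the jump \<open>(x, y) \<mapsto> (y, 4 w\<^sup>2 y - x)\<close> climbs to infinity on the conic \<open>t = w\<^sup>2\<close>.\<close>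

lemma infinite_integral_points_conic:
  fixes w :: int
  assumes "w \<ge> 1"
  shows "infinite {x. x > 0 \<and> (\<exists>y. x\<^sup>2 + y\<^sup>2 = w\<^sup>2 * (4 * x * y + 1))}" (is "infinite ?X")
proof
  assume fin: "finite ?X"
  have "\<exists>x y. x \<ge> int n \<and> 0 < x \<and> x < y \<and> x\<^sup>2 + y\<^sup>2 = w\<^sup>2 * (4 * x * y + 1)" for n
  proof (induction n)
    case 0
    have "w * 1 < w * (4 * w\<^sup>2)" using assms by (intro mult_strict_left_mono) (use mult_mono[of 1 w 1 w] in \<open>auto simp: power2_eq_square\<close>)
    moreover have "w\<^sup>2 + (w * (4 * w\<^sup>2))\<^sup>2 = w\<^sup>2 * (4 * w * (w * (4 * w\<^sup>2)) + 1)"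
      by (simp add: algebra_simps power2_eq_square)
    ultimately show ?case using assms by (intro exI[of _ w] exI[of _ "w * (4 * w\<^sup>2)"]) auto
  next
    case (Suc n)
    then obtain x y where xy: "x \<ge> int n" "0 < x" "x < y" "x\<^sup>2 + y\<^sup>2 = w\<^sup>2 * (4 * x * y + 1)" by blast
    have "y \<le> w\<^sup>2 * y"
      using assms xy mult_mono[of 1 w 1 w] mult_right_mono[of 1 "w * w" y] by (simp add: power2_eq_square)
    then have "y < 4 * (w\<^sup>2 * y) - x" using xy by linarith
    then have "y < 4 * w\<^sup>2 * y - x" by (simp add: mult.assoc)
    moreover have "y\<^sup>2 + (4 * w\<^sup>2 * y - x)\<^sup>2 = w\<^sup>2 * (4 * y * (4 * w\<^sup>2 * y - x) + 1)"
      using xy(4) by (simp add: algebra_simps power2_eq_square)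
    ultimately show ?case using xy by (intro exI[of _ y] exI[of _ "4 * w\<^sup>2 * y - x"]) auto
  qed
  then obtain x y where x: "x \<ge> int (nat (Max ?X + 1))" "0 < x" "x\<^sup>2 + y\<^sup>2 = w\<^sup>2 * (4 * x * y + 1)" by blast
  then have "x \<in> ?X" by blast
  then have "x \<le> Max ?X" using fin by (rule Max_ge[rotated])
  then show False using x by linarith
qed

section \<open>Rational curves\<close>

text \<open>Complex coefficients, since the curves have to pass through arbitrary complex
  points.\<close>

definition polyc :: "(complex \<Rightarrow> complex) \<Rightarrow> bool" where
  "polyc f \<longleftrightarrow> (\<exists>p. f = poly p)"

lemma fun_subring_polyc: "fun_subring polyc"
  unfolding fun_subring_def polyc_def
proof (intro conjI allI impI; (elim exE)?)
  show "\<exists>p. (\<lambda>_. 0 :: complex) = poly p" by (rule exI[of _ 0]) auto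
  show "\<exists>p. (\<lambda>_. 1 :: complex) = poly p" by (rule exI[of _ 1]) auto
  fix f g :: "complex \<Rightarrow> complex" and p q assume "f = poly p" "g = poly q"
  then have "(\<lambda>x. f x + g x) = poly (p + q)" "(\<lambda>x. f x * g x) = poly (p * q)" by auto
  then show "\<exists>p. (\<lambda>x. f x + g x) = poly p" "\<exists>p. (\<lambda>x. f x * g x) = poly p" by blast+
qed

lemma polyc_const: "polyc (\<lambda>_. c)"
  unfolding polyc_def by (rule exI[of _ "[:c:]"]) auto

lemma polyc_id: "polyc (\<lambda>x. x)"
  unfolding polyc_def by (rule exI[of _ "[:0, 1:]"]) auto

lemmas polyc_add = fun_subring_add[where C = polyc, OF fun_subring_polyc]
  and polyc_mult = fun_subring_mult[where C = polyc, OF fun_subring_polyc]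
  and polyc_power = fun_subring_power[where C = polyc, OF fun_subring_polyc]

lemma polyc_diff: assumes "polyc f" "polyc g" shows "polyc (\<lambda>x. f x - g x)"
  using polyc_add[OF assms(1) polyc_mult[OF polyc_const[of "-1"] assms(2)]] by simp

lemmas polyc_intros = polyc_const polyc_id polyc_add polyc_mult polyc_power polyc_diff

lemma polyc_finite_zeros:
  assumes "polyc f" "f a \<noteq> 0" shows "finite {x. f x = 0}"
proof -
  obtain p where "f = poly p" using assms(1) by (auto simp: polyc_def)
  then show ?thesis using assms(2) poly_roots_finite[of p] by fastforce
qed

text \<open>Along a rational curve \<open>f\<close> becomes a fraction in one variable; being
  nonzero at one parameter, it vanishes at finitely many only. Several such conditions can therefore
  be met at once.\<close>

lemma curve_cofinite:
  assumes f: "polyfun n f" and d: "polyc d"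
    and \<gamma>: "\<And>i. i < n \<Longrightarrow> frac_fun polyc d (\<lambda>\<tau>. \<gamma> \<tau> i)"
    and a: "d a \<noteq> 0" "f (\<gamma> a) \<noteq> 0"
  shows "finite {\<tau>. d \<tau> = 0 \<or> f (\<gamma> \<tau>) = 0}"
proof -
  have "frac_fun polyc d (\<lambda>\<tau>. f (\<gamma> \<tau>))"
    by (rule polyfun_compose[where C = "frac_fun polyc d", OF f
          fun_subring_frac_fun[where C = polyc, OF fun_subring_polyc d]
          frac_funI0[where C = polyc, OF polyc_const] \<gamma>])
  then obtain N p where p: "polyc p" "\<forall>x. d x \<noteq> 0 \<longrightarrow> f (\<gamma> x) * d x ^ N = p x"
    unfolding frac_fun_def by blast
  have "p a \<noteq> 0" using p(2) a by auto
  then have "finite ({\<tau>. d \<tau> = 0} \<union> {\<tau>. p \<tau> = 0})"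
    using polyc_finite_zeros[OF d a(1)] polyc_finite_zeros[OF p(1)] by simp
  then show ?thesis
    by (rule finite_subset[rotated]) (use p(2) in auto)
qed

text \<open>Primality of the ideal of rational polynomials vanishing on \<open>S\<close>, phrased
  with values.\<close>

definition zirreducible :: "nat \<Rightarrow> (nat \<Rightarrow> complex) set \<Rightarrow> bool" where
  "zirreducible n S \<longleftrightarrow> S \<noteq> {} \<and> (\<forall>f g. polyfun n f \<longrightarrow> polyfun n g \<longrightarrow>
     (\<exists>v\<in>S. f v \<noteq> 0) \<longrightarrow> (\<exists>v\<in>S. g v \<noteq> 0) \<longrightarrow> (\<exists>v\<in>S. f v \<noteq> 0 \<and> g v \<noteq> 0))"

lemma zirreducibleD:
  assumes "zirreducible n S" "polyfun n f" "polyfun n g" "v \<in> S" "f v \<noteq> 0" "w \<in> S" "g w \<noteq> 0"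
  obtains u where "u \<in> S" "f u \<noteq> 0" "g u \<noteq> 0"
  using assms unfolding zirreducible_def by blast

lemma zirreducible_open_Int:
  assumes S: "zirreducible n S" and "openin (zar n S) U" "U \<noteq> {}" "openin (zar n S) V" "V \<noteq> {}"
  shows "U \<inter> V \<noteq> {}"
proof -
  obtain v where v: "v \<in> U" using assms by blast
  obtain f where f: "polyfun n f" "f v \<noteq> 0" "{y \<in> S. f y \<noteq> 0} \<subseteq> U"
    using openin_zar_imp[OF assms(2) v] by blast
  obtain w where w: "w \<in> V" using assms by blast
  obtain g where g: "polyfun n g" "g w \<noteq> 0" "{y \<in> S. g y \<noteq> 0} \<subseteq> V"
    using openin_zar_imp[OF assms(4) w] by blast
  have "v \<in> S" "w \<in> S"
    using v w openin_subset[OF assms(2)] openin_subset[OF assms(4)] by auto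
  then show ?thesis using zirreducibleD[OF S f(1) g(1) _ f(2) _ g(2)] f(3) g(3) by blast
qed

lemma zirreducible_imp_irreducible_closed:
  assumes S: "zirreducible n S" shows "irreducible_closed (zar n S) S"
  unfolding irreducible_closed_def
proof (intro conjI allI impI)
  show "closedin (zar n S) S" using closedin_topspace[of "zar n S"] by simp
  show "S \<noteq> {}" using S by (simp add: zirreducible_def)
  fix A B assume AB: "closedin (zar n S) A \<and> closedin (zar n S) B \<and> S = A \<union> B"
  then have "openin (zar n S) (S - A)" "openin (zar n S) (S - B)"
    by (auto simp: closedin_def)
  then have "S - A = {} \<or> S - B = {}"
    using zirreducible_open_Int[OF S, of "S - A" "S - B"] AB by blast
  then show "S = A \<or> S = B" using AB by blast
qed

lemma zirreducible_open_dense: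
  assumes "zirreducible n S" "openin (zar n S) U" "U \<noteq> {}"
  shows "zariski_dense \<rat> (affine_variety n S) U"
proof -
  have "U \<subseteq> S" using openin_subset[OF assms(2)] by simp
  moreover have "zar n S closure_of U = S"
  proof (intro equalityI subsetI)
    fix x assume "x \<in> S"
    then show "x \<in> zar n S closure_of U"
      unfolding in_closure_of using zirreducible_open_Int[OF assms] by force
  qed (use closure_of_subset_topspace[of "zar n S" U] in auto)
  ultimately show ?thesis
    by (simp add: zariski_dense_def points_def affine_variety_def)
qed

text \<open>On the line through a point where \<open>f\<close> is nonzero and one where
  \<open>g\<close> is, each has finitely many zeros.\<close>

lemma zirreducible_affine_space: "zirreducible n (affine_space n)"
  unfolding zirreducible_def
proof (intro conjI allI impI; (elim bexE)?)
  show "affine_space n \<noteq> {}" by (auto simp: affine_space_def)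
  fix f g v w
  assume f: "polyfun n f" "f v \<noteq> 0" and g: "polyfun n g" "g w \<noteq> 0"
    and vw: "v \<in> affine_space n" "w \<in> affine_space n"
  define \<gamma> where "\<gamma> \<tau> i = v i + \<tau> * (w i - v i)" for \<tau> i
  have \<gamma>: "frac_fun polyc (\<lambda>_. 1) (\<lambda>\<tau>. \<gamma> \<tau> i)" for i
    unfolding \<gamma>_def by (rule frac_funI0) (intro polyc_intros)
  have "\<gamma> 0 = v" "\<gamma> 1 = w" by (auto simp: \<gamma>_def)
  then have "finite {\<tau>. (1::complex) = 0 \<or> f (\<gamma> \<tau>) = 0}" "finite {\<tau>. (1::complex) = 0 \<or> g (\<gamma> \<tau>) = 0}"
    using curve_cofinite[where \<gamma> = \<gamma> and a = 0, OF f(1) polyc_const \<gamma>]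
      curve_cofinite[where \<gamma> = \<gamma> and a = 1, OF g(1) polyc_const \<gamma>] f(2) g(2) by auto
  then have "finite ({\<tau>. f (\<gamma> \<tau>) = 0} \<union> {\<tau>. g (\<gamma> \<tau>) = 0})" by simp
  then obtain \<tau> where "\<tau> \<notin> {\<tau>. f (\<gamma> \<tau>) = 0} \<union> {\<tau>. g (\<gamma> \<tau>) = 0}"
    using ex_new_if_finite[OF infinite_UNIV_char_0] by blast
  moreover have "\<gamma> \<tau> \<in> affine_space n" using vw by (auto simp: \<gamma>_def affine_space_def)
  ultimately show "\<exists>v\<in>affine_space n. f v \<noteq> 0 \<and> g v \<noteq> 0" by blast
qed

section \<open>The cubic surface\<close>

definition mexp :: "nat \<Rightarrow> nat \<Rightarrow> nat \<Rightarrow> nat \<Rightarrow>\<^sub>0 nat" where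
  "mexp a b c = Poly_Mapping.single 0 a + Poly_Mapping.single 1 b + Poly_Mapping.single 2 c"

definition cubic :: mpoly where
  "cubic = Poly_Mapping.single (mexp 2 0 0) 1 + Poly_Mapping.single (mexp 0 2 0) 1 +
     Poly_Mapping.single (mexp 1 1 1) (-4) + Poly_Mapping.single (mexp 0 0 1) (-1)"

lemma monom_eval_single: "monom_eval (Poly_Mapping.single i a) v = v i ^ a"
  by (cases "a = 0") (auto simp: monom_eval_def)

lemma peval_cubic: "peval cubic v = (v 0)\<^sup>2 + (v 1)\<^sup>2 - 4 * v 0 * v 1 * v 2 - v 2"
  by (simp add: cubic_def mexp_def peval_add peval_single monom_eval_add monom_eval_single
      del: single_numeral single_one)

lemma lookup_mexp:
  "Poly_Mapping.lookup (mexp a b c) i = (if i = 0 then a else if i = 1 then b else if i = 2 then c else 0)"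
  by (auto simp: mexp_def lookup_add lookup_single when_def)

lemma keys_mexp: "Poly_Mapping.keys (mexp a b c) \<subseteq> {..<3}"
  by (auto simp: in_keys_iff lookup_mexp split: if_splits)

lemma cubic_polys: "cubic \<in> polys \<rat> 3"
  unfolding cubic_def by (intro polys_add polys_single keys_mexp) auto

lemma total_degree_cubic: "total_degree cubic = 3"
proof -
  define g where "g m = (\<Sum>i\<in>Poly_Mapping.keys m. Poly_Mapping.lookup m i)" for m :: "nat \<Rightarrow>\<^sub>0 nat"
  have g: "g (mexp a b c) = a + b + c" for a b c
  proof -
    have "g (mexp a b c) = (\<Sum>i<3. Poly_Mapping.lookup (mexp a b c) i)"
      unfolding g_def using keys_mexp by (intro sum.mono_neutral_left) (auto simp: in_keys_iff)
    then show ?thesis by (simp add: lookup_mexp eval_nat_numeral)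
  qed
  have neq: "mexp a b c \<noteq> mexp 1 1 1" if "a + b + c \<noteq> 3" for a b c
    using that g[of a b c] g[of 1 1 1] by auto
  have keys: "Poly_Mapping.keys cubic \<subseteq> {mexp 2 0 0, mexp 0 2 0, mexp 1 1 1, mexp 0 0 1}"
  proof
    fix m assume "m \<in> Poly_Mapping.keys cubic"
    then have "Poly_Mapping.lookup cubic m \<noteq> 0" by (simp add: in_keys_iff)
    then show "m \<in> {mexp 2 0 0, mexp 0 2 0, mexp 1 1 1, mexp 0 0 1}"
      by (auto simp: cubic_def lookup_add lookup_single when_def split: if_splits)
  qed
  have "Poly_Mapping.lookup cubic (mexp 1 1 1) = -4"
    using neq[of 2 0 0] neq[of 0 2 0] neq[of 0 0 1]
    by (simp add: cubic_def lookup_add lookup_single when_def)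
  then have "mexp 1 1 1 \<in> Poly_Mapping.keys cubic" by (simp add: in_keys_iff)
  then have "3 \<in> g ` Poly_Mapping.keys cubic" using g[of 1 1 1] by force
  moreover have "g ` Poly_Mapping.keys cubic \<subseteq> {2, 3, 1}" using keys by (auto simp: g)
  ultimately have "Max (insert 0 (g ` Poly_Mapping.keys cubic)) = 3" by (intro Max_eqI) auto
  then show ?thesis by (simp add: total_degree_def g_def)
qed

section \<open>Points of the surface, smoothness, irreducibility\<close>

definition pt :: "complex \<Rightarrow> complex \<Rightarrow> complex \<Rightarrow> nat \<Rightarrow> complex" where
  "pt x y t = (\<lambda>i. if i = 0 then x else if i = 1 then y else if i = 2 then t else 0)"

lemma pt_simps [simp]: "pt x y t 0 = x" "pt x y t 1 = y" "pt x y t (Suc 0) = y" "pt x y t 2 = t"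
  by (auto simp: pt_def)

abbreviation cubic_surface :: "(nat \<Rightarrow> complex) set" where "cubic_surface \<equiv> hypersurface 3 cubic"

lemma pt_eta:
  assumes "v \<in> affine_space 3" shows "pt (v 0) (v 1) (v 2) = v"
proof
  fix i :: nat
  consider "i = 0" | "i = 1" | "i = 2" | "3 \<le> i" by linarith
  then show "pt (v 0) (v 1) (v 2) i = v i" using assms by cases (auto simp: pt_def affine_space_def)
qed

lemma pt_eta2:
  assumes "v \<in> affine_space 2" shows "pt (v 0) (v 1) 0 = v"
proof
  fix i :: nat
  consider "i = 0" | "i = 1" | "2 \<le> i" by linarith
  then show "pt (v 0) (v 1) 0 i = v i" using assms by cases (auto simp: pt_def affine_space_def)
qed

lemma pt_affine_space3 [simp]: "pt x y t \<in> affine_space 3"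
  by (auto simp: pt_def affine_space_def)

lemma pt_affine_space2 [simp]: "pt x y 0 \<in> affine_space 2"
  by (auto simp: pt_def affine_space_def)

lemma pt_in_cubic_surface_iff [simp]: "pt x y t \<in> cubic_surface \<longleftrightarrow> x\<^sup>2 + y\<^sup>2 = t * (1 + 4 * x * y)"
  by (auto simp: hypersurface_def peval_cubic algebra_simps)

lemma cubic_surface_eq: "v \<in> cubic_surface \<Longrightarrow> (v 0)\<^sup>2 + (v 1)\<^sup>2 = v 2 * (1 + 4 * v 0 * v 1)"
  by (auto simp: hypersurface_def peval_cubic algebra_simps)

lemma cubic_surface_imp_affine_space: "v \<in> cubic_surface \<Longrightarrow> v \<in> affine_space 3"
  by (simp add: hypersurface_def)

lemma cubic_surface_cases:
  assumes "v \<in> cubic_surface"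
  obtains x y t where "v = pt x y t" "x\<^sup>2 + y\<^sup>2 = t * (1 + 4 * x * y)"
  using pt_eta[OF cubic_surface_imp_affine_space[OF assms]] cubic_surface_eq[OF assms] that by metis

text \<open>At a singular point the derivative in \<open>t\<close> gives 4xy = -1, and the other two
  give x = 2yt and y = 2xt. Hence x^2 + y^2 = 4xyt = -t, while the equation of the surface makes it
  0; so \<open>t\<close>, and with it \<open>x\<close>, vanishes, against 4xy = -1.\<close>

lemma smooth_cubic: "smooth_hypersurface 3 cubic"
  unfolding smooth_hypersurface_def
proof
  fix v assume "v \<in> cubic_surface"
  then have e: "(v 0)\<^sup>2 + (v 1)\<^sup>2 = v 2 * (1 + 4 * v 0 * v 1)" by (rule cubic_surface_eq)
  have d0: "deriv (\<lambda>t. peval cubic (v(0 := t))) (v 0) = 2 * v 0 - 4 * v 1 * v 2"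
    unfolding peval_cubic by (rule DERIV_imp_deriv) (auto intro!: derivative_eq_intros)
  have d1: "deriv (\<lambda>t. peval cubic (v(1 := t))) (v 1) = 2 * v 1 - 4 * v 0 * v 2"
    unfolding peval_cubic by (rule DERIV_imp_deriv) (auto intro!: derivative_eq_intros)
  have d2: "deriv (\<lambda>t. peval cubic (v(2 := t))) (v 2) = - 4 * v 0 * v 1 - 1"
    unfolding peval_cubic by (rule DERIV_imp_deriv) (auto intro!: derivative_eq_intros)
  show "\<exists>i<3. deriv (\<lambda>t. peval cubic (v(i := t))) (v i) \<noteq> 0"
  proof (rule ccontr)
    assume "\<not> ?thesis"
    then have "deriv (\<lambda>t. peval cubic (v(i := t))) (v i) = 0" if "i < 3" for i using that by blast
    from this[of 0] this[of 1] this[of 2]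
    have z: "2 * v 0 - 4 * v 1 * v 2 = 0" "2 * v 1 - 4 * v 0 * v 2 = 0" "- 4 * v 0 * v 1 - 1 = 0"
      using d0 d1 d2 by simp_all
    define x y t where "x = v 0" "y = v 1" "t = v 2"
    have x: "x = 2 * y * t" and y: "y = 2 * x * t"
      using z(1,2) by (simp_all add: x_y_t_def algebra_simps)
    have b: "4 * (x * y) + 1 = - (- 4 * v 0 * v 1 - 1)" by (simp add: x_y_t_def)
    have "4 * (x * y) + 1 = 0" unfolding b z(3) by simp
    then have xy: "4 * (x * y) = -1" by (simp add: eq_neg_iff_add_eq_0)
    have "x * x + y * y = x * (2 * y * t) + y * (2 * x * t)" using x y by metis
    also have "\<dots> = 4 * (x * y) * t" by (simp add: algebra_simps)
    finally have "x * x + y * y = 4 * (x * y) * t" .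
    moreover have "x * x + y * y = 0" using e xy by (simp add: x_y_t_def power2_eq_square mult.assoc)
    ultimately have "t = 0" using xy by simp
    then have "x = 0" using x by simp
    then show False using xy by simp
  qed
qed

lemma simply_connected_cubic_surface: "simply_connected cubic_surface"
proof (rule simply_connected_retraction_gen[OF simply_connected_surf])
  show "continuous_on surf (\<lambda>(x, y, t). pt x y t)"
  proof (rule continuous_on_coordinatewise_then_product)
    fix i :: nat
    consider "i = 0" | "i = 1" | "i = 2" | "3 \<le> i" by linarith
    then show "continuous_on surf (\<lambda>v. (case v of (x, y, t) \<Rightarrow> pt x y t) i)"
      unfolding case_prod_unfold by cases (auto simp: pt_def intro!: continuous_intros)
  qed
  show "(\<lambda>(x, y, t). pt x y t) ` surf = cubic_surface"
    by (force simp: surf_def add.commute elim: cubic_surface_cases)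
  show "continuous_on cubic_surface (\<lambda>v. (v 0, v 1, v 2))"
    by (intro continuous_on_Pair continuous_on_subset[OF continuous_on_product_coordinates subset_UNIV])
  show "(\<lambda>v. (v 0, v 1, v 2)) \<in> cubic_surface \<rightarrow> surf"
    by (auto simp: surf_def add.commute dest: cubic_surface_eq)
  show "(\<lambda>(x, y, t). pt x y t) (v 0, v 1, v 2) = v" if "v \<in> cubic_surface" for v
    using pt_eta[OF cubic_surface_imp_affine_space[OF that]] by simp
qed

lemma less_3_cases: "i < (3::nat) \<Longrightarrow> i = 0 \<or> i = 1 \<or> i = 2"
  by linarith

lemma less_2_cases': "i < (2::nat) \<Longrightarrow> i = 0 \<or> i = 1"
  by linarith

text \<open>\<open>graph_pt\<close> misses exactly the points of the surface over the hyperbola \<open>4xy = -1\<close>, which form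
  four lines; on the hyperbola itself it divides by \<open>0\<close>.\<close>

definition graph_pt :: "complex \<Rightarrow> complex \<Rightarrow> nat \<Rightarrow> complex" where
  "graph_pt x y = pt x y ((x\<^sup>2 + y\<^sup>2) / (1 + 4 * x * y))"

lemma graph_pt_in_surface: "1 + 4 * x * y \<noteq> 0 \<Longrightarrow> graph_pt x y \<in> cubic_surface"
  by (simp add: graph_pt_def)

lemma graph_pt_eq: "v \<in> cubic_surface \<Longrightarrow> 1 + 4 * v 0 * v 1 \<noteq> 0 \<Longrightarrow> graph_pt (v 0) (v 1) = v"
  using cubic_surface_eq[of v] pt_eta[OF cubic_surface_imp_affine_space, of v] by (simp add: graph_pt_def)

lemma frac_pt:
  assumes C: "fun_subring C" and q: "C q" and xy: "C x" "C y" "C u"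
    and t: "\<And>a. t a = u a / q a"
  shows "i < 3 \<Longrightarrow> frac_fun C q (\<lambda>a. pt (x a) (y a) (t a) i)"
  using less_3_cases[of i] frac_funI0[where C = C and q = q, OF xy(1)]
    frac_funI0[where C = C and q = q, OF xy(2)]
    frac_fun_divide[where C = C and q = q, OF xy(3)] t by auto

lemma exists_cofinite:
  fixes A B :: "complex set" assumes "finite A" "finite B"
  obtains \<tau> where "\<tau> \<notin> A" "\<tau> \<notin> B"
  using ex_new_if_finite[OF infinite_UNIV_char_0, of "A \<union> B"] assms by auto

text \<open>Near the lines omitted by the graph the surface is parametrised by \<open>ab = 1 + 16y\<^sup>4\<close>, with
  \<open>b = 1 + 4xy\<close>: moving first \<open>a\<close> and then \<open>y\<close> leaves the lines.\<close>

lemma nonzero_on_graph: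
  assumes f: "polyfun 3 f" and v: "v \<in> cubic_surface" "f v \<noteq> 0"
  obtains x y where "1 + 4 * x * y \<noteq> 0" "f (graph_pt x y) \<noteq> 0"
proof -
  define \<psi> where "\<psi> a b y = pt ((b - 1) / (4 * y)) y ((a + b - 2) / (16 * y\<^sup>2))" for a b y
  have \<psi>_graph: "\<psi> a b y = graph_pt ((b - 1) / (4 * y)) y" "1 + 4 * ((b - 1) / (4 * y)) * y \<noteq> 0"
    if "y \<noteq> 0" "b \<noteq> 0" "a * b = 1 + 16 * y ^ 4" for a b y
  proof -
    have b: "1 + 4 * ((b - 1) / (4 * y)) * y = b" using that(1) by (simp add: field_simps)
    have "((b - 1) / (4 * y))\<^sup>2 + y\<^sup>2 = (b\<^sup>2 - 2 * b + (1 + 16 * y ^ 4)) / (16 * y\<^sup>2)"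
      using that(1) by (simp add: field_simps power_numeral_reduce)
    also have "\<dots> = (a + b - 2) / (16 * y\<^sup>2) * b"
      unfolding that(3)[symmetric] by (simp add: algebra_simps power2_eq_square)
    finally have "(((b - 1) / (4 * y))\<^sup>2 + y\<^sup>2) / b = (a + b - 2) / (16 * y\<^sup>2)"
      using that(2) by simp
    then show "\<psi> a b y = graph_pt ((b - 1) / (4 * y)) y"
      unfolding \<psi>_def graph_pt_def b by simp
    show "1 + 4 * ((b - 1) / (4 * y)) * y \<noteq> 0" unfolding b by (rule that(2))
  qed
  obtain x y t where xyt: "v = pt x y t" "x\<^sup>2 + y\<^sup>2 = t * (1 + 4 * x * y)"
    using v(1) by (rule cubic_surface_cases)
  show thesis
  proof (cases "1 + 4 * x * y = 0")
    case False
    then have "graph_pt x y = v" using graph_pt_eq[OF v(1)] xyt by simp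
    then show ?thesis using that False v(2) by metis
  next
    case True
    then have y: "y \<noteq> 0" by auto
    have "16 * y\<^sup>2 * (x\<^sup>2 + y\<^sup>2) = (1 + 4 * x * y) * (4 * x * y - 1) + 1 + 16 * y ^ 4"
      by (simp add: algebra_simps power_numeral_reduce)
    then have y4: "1 + 16 * y ^ 4 = 0" using xyt(2) True by simp
    have x: "x = (0 - 1) / (4 * y)" using True y by (simp add: field_simps add_eq_0_iff)
    \<comment> \<open>On the line through \<open>v\<close> one has b = 0 and t = (a - 2)/(16 y^2);
      this is the value of \<open>a\<close> at \<open>v\<close>.\<close>
    define a0 where "a0 = 16 * t * y\<^sup>2 + 2"
    have v\<psi>: "v = \<psi> a0 0 y"
      unfolding \<psi>_def xyt(1) a0_def using x y by simp
    define \<gamma> where "\<gamma> a = \<psi> a 0 y" for a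
    have \<gamma>: "frac_fun polyc (\<lambda>_. 16 * y\<^sup>2) (\<lambda>a. \<gamma> a i)" if "i < 3" for i
      unfolding \<gamma>_def \<psi>_def
      by (rule frac_pt[where C = polyc, OF fun_subring_polyc _ _ _ _ refl that]) (intro polyc_intros)+
    have "finite {a. 16 * y\<^sup>2 = 0 \<or> f (\<gamma> a) = 0}"
      using curve_cofinite[where \<gamma> = \<gamma> and a = a0, OF f polyc_const \<gamma>] y v v\<psi>
      by (simp add: \<gamma>_def)
    moreover have "finite {0 :: complex}" by simp
    ultimately obtain a where "a \<notin> {a. 16 * y\<^sup>2 = 0 \<or> f (\<gamma> a) = 0}" "a \<notin> {0}"
      by (rule exists_cofinite)
    then have a: "a \<noteq> 0" "f (\<psi> a 0 y) \<noteq> 0" by (auto simp: \<gamma>_def)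
    \<comment> \<open>With \<open>a\<close> nonzero and fixed, \<open>b\<close> follows from ab = 1
      + 16 z^4; at z = y, where \<open>b\<close> vanishes, the curve passes through the point just
      found.\<close>
    define \<delta> where "\<delta> z = \<psi> a ((1 + 16 * z ^ 4) / a) z" for z
    have \<delta>: "frac_fun polyc (\<lambda>z. 16 * z\<^sup>2) (\<lambda>z. \<delta> z i)" if i: "i < 3" for i
    proof -
      have "polyc (\<lambda>z. 16 * z\<^sup>2)" "polyc (\<lambda>z. z)"
          "polyc (\<lambda>z. a + (1 + 16 * z ^ 4) * (1 / a) - 2)" "polyc (\<lambda>z. ((1 + 16 * z ^ 4) * (1 / a) - 1) * (4 * z))"
        by (intro polyc_intros)+
      note p = this
      \<comment> \<open>The first coordinate only needs the denominator 4z; it is expanded by 4z to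
        share 16 z^2 with the third.\<close>
      have "(\<lambda>z. \<delta> z 0) = (\<lambda>z. ((1 + 16 * z ^ 4) * (1 / a) - 1) * (4 * z) / (16 * z\<^sup>2))"
        by (auto simp: \<delta>_def \<psi>_def fun_eq_iff divide_simps power2_eq_square)
      moreover have "(\<lambda>z. \<delta> z 1) = (\<lambda>z. z)" by (simp add: \<delta>_def \<psi>_def)
      moreover have "(\<lambda>z. \<delta> z 2) = (\<lambda>z. (a + (1 + 16 * z ^ 4) * (1 / a) - 2) / (16 * z\<^sup>2))"
        by (simp add: \<delta>_def \<psi>_def)
      ultimately show ?thesis
        using less_3_cases[OF i] frac_fun_divide[where C = polyc and q = "\<lambda>z. 16 * z\<^sup>2", OF p(3)]
          frac_fun_divide[where C = polyc and q = "\<lambda>z. 16 * z\<^sup>2", OF p(4)]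
          frac_funI0[where C = polyc and q = "\<lambda>z. 16 * z\<^sup>2", OF p(2)] by auto
    qed
    have "polyc (\<lambda>z. 16 * z\<^sup>2)" by (intro polyc_intros)
    then have "finite {z. 16 * z\<^sup>2 = 0 \<or> f (\<delta> z) = 0}"
      using curve_cofinite[where \<gamma> = \<delta> and a = y, OF f _ \<delta>] y a(2) y4 by (simp add: \<delta>_def)
    moreover have "polyc (\<lambda>z. 1 + 16 * z ^ 4)" by (intro polyc_intros)
    then have "finite {z. 1 + 16 * z ^ 4 = (0::complex)}"
      using polyc_finite_zeros[of "\<lambda>z. 1 + 16 * z ^ 4" 0] by simp
    ultimately obtain z where "z \<notin> {z. 16 * z\<^sup>2 = 0 \<or> f (\<delta> z) = 0}" "z \<notin> {z. 1 + 16 * z ^ 4 = 0}"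
      by (rule exists_cofinite)
    then have "z \<noteq> 0" "f (\<delta> z) \<noteq> 0" "1 + 16 * z ^ 4 \<noteq> 0" by auto
    then have c: "z \<noteq> 0" "(1 + 16 * z ^ 4) / a \<noteq> 0" "a * ((1 + 16 * z ^ 4) / a) = 1 + 16 * z ^ 4"
      using a(1) by simp_all
    show ?thesis
      using that[OF \<psi>_graph(2)[OF c]] \<psi>_graph(1)[OF c] \<open>f (\<delta> z) \<noteq> 0\<close> unfolding \<delta>_def by simp
  qed
qed

lemma polyc_graph_pt:
  assumes "polyc x" "polyc y"
  shows "polyc (\<lambda>\<tau>. 1 + 4 * x \<tau> * y \<tau>)"
    "i < 3 \<Longrightarrow> frac_fun polyc (\<lambda>\<tau>. 1 + 4 * x \<tau> * y \<tau>) (\<lambda>\<tau>. graph_pt (x \<tau>) (y \<tau>) i)"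
proof -
  show q: "polyc (\<lambda>\<tau>. 1 + 4 * x \<tau> * y \<tau>)" by (intro polyc_intros assms)
  have "polyc (\<lambda>\<tau>. (x \<tau>)\<^sup>2 + (y \<tau>)\<^sup>2)" by (intro polyc_intros assms)
  then show "i < 3 \<Longrightarrow> frac_fun polyc (\<lambda>\<tau>. 1 + 4 * x \<tau> * y \<tau>) (\<lambda>\<tau>. graph_pt (x \<tau>) (y \<tau>) i)"
    unfolding graph_pt_def by (rule frac_pt[where C = polyc, OF fun_subring_polyc q assms(1,2) _ refl])
qed

text \<open>Points of nonvanishing are first moved into the graph. The line joining their
  projections to the (x, y)-plane then lifts to a rational curve on the surface, almost every point
  of which serves both functions.\<close>

lemma zirreducible_cubic_surface: "zirreducible 3 cubic_surface"
  unfolding zirreducible_def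
proof (intro conjI allI impI; (elim bexE)?)
  have "graph_pt 0 0 \<in> cubic_surface" by (simp add: graph_pt_in_surface)
  then show "cubic_surface \<noteq> {}" by blast
  fix f g v w
  assume f: "polyfun 3 f" "f v \<noteq> 0" and g: "polyfun 3 g" "g w \<noteq> 0" and vw: "v \<in> cubic_surface" "w \<in> cubic_surface"
  obtain x1 y1 where 1: "1 + 4 * x1 * y1 \<noteq> 0" "f (graph_pt x1 y1) \<noteq> 0"
    using nonzero_on_graph[OF f(1) vw(1) f(2)] .
  obtain x2 y2 where 2: "1 + 4 * x2 * y2 \<noteq> 0" "g (graph_pt x2 y2) \<noteq> 0"
    using nonzero_on_graph[OF g(1) vw(2) g(2)] .
  define x y where "x \<tau> = x1 + \<tau> * (x2 - x1)" "y \<tau> = y1 + \<tau> * (y2 - y1)" for \<tau>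
  have xy: "polyc x" "polyc y" unfolding x_y_def by (intro polyc_intros)+
  have "finite {\<tau>. 1 + 4 * x \<tau> * y \<tau> = 0 \<or> f (graph_pt (x \<tau>) (y \<tau>)) = 0}"
    by (rule curve_cofinite[where \<gamma> = "\<lambda>\<tau>. graph_pt (x \<tau>) (y \<tau>)" and a = 0, OF f(1) polyc_graph_pt(1)[OF xy]
          polyc_graph_pt(2)[OF xy]]) (use 1 in \<open>auto simp: x_y_def\<close>)
  moreover have "finite {\<tau>. 1 + 4 * x \<tau> * y \<tau> = 0 \<or> g (graph_pt (x \<tau>) (y \<tau>)) = 0}"
    by (rule curve_cofinite[where \<gamma> = "\<lambda>\<tau>. graph_pt (x \<tau>) (y \<tau>)" and a = 1, OF g(1) polyc_graph_pt(1)[OF xy]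
          polyc_graph_pt(2)[OF xy]]) (use 2 in \<open>auto simp: x_y_def\<close>)
  ultimately obtain \<tau> where "\<tau> \<notin> {\<tau>. 1 + 4 * x \<tau> * y \<tau> = 0 \<or> f (graph_pt (x \<tau>) (y \<tau>)) = 0}"
      "\<tau> \<notin> {\<tau>. 1 + 4 * x \<tau> * y \<tau> = 0 \<or> g (graph_pt (x \<tau>) (y \<tau>)) = 0}"
    by (rule exists_cofinite)
  then have "1 + 4 * x \<tau> * y \<tau> \<noteq> 0" "f (graph_pt (x \<tau>) (y \<tau>)) \<noteq> 0" "g (graph_pt (x \<tau>) (y \<tau>)) \<noteq> 0"
    by auto
  then show "\<exists>v\<in>cubic_surface. f v \<noteq> 0 \<and> g v \<noteq> 0" using graph_pt_in_surface by blast
qed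

section \<open>Equal dimension of the plane and the surface\<close>

abbreviation affine_plane :: "(nat \<Rightarrow> complex) set" where "affine_plane \<equiv> affine_space 2"

lemma homeomorphic_maps_zar:
  assumes p: "polyfun n p" and q: "polyfun m q"
    and \<phi>: "\<And>i. i < m \<Longrightarrow> frac_fun (polyfun n) p (\<lambda>x. \<phi> x i)"
    and \<psi>: "\<And>i. i < n \<Longrightarrow> frac_fun (polyfun m) q (\<lambda>x. \<psi> x i)"
    and im: "\<And>x. x \<in> X \<Longrightarrow> p x \<noteq> 0 \<Longrightarrow> \<phi> x \<in> Y \<and> q (\<phi> x) \<noteq> 0 \<and> \<psi> (\<phi> x) = x"
    and im': "\<And>y. y \<in> Y \<Longrightarrow> q y \<noteq> 0 \<Longrightarrow> \<psi> y \<in> X \<and> p (\<psi> y) \<noteq> 0 \<and> \<phi> (\<psi> y) = y"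
  shows "homeomorphic_maps (subtopology (zar n X) {x \<in> X. p x \<noteq> 0})
    (subtopology (zar m Y) {y \<in> Y. q y \<noteq> 0}) \<phi> \<psi>"
  unfolding homeomorphic_maps_def continuous_map_in_subtopology
proof (intro conjI)
  show "continuous_map (subtopology (zar n X) {x \<in> X. p x \<noteq> 0}) (zar m Y) \<phi>"
    by (rule continuous_map_zar[OF p \<phi>]) (use im in auto)
  show "continuous_map (subtopology (zar m Y) {y \<in> Y. q y \<noteq> 0}) (zar n X) \<psi>"
    by (rule continuous_map_zar[OF q \<psi>]) (use im' in auto)
qed (use im im' in auto)

text \<open>The graph identifies the complement of the hyperbola in the plane with an open part of
  the surface. Rational translations carry any given point of the plane off the hyperbola, so such
  charts cover the plane.\<close>

lemma krull_dim_plane_le_surface: "krull_dim (zar 2 affine_plane) \<le> krull_dim (zar 3 cubic_surface)"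
proof (rule krull_dim_le_local_homeomorphism)
  fix v assume "v \<in> topspace (zar 2 affine_plane)"
  then have v: "v \<in> affine_plane" by simp
  obtain c :: complex where c: "c \<in> \<rat>" "v 0 + c \<noteq> 0"
    by (cases "v 0 = 0") (auto intro: that[of 0] that[of 1])
  \<comment> \<open>The expression is affine in \<open>d\<close> with nonzero slope 4(v 0 + c), so
    it cannot vanish for both 0 and 1.\<close>
  have "\<exists>d\<in>\<rat>. 1 + 4 * (v 0 + c) * (v 1 + d) \<noteq> 0"
  proof (rule ccontr)
    assume "\<not> ?thesis"
    then have "1 + 4 * (v 0 + c) * (v 1 + d) = 0" if "d \<in> \<rat>" for d using that by blast
    from this[of 0] this[of 1]
    have "(1 + 4 * (v 0 + c) * (v 1 + 1)) - (1 + 4 * (v 0 + c) * v 1) = 0" by simp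
    also have "(1 + 4 * (v 0 + c) * (v 1 + 1)) - (1 + 4 * (v 0 + c) * v 1) = 4 * (v 0 + c)"
      by (simp add: algebra_simps)
    finally show False using c by (simp del: distrib_left_numeral)
  qed
  then obtain d where d: "d \<in> \<rat>" "1 + 4 * (v 0 + c) * (v 1 + d) \<noteq> 0" by blast
  define p where "p u = 1 + 4 * (u 0 + c) * (u 1 + d)" for u :: "nat \<Rightarrow> complex"
  define q where "q u = 1 + 4 * u 0 * u 1" for u :: "nat \<Rightarrow> complex"
  define \<phi> where "\<phi> u = graph_pt (u 0 + c) (u 1 + d)" for u :: "nat \<Rightarrow> complex"
  define \<psi> where "\<psi> u = pt (u 0 - c) (u 1 - d) 0" for u :: "nat \<Rightarrow> complex"
  have p: "polyfun 2 p" unfolding p_def by (intro polyfun_intros c d) auto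
  have q: "polyfun 3 q" unfolding q_def by (intro polyfun_intros) auto
  have \<phi>: "frac_fun (polyfun 2) p (\<lambda>x. \<phi> x i)" if "i < 3" for i
    unfolding \<phi>_def graph_pt_def
  proof (rule frac_pt[where C = "polyfun 2", OF fun_subring_polyfun p _ _ _ _ that])
    show "polyfun 2 (\<lambda>u. u 0 + c)" "polyfun 2 (\<lambda>u. u 1 + d)"
      by (intro polyfun_intros c d; simp)+
    show "polyfun 2 (\<lambda>u. (u 0 + c)\<^sup>2 + (u 1 + d)\<^sup>2)" by (intro polyfun_intros c d) auto
  qed (simp add: p_def)
  have \<psi>: "frac_fun (polyfun 3) q (\<lambda>x. \<psi> x i)" if "i < 2" for i
  proof -
    have "polyfun 3 (\<lambda>u. u 0 - c)" "polyfun 3 (\<lambda>u. u 1 - d)" by (intro polyfun_intros c d; simp)+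
    then show ?thesis
      using less_2_cases'[OF that] frac_funI0[where C = "polyfun 3" and q = q] by (auto simp: \<psi>_def)
  qed
  have "homeomorphic_maps (subtopology (zar 2 affine_plane) {u \<in> affine_plane. p u \<noteq> 0})
      (subtopology (zar 3 cubic_surface) {u \<in> cubic_surface. q u \<noteq> 0}) \<phi> \<psi>"
  proof (rule homeomorphic_maps_zar[OF p q \<phi> \<psi>])
    show "\<phi> u \<in> cubic_surface \<and> q (\<phi> u) \<noteq> 0 \<and> \<psi> (\<phi> u) = u" if "u \<in> affine_plane" "p u \<noteq> 0" for u
      using that graph_pt_in_surface[of "u 0 + c" "u 1 + d"] pt_eta2[of u]
      by (simp add: p_def q_def \<phi>_def \<psi>_def graph_pt_def)
    show "\<psi> u \<in> affine_plane \<and> p (\<psi> u) \<noteq> 0 \<and> \<phi> (\<psi> u) = u" if "u \<in> cubic_surface" "q u \<noteq> 0" for u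
      using that graph_pt_eq[of u] by (simp add: p_def q_def \<phi>_def \<psi>_def)
  qed
  moreover have "openin (zar 2 affine_plane) {u \<in> affine_plane. p u \<noteq> 0}" "openin (zar 3 cubic_surface) {u \<in> cubic_surface. q u \<noteq> 0}"
    using p q by (auto intro: openin_zar_polyfun)
  ultimately show "\<exists>U V f g. openin (zar 2 affine_plane) U \<and> v \<in> U \<and> openin (zar 3 cubic_surface) V \<and>
      homeomorphic_maps (subtopology (zar 2 affine_plane) U) (subtopology (zar 3 cubic_surface) V) f g"
    using v d(2) by (intro exI[of _ "{u \<in> affine_plane. p u \<noteq> 0}"] exI[of _ "{u \<in> cubic_surface. q u \<noteq> 0}"] exI conjI)
      (auto simp: p_def)
qed

definition polyinv :: "((nat \<Rightarrow> complex) \<Rightarrow> nat \<Rightarrow> complex) \<Rightarrow> bool" where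
  "polyinv \<theta> \<longleftrightarrow> (\<forall>i<3. polyfun 3 (\<lambda>v. \<theta> v i)) \<and> (\<forall>v\<in>cubic_surface. \<theta> v \<in> cubic_surface \<and> \<theta> (\<theta> v) = v)"

definition vieta_x :: "(nat \<Rightarrow> complex) \<Rightarrow> nat \<Rightarrow> complex" where
  "vieta_x v = pt (4 * v 2 * v 1 - v 0) (v 1) (v 2)"

definition vieta_y :: "(nat \<Rightarrow> complex) \<Rightarrow> nat \<Rightarrow> complex" where
  "vieta_y v = pt (v 0) (4 * v 2 * v 0 - v 1) (v 2)"

lemma polyinv_vieta: "polyinv vieta_x" "polyinv vieta_y"
proof -
  have p: "polyfun 3 (\<lambda>v. v 0)" "polyfun 3 (\<lambda>v. v 1)" "polyfun 3 (\<lambda>v. v 2)"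
      "polyfun 3 (\<lambda>v. 4 * v 2 * v 1 - v 0)" "polyfun 3 (\<lambda>v. 4 * v 2 * v 0 - v 1)"
    by (intro polyfun_intros; simp)+
  have "polyfun 3 (\<lambda>v. vieta_x v i)" "polyfun 3 (\<lambda>v. vieta_y v i)" if "i < 3" for i
    using less_3_cases[OF that] p by (auto simp: vieta_x_def vieta_y_def)
  moreover have "vieta_x v \<in> cubic_surface \<and> vieta_x (vieta_x v) = v" "vieta_y v \<in> cubic_surface \<and> vieta_y (vieta_y v) = v"
    if "v \<in> cubic_surface" for v
    using cubic_surface_eq[OF that] pt_eta[OF cubic_surface_imp_affine_space[OF that]]
    by (simp_all add: vieta_x_def vieta_y_def) (simp_all add: algebra_simps power2_eq_square)
  ultimately show "polyinv vieta_x" "polyinv vieta_y" by (auto simp: polyinv_def)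
qed

lemma polyinv_id: "polyinv (\<lambda>v. v)"
  by (auto simp: polyinv_def intro: polyfun_var)

text \<open>The graph chart and its images under the two jumps cover the surface. If 1 + 4xy
  vanished at a point and at both of its jumps, adding up would give 4 + 16t(x^2 + y^2) = 0, but x^2
  + y^2 = 0 wherever 1 + 4xy = 0.\<close>

lemma krull_dim_surface_le_plane: "krull_dim (zar 3 cubic_surface) \<le> krull_dim (zar 2 affine_plane)"
proof (rule krull_dim_le_local_homeomorphism)
  fix v assume "v \<in> topspace (zar 3 cubic_surface)"
  then have v: "v \<in> cubic_surface" by simp
  define b where "b u = 1 + 4 * u 0 * u 1" for u :: "nat \<Rightarrow> complex"
  have "\<exists>\<theta>. polyinv \<theta> \<and> b (\<theta> v) \<noteq> 0"
  proof (rule ccontr)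
    assume n: "\<not> ?thesis"
    have "b v = 0" "b (vieta_x v) = 0" "b (vieta_y v) = 0"
      using n polyinv_id polyinv_vieta by metis+
    moreover have "b v + b (vieta_x v) = 2 + 16 * v 2 * (v 1)\<^sup>2" "b v + b (vieta_y v) = 2 + 16 * v 2 * (v 0)\<^sup>2"
      by (simp_all add: b_def vieta_x_def vieta_y_def algebra_simps power2_eq_square)
    moreover have "4 + 16 * v 2 * ((v 0)\<^sup>2 + (v 1)\<^sup>2) = (2 + 16 * v 2 * (v 1)\<^sup>2) + (2 + 16 * v 2 * (v 0)\<^sup>2)"
      by (simp add: distrib_left)
    ultimately have "4 + 16 * v 2 * ((v 0)\<^sup>2 + (v 1)\<^sup>2) = 0"
      by (metis add.right_neutral)
    moreover have "(v 0)\<^sup>2 + (v 1)\<^sup>2 = 0" using cubic_surface_eq[OF v] \<open>b v = 0\<close> by (simp add: b_def)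
    ultimately show False by simp
  qed
  then obtain \<theta> where \<theta>: "polyinv \<theta>" "b (\<theta> v) \<noteq> 0" by blast
  then have \<theta>p: "\<And>i. i < 3 \<Longrightarrow> polyfun 3 (\<lambda>v. \<theta> v i)"
    and \<theta>_inv: "\<And>v. v \<in> cubic_surface \<Longrightarrow> \<theta> v \<in> cubic_surface" "\<And>v. v \<in> cubic_surface \<Longrightarrow> \<theta> (\<theta> v) = v"
    by (auto simp: polyinv_def)
  define p where "p u = b (\<theta> u)" for u
  define \<phi> where "\<phi> u = pt (\<theta> u 0) (\<theta> u 1) 0" for u
  define \<psi> where "\<psi> u = \<theta> (graph_pt (u 0) (u 1))" for u :: "nat \<Rightarrow> complex"
  have bp: "polyfun 2 b" unfolding b_def by (intro polyfun_intros) auto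
  have p: "polyfun 3 p" unfolding p_def b_def by (intro polyfun_intros \<theta>p) auto
  have \<phi>: "frac_fun (polyfun 3) p (\<lambda>x. \<phi> x i)" if "i < 2" for i
    using less_2_cases'[OF that] frac_funI0[where C = "polyfun 3" and q = p, OF \<theta>p] by (auto simp: \<phi>_def)
  have graph_pt: "frac_fun (polyfun 2) b (\<lambda>u. graph_pt (u 0) (u 1) i)" if "i < 3" for i
    unfolding graph_pt_def
  proof (rule frac_pt[where C = "polyfun 2", OF fun_subring_polyfun bp _ _ _ _ that])
    show "polyfun 2 (\<lambda>u. (u 0)\<^sup>2 + (u 1)\<^sup>2)" by (intro polyfun_intros) auto
  qed (auto simp: b_def intro: polyfun_var)
  have \<psi>: "frac_fun (polyfun 2) b (\<lambda>x. \<psi> x i)" if "i < 3" for i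
    unfolding \<psi>_def
    by (rule polyfun_compose[where C = "frac_fun (polyfun 2) b" and \<phi> = "\<lambda>u. graph_pt (u 0) (u 1)", OF \<theta>p[OF that]
          fun_subring_frac_fun[where C = "polyfun 2", OF fun_subring_polyfun bp]
          frac_funI0[where C = "polyfun 2", OF polyfun_const] graph_pt])
  have "homeomorphic_maps (subtopology (zar 3 cubic_surface) {u \<in> cubic_surface. p u \<noteq> 0})
      (subtopology (zar 2 affine_plane) {u \<in> affine_plane. b u \<noteq> 0}) \<phi> \<psi>"
  proof (rule homeomorphic_maps_zar[OF p bp \<phi> \<psi>])
    show "\<phi> u \<in> affine_plane \<and> b (\<phi> u) \<noteq> 0 \<and> \<psi> (\<phi> u) = u" if "u \<in> cubic_surface" "p u \<noteq> 0" for u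
      using that graph_pt_eq[OF \<theta>_inv(1)[OF that(1)]] \<theta>_inv(2)[OF that(1)] by (simp add: p_def b_def \<phi>_def \<psi>_def)
    show "\<psi> u \<in> cubic_surface \<and> p (\<psi> u) \<noteq> 0 \<and> \<phi> (\<psi> u) = u" if "u \<in> affine_plane" "b u \<noteq> 0" for u
    proof -
      have "graph_pt (u 0) (u 1) \<in> cubic_surface" using that by (simp add: graph_pt_in_surface b_def)
      then show ?thesis
        using \<theta>_inv that pt_eta2[OF that(1)] by (simp add: p_def \<phi>_def \<psi>_def b_def graph_pt_def)
    qed
  qed
  moreover have "openin (zar 3 cubic_surface) {u \<in> cubic_surface. p u \<noteq> 0}" "openin (zar 2 affine_plane) {u \<in> affine_plane. b u \<noteq> 0}"
    using p bp by (auto intro: openin_zar_polyfun)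
  ultimately show "\<exists>U V f g. openin (zar 3 cubic_surface) U \<and> v \<in> U \<and> openin (zar 2 affine_plane) V \<and>
      homeomorphic_maps (subtopology (zar 3 cubic_surface) U) (subtopology (zar 2 affine_plane) V) f g"
    using v \<theta>(2) by (intro exI[of _ "{u \<in> cubic_surface. p u \<noteq> 0}"] exI[of _ "{u \<in> affine_plane. b u \<noteq> 0}"] exI conjI)
      (auto simp: p_def)
qed

text \<open>For \<open>t = w\<^sup>2\<close>, projection from the point \<open>(0, w)\<close> parametrises the conic by the slope \<open>s\<close>.\<close>

definition conic_den :: "complex \<Rightarrow> complex \<Rightarrow> complex" where
  "conic_den w s = 1 + s\<^sup>2 - 4 * w\<^sup>2 * s"

definition conic_pt :: "complex \<Rightarrow> complex \<Rightarrow> nat \<Rightarrow> complex" where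
  "conic_pt w s = pt ((4 * w ^ 3 - 2 * w * s) / conic_den w s) (w + s * ((4 * w ^ 3 - 2 * w * s) / conic_den w s)) (w\<^sup>2)"

lemma conic_pt_in_surface:
  assumes "conic_den w s \<noteq> 0" shows "conic_pt w s \<in> cubic_surface"
proof -
  define x where "x = (4 * w ^ 3 - 2 * w * s) / conic_den w s"
  have "x * (1 + s\<^sup>2 - 4 * w\<^sup>2 * s) = 4 * w ^ 3 - 2 * w * s"
    using assms by (simp add: x_def conic_den_def)
  then have "x * (x * (1 + s\<^sup>2 - 4 * w\<^sup>2 * s) - (4 * w ^ 3 - 2 * w * s)) = 0" by simp
  then have "x\<^sup>2 + (w + s * x)\<^sup>2 = w\<^sup>2 * (1 + 4 * x * (w + s * x))"
    by (simp add: algebra_simps power_numeral_reduce)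
  then show ?thesis unfolding conic_pt_def x_def[symmetric] by simp
qed

text \<open>The condition on \<open>w\<close> says that the conic is nondegenerate. A vanishing
  denominator would make the numerator vanish too, so s = 2w^2, where the denominator equals 1 -
  4w^4.\<close>

lemma conic_pt_eq:
  assumes v: "v \<in> cubic_surface" "v 2 = w\<^sup>2" "v 0 \<noteq> 0" and ne: "w * (1 - 4 * w ^ 4) \<noteq> 0"
  defines "s \<equiv> (v 1 - w) / v 0"
  shows "conic_den w s \<noteq> 0" "conic_pt w s = v"
proof -
  have y: "v 1 = w + s * v 0" using v(3) by (simp add: s_def)
  have "v 0 * (v 0 * conic_den w s - (4 * w ^ 3 - 2 * w * s)) = (v 0)\<^sup>2 + (v 1)\<^sup>2 - v 2 * (1 + 4 * v 0 * v 1)"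
    unfolding y v(2) conic_den_def by (simp add: algebra_simps power_numeral_reduce)
  then have x: "v 0 * conic_den w s = 4 * w ^ 3 - 2 * w * s"
    using cubic_surface_eq[OF v(1)] v(3) by simp
  show d: "conic_den w s \<noteq> 0"
  proof
    assume d: "conic_den w s = 0"
    have "2 * w * (2 * w\<^sup>2 - s) = 4 * w ^ 3 - 2 * w * s" by (simp add: algebra_simps power_numeral_reduce)
    also have "\<dots> = 0" using x d by simp
    finally have "s = 2 * w\<^sup>2" using ne by simp
    then have "1 - 4 * w ^ 4 = 0" using d by (simp add: conic_den_def algebra_simps power_numeral_reduce)
    then show False using ne by simp
  qed
  then have "(4 * w ^ 3 - 2 * w * s) / conic_den w s = v 0" using x by (simp add: field_simps)
  then show "conic_pt w s = v"
    unfolding conic_pt_def using y v(2) pt_eta[OF cubic_surface_imp_affine_space[OF v(1)]] by simp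
qed

text \<open>Abstract in \<open>C\<close>, to cover both \<open>w\<close> and \<open>s\<close> as
  coordinates of the plane and either of them frozen at a complex number.\<close>

lemma frac_conic_pt:
  assumes C: "fun_subring C" and neg: "\<And>f g. C f \<Longrightarrow> C g \<Longrightarrow> C (\<lambda>a. f a - g a)"
    and num: "C (\<lambda>_. 2)" "C (\<lambda>_. 4)" and w: "C w" and s: "C s"
  shows "C (\<lambda>a. conic_den (w a) (s a))"
    "i < 3 \<Longrightarrow> frac_fun C (\<lambda>a. conic_den (w a) (s a)) (\<lambda>a. conic_pt (w a) (s a) i)"
proof -
  note mult = fun_subring_mult[where C = C, OF C] and add = fun_subring_add[where C = C, OF C]
    and pow = fun_subring_power[where C = C, OF C] and one = fun_subring_1[where C = C, OF C]
  have p: "C (\<lambda>a. 4 * w a ^ 3 - 2 * w a * s a)"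
    by (rule neg, rule mult, rule num(2), rule pow, rule w, rule mult, rule mult, rule num(1), rule w, rule s)
  show q: "C (\<lambda>a. conic_den (w a) (s a))"
    unfolding conic_den_def
    by (rule neg, rule add, rule one, rule pow, rule s, rule mult, rule mult, rule num(2), rule pow,
        rule w, rule s)
  let ?F = "frac_fun C (\<lambda>a. conic_den (w a) (s a))"
  note F = fun_subring_frac_fun[where C = C, OF C q]
  have x: "?F (\<lambda>a. (4 * w a ^ 3 - 2 * w a * s a) / conic_den (w a) (s a))"
    by (rule frac_fun_divide[where C = C, OF p])
  have y: "?F (\<lambda>a. w a + s a * ((4 * w a ^ 3 - 2 * w a * s a) / conic_den (w a) (s a)))"
    by (rule fun_subring_add[where C = ?F, OF F frac_funI0[where C = C, OF w]
          fun_subring_mult[where C = ?F, OF F frac_funI0[where C = C, OF s] x]])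
  have t: "?F (\<lambda>a. (w a)\<^sup>2)"
    by (rule frac_funI0[where C = C, OF pow[OF w]])
  show "?F (\<lambda>a. conic_pt (w a) (s a) i)" if "i < 3"
    using less_3_cases[OF that] x y t by (auto simp: conic_pt_def)
qed

lemmas frac_conic_pt_polyc = frac_conic_pt[where C = polyc, OF fun_subring_polyc polyc_diff polyc_const polyc_const]

lemma polyfun_conic_den: "polyfun 2 (\<lambda>v. conic_den (v 0) (v 1))"
  unfolding conic_den_def by (intro polyfun_intros) auto

lemma frac_conic_pt_polyfun:
  "i < 3 \<Longrightarrow> frac_fun (polyfun 2) (\<lambda>v. conic_den (v 0) (v 1)) (\<lambda>v. conic_pt (v 0) (v 1) i)"
  by (rule frac_conic_pt(2)[where C = "polyfun 2", OF fun_subring_polyfun polyfun_diff polyfun_const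
        polyfun_const polyfun_var polyfun_var]) auto

section \<open>Density\<close>

text \<open>Suppose \<open>f\<close> vanishes at all integral points but not at the point with
  parameters (w, s). Moving \<open>w\<close> with \<open>s\<close> fixed reaches a positive integer
  \<open>n\<close> such that \<open>f\<close> is not identically zero on the conic t = n^2. There it
  has finitely many zeros, but the conic has infinitely many integral points.\<close>

lemma zariski_dense_integral_points: "zariski_dense \<rat> (affine_variety 3 cubic_surface) (integral_points cubic_surface)"
proof -
  have key: "\<exists>v\<in>integral_points cubic_surface. f v \<noteq> 0" if f: "polyfun 3 f" and u: "u \<in> cubic_surface" "f u \<noteq> 0" for f u
  proof (rule ccontr)
    assume "\<not> ?thesis"
    then have zero: "\<And>v. v \<in> integral_points cubic_surface \<Longrightarrow> f v = 0" by blast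
    \<comment> \<open>Off the zeros of \<open>g\<close> the parametrisation can be inverted:
      \<open>v 0\<close> is nonzero and, for v 2 = w^2, the conic is nondegenerate.\<close>
    define g where "g v = v 0 * (v 2 * (1 - 4 * (v 2)\<^sup>2))" for v :: "nat \<Rightarrow> complex"
    have g: "polyfun 3 g" unfolding g_def by (intro polyfun_intros) auto
    have "graph_pt 1 0 \<in> cubic_surface" "g (graph_pt 1 0) \<noteq> 0" by (simp_all add: graph_pt_in_surface) (simp add: graph_pt_def g_def)
    then obtain v where v: "v \<in> cubic_surface" "f v \<noteq> 0" "g v \<noteq> 0"
      using zirreducibleD[OF zirreducible_cubic_surface f g u _ _] by metis
    define w0 where "w0 = csqrt (v 2)"
    define s0 where "s0 = (v 1 - w0) / v 0"
    have w0: "v 2 = w0\<^sup>2" by (simp add: w0_def)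
    have "w0 * (1 - 4 * w0 ^ 4) \<noteq> 0" "v 0 \<noteq> 0"
      using v(3) unfolding g_def w0 by (auto simp flip: power_mult)
    then have par0: "conic_den w0 s0 \<noteq> 0" "conic_pt w0 s0 = v"
      unfolding s0_def using conic_pt_eq[OF v(1) w0] by blast+
    have "finite {w. conic_den w s0 = 0 \<or> f (conic_pt w s0) = 0}"
      by (rule curve_cofinite[where \<gamma> = "\<lambda>w. conic_pt w s0" and a = w0, OF f])
         (use par0 v(2) in \<open>auto intro: frac_conic_pt_polyc polyc_id polyc_const\<close>)
    then have "finite ((of_int :: int \<Rightarrow> complex) -` {w. conic_den w s0 = 0 \<or> f (conic_pt w s0) = 0})"
      by (rule finite_vimageI) (auto intro: injI)
    moreover have "infinite {1 :: int..}" by (rule infinite_Ici)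
    ultimately have "infinite ({1..} - (of_int :: int \<Rightarrow> complex) -` {w. conic_den w s0 = 0 \<or> f (conic_pt w s0) = 0})"
      by (rule Diff_infinite_finite)
    then have "{1..} - (of_int :: int \<Rightarrow> complex) -` {w. conic_den w s0 = 0 \<or> f (conic_pt w s0) = 0} \<noteq> {}"
      by (metis finite.emptyI)
    then obtain n :: int where n: "n \<ge> 1" "conic_den (of_int n) s0 \<noteq> 0" "f (conic_pt (of_int n) s0) \<noteq> 0" by auto
    define w :: complex where "w = of_int n"
    have fin: "finite {s. conic_den w s = 0 \<or> f (conic_pt w s) = 0}"
      by (rule curve_cofinite[where \<gamma> = "\<lambda>s. conic_pt w s" and a = s0, OF f])
         (use n in \<open>auto intro: frac_conic_pt_polyc polyc_id polyc_const simp: w_def\<close>)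
    define X where "X = {x. x > 0 \<and> (\<exists>y. x\<^sup>2 + y\<^sup>2 = n\<^sup>2 * (4 * x * y + 1))}"
    \<comment> \<open>Distinct first coordinates come from distinct parameters, so an infinite
      \<open>X\<close> would need infinitely many exceptional parameters.\<close>
    have "of_int x \<in> (\<lambda>s. conic_pt w s 0) ` {s. conic_den w s = 0 \<or> f (conic_pt w s) = 0}" if x: "x \<in> X" for x
    proof -
      obtain y where xy: "x > 0" "x\<^sup>2 + y\<^sup>2 = n\<^sup>2 * (4 * x * y + 1)" using x by (auto simp: X_def)
      define p where "p = pt (of_int x) (of_int y) (w\<^sup>2)"
      have "(of_int (x\<^sup>2 + y\<^sup>2) :: complex) = of_int (n\<^sup>2 * (4 * x * y + 1))" using xy by simp
      then have p: "p \<in> cubic_surface" by (simp add: p_def w_def add.commute)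
      have "n * n * (n * n) \<ge> 1" using n(1) mult_mono[of 1 n 1 n] mult_mono[of 1 "n * n" 1 "n * n"] by simp
      then have "n * (1 - 4 * n ^ 4) \<noteq> 0" using n(1) by (simp add: power_numeral_reduce)
      then have "(of_int (n * (1 - 4 * n ^ 4)) :: complex) \<noteq> 0" by (simp only: of_int_eq_0_iff) simp
      then have "w * (1 - 4 * w ^ 4) \<noteq> 0" by (simp add: w_def)
      then have s: "conic_pt w ((p 1 - w) / p 0) = p"
        using conic_pt_eq(2)[OF p, of w] xy by (simp add: p_def)
      have "p i \<in> \<int>" for i by (auto simp: p_def pt_def w_def)
      then have "f p = 0" using p by (intro zero) (simp add: integral_points_def)
      then show ?thesis
        using s by (intro image_eqI[of _ _ "(p 1 - w) / p 0"]) (auto simp: p_def)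
    qed
    then have "(of_int :: int \<Rightarrow> complex) ` X \<subseteq> (\<lambda>s. conic_pt w s 0) ` {s. conic_den w s = 0 \<or> f (conic_pt w s) = 0}"
      by blast
    then have "finite ((of_int :: int \<Rightarrow> complex) ` X)" using fin by (meson finite_imageI finite_subset)
    then have "finite X" by (rule finite_imageD) (auto intro: inj_onI)
    then show False using infinite_integral_points_conic[OF n(1)] by (simp add: X_def)
  qed
  have sub: "integral_points cubic_surface \<subseteq> cubic_surface" by (auto simp: integral_points_def)
  moreover have "zar 3 cubic_surface closure_of integral_points cubic_surface = cubic_surface"
  proof (intro equalityI subsetI)
    fix x assume x: "x \<in> cubic_surface"
    have "\<exists>y. y \<in> integral_points cubic_surface \<and> y \<in> T" if T: "x \<in> T" "openin (zar 3 cubic_surface) T" for T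
    proof -
      obtain f where f: "polyfun 3 f" "f x \<noteq> 0" "{y \<in> cubic_surface. f y \<noteq> 0} \<subseteq> T"
        using openin_zar_imp[OF T(2,1)] by blast
      show ?thesis using key[OF f(1) x f(2)] sub f(3) by blast
    qed
    then show "x \<in> zar 3 cubic_surface closure_of integral_points cubic_surface"
      unfolding in_closure_of using x by simp
  qed (use closure_of_subset_topspace[of "zar 3 cubic_surface"] in auto)
  ultimately show ?thesis by (simp add: zariski_dense_def points_def affine_variety_def)
qed

section \<open>Thinness\<close>

lemma Rats_Ints: "z \<in> \<int> \<Longrightarrow> z \<in> (\<rat> :: complex set)"
  by (auto elim!: Ints_cases)

lemma points_affine_variety [simp]: "points (affine_variety n X) = X"
  by (simp add: points_def affine_variety_def)

lemma rational_points_affine [simp]: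
  "rational_points \<rat> (affine_variety n X) = {v \<in> X. \<forall>i. v i \<in> \<rat>}"
  by (auto simp: rational_points_def points_def affine_variety_def)

lemma cubic_surface_eq_zero_set: "cubic_surface = {v \<in> affine_space 3. \<forall>f\<in>{peval cubic}. f v = 0}"
  by (simp add: hypersurface_def)

lemma irreducible_variety_cubic_surface: "irreducible_variety \<rat> (affine_variety 3 cubic_surface)"
  unfolding irreducible_variety_def
proof
  show "variety \<rat> (affine_variety 3 cubic_surface)"
    by (rule variety_affine[OF _ cubic_surface_eq_zero_set]) (simp add: polyfun_peval cubic_polys)
  show "irreducible_closed (zar 3 cubic_surface) (points (affine_variety 3 cubic_surface))"
    using zirreducible_imp_irreducible_closed[OF zirreducible_cubic_surface] by simp
qed

lemma variety_affine_plane: "variety \<rat> (affine_variety 2 affine_plane)"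
  by (rule variety_affine[of "{}"]) auto

lemma krull_dim_eq: "krull_dim (zar 2 affine_plane) = krull_dim (zar 3 cubic_surface)"
  using krull_dim_plane_le_surface krull_dim_surface_le_plane by (rule antisym)

section \<open>The double cover as a rational map from the plane\<close>

definition cover_dom :: "(nat \<Rightarrow> complex) set" where
  "cover_dom = {v \<in> affine_plane. conic_den (v 0) (v 1) \<noteq> 0}"

definition cover_map :: "(nat \<Rightarrow> complex) \<Rightarrow> nat \<Rightarrow> complex" where
  "cover_map v = conic_pt (v 0) (v 1)"

lemma openin_cover_dom: "openin (zar 2 affine_plane) cover_dom"
  unfolding cover_dom_def by (rule openin_zar_polyfun[OF polyfun_conic_den])

lemma cover_map_in_surface: "v \<in> cover_dom \<Longrightarrow> cover_map v \<in> cubic_surface"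
  by (simp add: cover_dom_def cover_map_def conic_pt_in_surface)

lemma rational_map_cover_map: "rational_map \<rat> (affine_variety 2 affine_plane) (affine_variety 3 cubic_surface) cover_dom cover_map"
  unfolding rational_map_def
proof (intro conjI openin_cover_dom)
  have "pt 0 0 0 \<in> cover_dom" by (simp add: cover_dom_def conic_den_def)
  then show "zariski_dense \<rat> (affine_variety 2 affine_plane) cover_dom"
    by (intro zirreducible_open_dense zirreducible_affine_space openin_cover_dom) auto
  have "{x \<in> cover_dom. cover_map x \<in> cubic_surface} = cover_dom" using cover_map_in_surface by auto
  moreover have "regular_on \<rat> (affine_variety 2 affine_plane) cover_dom (\<lambda>x. cover_map x i)" if "i < 3" for i
    unfolding cover_map_def by (rule regular_on_frac[OF polyfun_conic_den frac_conic_pt_polyfun[OF that]]) (simp add: cover_dom_def)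
  ultimately show "morphism_on \<rat> (affine_variety 2 affine_plane) cover_dom (affine_variety 3 cubic_surface) cover_map"
    unfolding morphism_on_def using cover_map_in_surface openin_cover_dom
    by (auto simp: points_def affine_variety_def[of 3])
qed

text \<open>Vieta jumping makes the square root of \<open>t\<close> an integer, and then the slope
  is rational. Every integral point has to be reached, not just almost all of them.\<close>

lemma integral_points_subset_image: "integral_points cubic_surface \<subseteq> cover_map ` {v \<in> cover_dom. \<forall>i. v i \<in> \<rat>}"
proof
  fix v assume v: "v \<in> integral_points cubic_surface"
  then have vS: "v \<in> cubic_surface" and "\<And>i. v i \<in> \<int>" by (auto simp: integral_points_def)
  then obtain x y t :: int where xyt: "v 0 = of_int x" "v 1 = of_int y" "v 2 = of_int t"
    by (metis Ints_cases)
  have "(of_int (x\<^sup>2 + y\<^sup>2) :: complex) = of_int (t * (4 * x * y + 1))"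
    using cubic_surface_eq[OF vS] unfolding xyt by (simp add: add.commute)
  then have "x\<^sup>2 + y\<^sup>2 = t * (4 * x * y + 1)" by (simp only: of_int_eq_iff)
  then obtain n where n: "t = n\<^sup>2" using vieta_jumping_square by blast
  have imgI: "v \<in> cover_map ` {v \<in> cover_dom. \<forall>i. v i \<in> \<rat>}"
    if "w \<in> \<rat>" "s \<in> \<rat>" "conic_den w s \<noteq> 0" "conic_pt w s = v" for w s
  proof (rule image_eqI[of _ _ "pt w s 0"])
    show "pt w s 0 \<in> {v \<in> cover_dom. \<forall>i. v i \<in> \<rat>}"
      using that by (auto simp: cover_dom_def) (simp add: pt_def)
  qed (use that in \<open>simp add: cover_map_def\<close>)
  have vpt: "v = pt (of_int x) (of_int y) (of_int t)"
    using pt_eta[OF cubic_surface_imp_affine_space[OF vS]] unfolding xyt by simp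
  show "v \<in> cover_map ` {v \<in> cover_dom. \<forall>i. v i \<in> \<rat>}"
  proof (cases "x = 0 \<or> n = 0")
    case False
    define w :: complex where "w = of_int n"
    \<comment> \<open>An odd number is nonzero: for integral w the conic degenerates at w = 0
      only.\<close>
    have n4: "1 - 4 * n ^ 4 \<noteq> 0" by presburger
    then have "(of_int (n * (1 - 4 * n ^ 4)) :: complex) \<noteq> 0" using False by (simp only: of_int_eq_0_iff) simp
    then have "w * (1 - 4 * w ^ 4) \<noteq> 0" by (simp add: w_def)
    then have "conic_den w ((v 1 - w) / v 0) \<noteq> 0" "conic_pt w ((v 1 - w) / v 0) = v"
      using conic_pt_eq[OF vS, of w] False by (auto simp: xyt(1,3) n w_def)
    then show ?thesis by (intro imgI) (auto simp: w_def xyt(1) xyt(2)[unfolded One_nat_def])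
  next
    case True
    text \<open>The base point of the projection is reached along the tangent, of slope \<open>2w\<^sup>2\<close>; its mirror
      image \<open>(0, -w)\<close> is the base point for \<open>-w\<close>.\<close>
    have "\<exists>w. x = 0 \<and> y = w \<and> t = w\<^sup>2"
    proof (cases "x = 0")
      case True
      then show ?thesis using \<open>x\<^sup>2 + y\<^sup>2 = t * (4 * x * y + 1)\<close> by auto
    next
      case False
      then have "n = 0" using True by simp
      then have "x\<^sup>2 + y\<^sup>2 = 0" using \<open>x\<^sup>2 + y\<^sup>2 = t * (4 * x * y + 1)\<close> n by simp
      then show ?thesis using False by (simp add: sum_power2_eq_zero_iff)
    qed
    then obtain m where m: "x = 0" "y = m" "t = m\<^sup>2" by blast
    define w :: complex where "w = of_int m"
    have "1 - 4 * m ^ 4 \<noteq> 0" by presburger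
    then have "(of_int (1 - 4 * m ^ 4) :: complex) \<noteq> 0" by (simp only: of_int_eq_0_iff) simp
    then have d: "conic_den w (2 * w\<^sup>2) \<noteq> 0"
      by (simp add: conic_den_def w_def power_mult_distrib flip: power_mult power_add)
    moreover have "conic_pt w (2 * w\<^sup>2) = v"
      unfolding vpt m by (simp add: conic_pt_def w_def power_numeral_reduce)
    ultimately show ?thesis by (intro imgI) (auto simp: w_def)
  qed
qed

text \<open>\<open>q\<close> and \<open>r\<close> cut out a nonempty open set on which
  \<open>t\<close> is supposed to be a square. On a suitable curve \<open>t\<close> has a simple
  pole, and there the orders of the two sides differ in parity.\<close>

lemma no_square_root_on_surface:
  assumes p: "polyfun 3 p" and q: "polyfun 3 q" and r: "polyfun 3 r" and v: "v \<in> cubic_surface" "q v \<noteq> 0" "r v \<noteq> 0"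
    and eq: "\<And>u. u \<in> cubic_surface \<Longrightarrow> q u \<noteq> 0 \<Longrightarrow> r u \<noteq> 0 \<Longrightarrow> (p u)\<^sup>2 = u 2 * (q u)\<^sup>2"
  shows False
proof -
  \<comment> \<open>Its nonvanishing keeps \<open>x\<close>, \<open>y\<close> and x^2 + y^2 away
    from 0; for c = x/y both \<open>c\<close> and 1 + c^2 are then nonzero.\<close>
  define g where "g u = u 0 * u 1 * ((u 0)\<^sup>2 + (u 1)\<^sup>2)" for u :: "nat \<Rightarrow> complex"
  have g: "polyfun 3 g" unfolding g_def by (intro polyfun_intros) auto
  have qr: "polyfun 3 (\<lambda>u. q u * r u)" using q r by (rule polyfun_mult)
  have "graph_pt 1 1 \<in> cubic_surface" "g (graph_pt 1 1) \<noteq> 0" by (simp_all add: graph_pt_in_surface) (simp add: graph_pt_def g_def)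
  then obtain u0 where u0: "u0 \<in> cubic_surface" "q u0 * r u0 \<noteq> 0" "g u0 \<noteq> 0"
    using zirreducibleD[OF zirreducible_cubic_surface qr g v(1)] v by (metis no_zero_divisors)
  have gqr: "polyfun 3 (\<lambda>u. g u * (q u * r u))" using g qr by (rule polyfun_mult)
  obtain x0 y0 where xy0: "1 + 4 * x0 * y0 \<noteq> 0" "g (graph_pt x0 y0) * (q (graph_pt x0 y0) * r (graph_pt x0 y0)) \<noteq> 0"
    using nonzero_on_graph[OF gqr u0(1)] u0(2,3) by auto
  then have nz: "x0 \<noteq> 0" "y0 \<noteq> 0" "x0\<^sup>2 + y0\<^sup>2 \<noteq> 0" by (auto simp: g_def graph_pt_def)
  text \<open>On the curve \<open>x = c y\<close> in the surface one has \<open>(1 + 4 c y\<^sup>2) t = (1 + c\<^sup>2) y\<^sup>2\<close>, and \<open>1 + 4 c y\<^sup>2\<close> has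
    a simple zero.\<close>
  define c where "c = x0 / y0"
  have c: "c \<noteq> 0" "x0 = c * y0" using nz by (simp_all add: c_def)
  have "x0\<^sup>2 + y0\<^sup>2 = (1 + c\<^sup>2) * y0\<^sup>2" by (simp add: c(2) algebra_simps)
  then have c2: "1 + c\<^sup>2 \<noteq> 0" using nz by auto
  define d where "d = [:1, 0, 4 * c:]"
  have dq: "poly d y = 1 + 4 * (c * y) * y" for y by (simp add: d_def algebra_simps)
  define \<gamma> where "\<gamma> y = graph_pt (c * y) y" for y
  have xy: "polyc (\<lambda>y. c * y)" "polyc (\<lambda>y. y)" by (intro polyc_intros)+
  have dp: "polyc (\<lambda>y. 1 + 4 * (c * y) * y)" by (rule polyc_graph_pt(1)[OF xy])
  have \<gamma>: "i < 3 \<Longrightarrow> frac_fun polyc (\<lambda>y. 1 + 4 * (c * y) * y) (\<lambda>y. \<gamma> y i)" for i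
    unfolding \<gamma>_def by (rule polyc_graph_pt(2)[OF xy])
  have pull: "\<exists>N a. \<forall>y. poly d y \<noteq> 0 \<longrightarrow> f (\<gamma> y) * poly d y ^ N = poly a y" if "polyfun 3 f" for f
  proof -
    have "frac_fun polyc (\<lambda>y. 1 + 4 * (c * y) * y) (\<lambda>y. f (\<gamma> y))"
      by (rule polyfun_compose[where C = "frac_fun polyc (\<lambda>y. 1 + 4 * (c * y) * y)", OF that
            fun_subring_frac_fun[where C = polyc, OF fun_subring_polyc dp]
            frac_funI0[where C = polyc, OF polyc_const] \<gamma>])
    then obtain N h where h: "polyc h" "\<forall>y. 1 + 4 * (c * y) * y \<noteq> 0 \<longrightarrow> f (\<gamma> y) * (1 + 4 * (c * y) * y) ^ N = h y"
      unfolding frac_fun_def by blast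
    then obtain a where "h = poly a" by (auto simp: polyc_def)
    then show ?thesis using h(2) unfolding dq by blast
  qed
  obtain N a where a: "\<forall>y. poly d y \<noteq> 0 \<longrightarrow> p (\<gamma> y) * poly d y ^ N = poly a y" using pull[OF p] by blast
  obtain M b where b: "\<forall>y. poly d y \<noteq> 0 \<longrightarrow> q (\<gamma> y) * poly d y ^ M = poly b y" using pull[OF q] by blast
  have \<gamma>0: "\<gamma> y0 = graph_pt x0 y0" by (simp add: \<gamma>_def c(2))
  have d0: "poly d y0 \<noteq> 0" using xy0(1) by (simp add: dq c(2))
  have b0: "poly b y0 \<noteq> 0" using b d0 xy0(2) \<gamma>0 by (metis mult_eq_0_iff power_not_zero)
  have fin: "finite {y. 1 + 4 * (c * y) * y = 0 \<or> (\<lambda>u. q u * r u) (\<gamma> y) = 0}"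
    by (rule curve_cofinite[where \<gamma> = \<gamma> and a = y0, OF qr dp \<gamma>]) (use d0 xy0(2) \<gamma>0 in \<open>auto simp: dq\<close>)
  \<comment> \<open>The equation p^2 = t q^2 on the curve with denominators cleared, for p = a/d^N,
    q = b/d^M and t = (1 + c^2) y^2/d. The single \<open>d\<close> below \<open>t\<close> makes the
    exponent of \<open>d\<close> in \<open>A\<close> odd.\<close>
  define A where "A = a\<^sup>2 * d ^ (2 * M + 1)"
  define B where "B = smult (1 + c\<^sup>2) ([:0, 1:]\<^sup>2 * b\<^sup>2 * d ^ (2 * N))"
  have AB: "poly (A - B) y = 0" if y: "1 + 4 * (c * y) * y \<noteq> 0" "q (\<gamma> y) * r (\<gamma> y) \<noteq> 0" for y
  proof -
    have dy: "poly d y \<noteq> 0" using y by (simp add: dq)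
    have "\<gamma> y \<in> cubic_surface" unfolding \<gamma>_def using y by (intro graph_pt_in_surface)
    then have root: "(p (\<gamma> y))\<^sup>2 = \<gamma> y 2 * (q (\<gamma> y))\<^sup>2" using y eq by simp
    have \<gamma>2: "\<gamma> y 2 * poly d y = (1 + c\<^sup>2) * y\<^sup>2"
      using dy by (simp add: \<gamma>_def graph_pt_def dq) (simp add: algebra_simps)
    have "poly A y = (p (\<gamma> y))\<^sup>2 * poly d y * poly d y ^ (2 * N + 2 * M)"
    proof -
      have "poly a y = p (\<gamma> y) * poly d y ^ N" using a dy by simp
      then show ?thesis by (simp add: A_def power_mult_distrib power_add power_mult algebra_simps)
    qed
    also have "\<dots> = (\<gamma> y 2 * poly d y) * (q (\<gamma> y))\<^sup>2 * poly d y ^ (2 * N + 2 * M)"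
      unfolding root by (simp only: ac_simps)
    also have "\<dots> = (1 + c\<^sup>2) * y\<^sup>2 * (q (\<gamma> y))\<^sup>2 * poly d y ^ (2 * N + 2 * M)"
      unfolding \<gamma>2 ..
    also have "\<dots> = poly B y"
    proof -
      have "poly b y = q (\<gamma> y) * poly d y ^ M" using b dy by simp
      then show ?thesis by (simp add: B_def power_mult_distrib power_add power_mult algebra_simps)
    qed
    finally show ?thesis by simp
  qed
  have "finite {y. poly (A - B) y \<noteq> 0}"
    by (rule finite_subset[OF _ fin]) (use AB in blast)
  moreover have "infinite ({y. poly (A - B) y \<noteq> 0} \<union> {y. poly (A - B) y = 0})"
    using infinite_UNIV_char_0[where 'a = complex] by (simp add: Un_def excluded_middle)
  ultimately have "infinite {y. poly (A - B) y = 0}" by blast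
  then have AB: "A = B" using poly_roots_finite[of "A - B"] by auto
  \<comment> \<open>A zero of \<open>d\<close>, simple because the other zero is -z and z \<noteq>
    0, and not a zero of y^2.\<close>
  define z where "z = csqrt (- 1 / (4 * c))"
  have z2: "z\<^sup>2 = - 1 / (4 * c)" by (simp add: z_def)
  then have z0: "z \<noteq> 0" using c by auto
  have dz: "d = smult (4 * c) ([:- z, 1:] * [:z, 1:])"
    using c z2 by (simp add: d_def power2_eq_square)
  have "b \<noteq> 0" "d \<noteq> 0" using b0 d0 by auto
  then have "B \<noteq> 0" using c2 by (simp add: B_def)
  then have "a \<noteq> 0" using AB by (auto simp: A_def)
  have ord1: "order z [:- z, 1:] = 1" using order_power_n_n[of z 1] by simp
  have ord_d: "order z d = 1"
  proof -
    have "order z d = order z ([:- z, 1:] * [:z, 1:])" unfolding dz by (rule order_smult) (use c in simp)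
    also have "\<dots> = order z [:- z, 1:] + order z [:z, 1:]" by (rule order_mult) simp
    also have "order z [:z, 1:] = 0" using z0 by (intro order_0I) simp
    finally show ?thesis using ord1 by simp
  qed
  have ord_pow: "order z (h ^ k) = k * order z h" if "h \<noteq> 0" for h :: "complex poly" and k
    using that by (induction k) (simp_all add: order_mult)
  have "order z A = order z (a\<^sup>2) + order z (d ^ (2 * M + 1))"
    unfolding A_def by (rule order_mult) (use \<open>a \<noteq> 0\<close> \<open>d \<noteq> 0\<close> in simp)
  moreover have "order z B = order z ([:0, 1:]\<^sup>2 * b\<^sup>2) + order z (d ^ (2 * N))"
    unfolding B_def using c2 \<open>b \<noteq> 0\<close> \<open>d \<noteq> 0\<close> by (simp add: order_smult order_mult)
  moreover have "order z ([:0, 1:]\<^sup>2 * b\<^sup>2) = order z ([:0, 1:]\<^sup>2) + order z (b\<^sup>2)"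
    by (rule order_mult) (use \<open>b \<noteq> 0\<close> in simp)
  moreover have "order z ([:0, 1:]\<^sup>2) = 0" using z0 by (intro order_0I) simp
  ultimately have "2 * order z a + (2 * M + 1) = 2 * order z b + 2 * N"
    using AB ord_pow[OF \<open>a \<noteq> 0\<close>] ord_pow[OF \<open>b \<noteq> 0\<close>] ord_pow[OF \<open>d \<noteq> 0\<close>] ord_d by (simp only:) simp
  then show False by presburger
qed

text \<open>The first coordinate of a section would be a square root of \<open>t\<close> on an open
  part of the surface.\<close>

lemma no_rational_section:
  "\<not> has_rational_section \<rat> (affine_variety 2 affine_plane) (affine_variety 3 cubic_surface) cover_dom cover_map"
proof
  assume "has_rational_section \<rat> (affine_variety 2 affine_plane) (affine_variety 3 cubic_surface) cover_dom cover_map"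
  then obtain V s U' f' where s: "rational_map \<rat> (affine_variety 3 cubic_surface) (affine_variety 2 affine_plane) V s"
    and f': "represents_same \<rat> (affine_variety 2 affine_plane) (affine_variety 3 cubic_surface) cover_dom cover_map U' f'"
    and sV: "s ` V \<subseteq> U'" and sec: "\<forall>y\<in>V. f' (s y) = y"
    unfolding has_rational_section_def by blast
  have V: "openin (zar 3 cubic_surface) V" "zariski_dense \<rat> (affine_variety 3 cubic_surface) V"
    and mV: "morphism_on \<rat> (affine_variety 3 cubic_surface) V (affine_variety 2 affine_plane) s"
    using s by (auto simp: rational_map_def)
  have U': "openin (zar 2 affine_plane) U'" and mU: "morphism_on \<rat> (affine_variety 2 affine_plane) U' (affine_variety 3 cubic_surface) f'"
    and agree: "\<And>x. x \<in> cover_dom \<Longrightarrow> x \<in> U' \<Longrightarrow> cover_map x = f' x"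
    using f' by (auto simp: represents_same_def rational_map_def)
  have VS: "V \<subseteq> cubic_surface" using openin_subset[OF V(1)] by simp
  have U'A: "U' \<subseteq> affine_plane" using openin_subset[OF U'] by simp
  have imf': "f' ` U' \<subseteq> cubic_surface" and regU: "regular_on \<rat> (affine_variety 2 affine_plane) {x \<in> U'. f' x \<in> cubic_surface} (\<lambda>x. f' x 2)"
    using mU unfolding morphism_on_def by (auto simp: affine_variety_def[of 3] points_def)
  have eqU: "{x \<in> U'. f' x \<in> cubic_surface} = U'" using imf' by auto
  \<comment> \<open>\<open>f'\<close> is known to agree with the cover only on
    \<open>cover_dom\<close>, but the section may take values outside it; the relation t = w^2
    extends to all of \<open>U'\<close> because the plane is irreducible.\<close>
  have sq: "f' x 2 = (x 0)\<^sup>2" if x: "x \<in> U'" for x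
  proof (rule ccontr)
    assume ne: "f' x 2 \<noteq> (x 0)\<^sup>2"
    obtain p q where pq: "polyfun 2 p" "polyfun 2 q" "q x \<noteq> 0" "\<And>y. y \<in> U' \<Longrightarrow> q y \<noteq> 0 \<Longrightarrow> f' y 2 = p y / q y"
      using regular_on_imp[OF regU[unfolded eqU] U'A x] by metis
    \<comment> \<open>On \<open>U'\<close>, \<open>h\<close> is nonzero exactly where the local
      fraction for \<open>f'\<close> is defined and violates the relation, which is an open
      condition.\<close>
    define h where "h y = (p y - (y 0)\<^sup>2 * q y) * q y" for y
    have "polyfun 2 h" unfolding h_def using pq by (intro polyfun_intros) auto
    then have "openin (zar 2 affine_plane) {y \<in> affine_plane. h y \<noteq> 0}" by (rule openin_zar_polyfun)
    then have o: "openin (zar 2 affine_plane) ({y \<in> affine_plane. h y \<noteq> 0} \<inter> U')" using U' by (rule openin_Int)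
    have "f' x 2 = p x / q x" using pq x by blast
    then have "p x \<noteq> (x 0)\<^sup>2 * q x" using ne pq(3) by (auto simp: field_simps)
    then have "h x \<noteq> 0" using pq(3) by (simp add: h_def)
    then have "x \<in> {y \<in> affine_plane. h y \<noteq> 0} \<inter> U'" using x U'A by auto
    moreover have "cover_dom \<noteq> {}"
    proof -
      have "pt 0 0 0 \<in> cover_dom" by (simp add: cover_dom_def conic_den_def)
      then show ?thesis by blast
    qed
    ultimately have "({y \<in> affine_plane. h y \<noteq> 0} \<inter> U') \<inter> cover_dom \<noteq> {}"
      by (intro zirreducible_open_Int[OF zirreducible_affine_space o _ openin_cover_dom]) auto
    then obtain y where y: "h y \<noteq> 0" "y \<in> U'" "y \<in> cover_dom" by blast
    then have "q y \<noteq> 0" by (auto simp: h_def)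
    have "f' y 2 = (y 0)\<^sup>2" using agree[OF y(3,2), symmetric] by (simp add: cover_map_def conic_pt_def)
    then have "p y = (y 0)\<^sup>2 * q y" using pq(4)[OF y(2) \<open>q y \<noteq> 0\<close>] \<open>q y \<noteq> 0\<close> by (simp add: field_simps)
    then show False using y by (simp add: h_def)
  qed
  have sA: "s ` V \<subseteq> affine_plane" and regV: "regular_on \<rat> (affine_variety 3 cubic_surface) {x \<in> V. s x \<in> affine_plane} (\<lambda>x. s x 0)"
    using mV unfolding morphism_on_def by (auto simp: affine_variety_def[of 2] points_def)
  have eqV: "{x \<in> V. s x \<in> affine_plane} = V" using sA by auto
  have root: "(s y 0)\<^sup>2 = y 2" if "y \<in> V" for y
    using sq[of "s y"] sV sec that by auto
  have "V \<noteq> {}"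
  proof
    assume "V = {}"
    then have "cubic_surface = {}" using V(2) by (simp add: zariski_dense_def)
    then show False using zirreducible_cubic_surface by (simp add: zirreducible_def)
  qed
  then obtain v where v: "v \<in> V" by blast
  obtain p q where pq: "polyfun 3 p" "polyfun 3 q" "q v \<noteq> 0" "\<And>y. y \<in> V \<Longrightarrow> q y \<noteq> 0 \<Longrightarrow> s y 0 = p y / q y"
    using regular_on_imp[OF regV[unfolded eqV] VS v] by metis
  obtain r where r: "polyfun 3 r" "r v \<noteq> 0" "{y \<in> cubic_surface. r y \<noteq> 0} \<subseteq> V"
    using openin_zar_imp[OF V(1) v] by blast
  show False
  proof (rule no_square_root_on_surface[OF pq(1,2) r(1) _ pq(3) r(2)])
    show "v \<in> cubic_surface" using v VS by blast
    fix u assume u: "u \<in> cubic_surface" "q u \<noteq> 0" "r u \<noteq> 0"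
    then have "u \<in> V" using r(3) by blast
    then have "(p u / q u)\<^sup>2 = u 2" using root pq(4) u by metis
    then show "(p u)\<^sup>2 = u 2 * (q u)\<^sup>2" using u(2) by (simp add: power_divide field_simps)
  qed
qed

lemma thin_integral_points: "thin \<rat> (affine_variety 3 cubic_surface) (integral_points cubic_surface)"
  unfolding thin_def
proof (intro conjI exI)
  show "irreducible_variety \<rat> (affine_variety 3 cubic_surface)" by (rule irreducible_variety_cubic_surface)
  show "integral_points cubic_surface \<subseteq> rational_points \<rat> (affine_variety 3 cubic_surface)"
    by (auto simp: integral_points_def intro: Rats_Ints)
  show "variety \<rat> (affine_variety 2 affine_plane)" by (rule variety_affine_plane)
  show "krull_dim (zar 2 affine_plane) = krull_dim (zar 3 cubic_surface)" by (rule krull_dim_eq)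
  show "rational_map \<rat> (affine_variety 2 affine_plane) (affine_variety 3 cubic_surface) cover_dom cover_map" by (rule rational_map_cover_map)
  show "\<not> has_rational_section \<rat> (affine_variety 2 affine_plane) (affine_variety 3 cubic_surface) cover_dom cover_map"
    by (rule no_rational_section)
  have "represents_same \<rat> (affine_variety 2 affine_plane) (affine_variety 3 cubic_surface) cover_dom cover_map cover_dom cover_map"
    using rational_map_cover_map by (simp add: represents_same_def)
  moreover have "cover_dom \<subseteq> affine_plane" by (auto simp: cover_dom_def)
  ultimately have "cover_map ` {v \<in> cover_dom. \<forall>i. v i \<in> \<rat>}
      \<subseteq> rational_image \<rat> (affine_variety 2 affine_plane) (affine_variety 3 cubic_surface) cover_dom cover_map"
    unfolding rational_image_def by auto
  then show "integral_points cubic_surface \<subseteq> rational_image \<rat> (affine_variety 2 affine_plane) (affine_variety 3 cubic_surface) cover_dom cover_map"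
    using integral_points_subset_image by blast
qed

theorem theorem1p9:
  shows "\<exists>(F :: mpoly) S.
    F \<in> polys \<rat> 3 \<and> total_degree F = 3 \<and> S = hypersurface 3 F \<and>
    smooth_hypersurface 3 F \<and> simply_connected S \<and>
    zariski_dense \<rat> (affine_variety 3 S) (integral_points S) \<and>
    thin \<rat> (affine_variety 3 S) (integral_points S)"
  by (intro exI[of _ cubic] exI[of _ cubic_surface] conjI refl cubic_polys total_degree_cubic smooth_cubic
      simply_connected_cubic_surface zariski_dense_integral_points thin_integral_points)

end
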